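(* Let $d,n\in\mathbb{N}_{\ge1}$, $0<\alpha<\beta\le1$, $I=[0,1]$, and let $u\in L^1(I,C^{n,\beta}_0(\mathbb{R}^d,\mathbb{R}^d))$ (Bochner integrable). Then $u$ has a unique strong $\mathcal{D}^{n,\alpha}$-flow $\Phi$.
   Context: $C^{n,\alpha}_0(\mathbb{R}^d,\mathbb{R}^d)$ is the Banach space of $C^n$-maps $f:\mathbb{R}^d\to\mathbb{R}^d$ with $f^{(l)}(x)\to0$ as $\|x\|\to\infty$ for $0\le l\le n$ and $\|f\|_{n,\alpha}:=\max\{\sup_{x,\,0\le l\le n}\|f^{(l)}(x)\|,\ \sup_{x\ne y}\|f^{(n)}(x)-f^{(n)}(y)\|/\|x-y\|^\alpha\}<\infty$. $\mathcal{D}^{n,\alpha}(\mathbb{R}^d):=\{\Phi\in\mathrm{Id}+C^{n,\alpha}_0(\mathbb{R}^d,\mathbb{R}^d):\det d\Phi(x)>0\ \forall x\}$ with metric $\|\Phi_1-\Phi_2\|_{n,\alpha}$. A strong $\mathcal{D}^{n,\alpha}$-flow of $u$ is a continuous map $\Phi:I\to\mathcal{D}^{n,\alpha}(\mathbb{R}^d)$ such that for all $t\in I$, $\Phi(t)=\mathrm{Id}+\int_0^tu(s)\circ\Phi(s)\,ds$ in $\mathcal{D}^{n,\alpha}(\mathbb{R}^d)$, where the integral is a Bochner integral in $C^{n,\alpha}_0(\mathbb{R}^d,\mathbb{R}^d)$ (in particular, the integrand is required to be Bochner integrable). *)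

theory Defs
  imports "HOL-Analysis.Analysis" "HOL-Library.Function_Algebras"
begin

section \<open>Functions as a real vector space\<close>

instantiation "fun" :: (type, real_vector) real_vector
begin

definition scaleR_fun :: "real \<Rightarrow> ('a \<Rightarrow> 'b) \<Rightarrow> 'a \<Rightarrow> 'b" where
  "scaleR_fun c f = (\<lambda>x. c *\<^sub>R f x)"

instance
  by standard (simp_all add: scaleR_fun_def fun_eq_iff scaleR_add_right scaleR_add_left)

end

lemma scaleR_fun_apply [simp]: "(c *\<^sub>R f) x = c *\<^sub>R f x"
  by (simp add: scaleR_fun_def)


section \<open>Bochner integration in a normed space given by a carrier\<close>

text \<open>The Bochner integral of \<^theory>\<open>HOL-Analysis.Bochner_Integration\<close> is for functions with
  values in a type of class \<open>second_countable_topology\<close>. The spaces needed below are non-separable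
  and depend on the parameters \<open>n\<close> and \<open>\<alpha>\<close>, so they are not types. Hence the target
  space is a subspace \<open>E\<close> of a real vector space, together with a norm \<open>N\<close>. The norm is
  extended-real-valued, and finite on \<open>E\<close>.

  The following notions are the usual ones for general Banach spaces. They are meant for
  complete measures, for which an a.e. limit of measurable functions is measurable; in particular
  the integrand of the nonnegative integral below is then measurable.\<close>

definition strongly_measurable_in ::
    "'v::real_vector set \<Rightarrow> ('v \<Rightarrow> ennreal) \<Rightarrow> 'a measure \<Rightarrow> ('a \<Rightarrow> 'v) \<Rightarrow> bool" where
  "strongly_measurable_in E N M f \<longleftrightarrow>
     (\<forall>x\<in>space M. f x \<in> E) \<and>
     (\<exists>s. (\<forall>i. simple_function M (s i) \<and> s i ` space M \<subseteq> E) \<and>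
          (AE x in M. (\<lambda>i::nat. N (f x - s i x)) \<longlonglongrightarrow> 0))"

definition has_bochner_integral_in ::
    "'v::real_vector set \<Rightarrow> ('v \<Rightarrow> ennreal) \<Rightarrow> 'a measure \<Rightarrow> ('a \<Rightarrow> 'v) \<Rightarrow> 'v \<Rightarrow> bool" where
  "has_bochner_integral_in E N M f v \<longleftrightarrow>
     strongly_measurable_in E N M f \<and> v \<in> E \<and>
     (\<exists>s. (\<forall>i. Bochner_Integration.simple_bochner_integrable M (s i) \<and> s i ` space M \<subseteq> E) \<and>
          (\<lambda>i::nat. \<integral>\<^sup>+x. N (f x - s i x) \<partial>M) \<longlonglongrightarrow> 0 \<and>
          (\<lambda>i. N (Bochner_Integration.simple_bochner_integral M (s i) - v)) \<longlonglongrightarrow> 0)"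

definition bochner_integrable_in ::
    "'v::real_vector set \<Rightarrow> ('v \<Rightarrow> ennreal) \<Rightarrow> 'a measure \<Rightarrow> ('a \<Rightarrow> 'v) \<Rightarrow> bool" where
  "bochner_integrable_in E N M f \<longleftrightarrow> (\<exists>v. has_bochner_integral_in E N M f v)"


section \<open>Higher derivatives and the spaces \<open>C\<^sup>n\<^sup>,\<^sup>\<alpha>\<^sub>0\<close>\<close>

text \<open>\<open>iter_deriv f [v\<^sub>1, \<dots>, v\<^sub>l] x\<close> is the \<open>l\<close>-linear map \<open>f\<^sup>(\<^sup>l\<^sup>)(x)\<close>
  evaluated at \<open>(v\<^sub>1, \<dots>, v\<^sub>l)\<close>.\<close>

primrec iter_deriv ::
    "('a::real_normed_vector \<Rightarrow> 'b::real_normed_vector) \<Rightarrow> 'a list \<Rightarrow> 'a \<Rightarrow> 'b" where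
  "iter_deriv f [] = f"
| "iter_deriv f (v # vs) = (\<lambda>x. frechet_derivative (iter_deriv f vs) (at x) v)"

text \<open>Multilinear maps on a finite-dimensional space form a finite-dimensional space, so
  differentiability and continuity of \<open>f\<^sup>(\<^sup>l\<^sup>)\<close> can be expressed for each tuple of arguments
  separately.\<close>

definition Cn_map :: "nat \<Rightarrow> ('a::euclidean_space \<Rightarrow> 'b::euclidean_space) \<Rightarrow> bool" where
  "Cn_map n f \<longleftrightarrow>
     (\<forall>vs x. length vs < n \<longrightarrow> iter_deriv f vs differentiable (at x)) \<and>
     (\<forall>vs. length vs \<le> n \<longrightarrow> continuous_on UNIV (iter_deriv f vs))"

text \<open>The operator norm of an \<open>l\<close>-linear map, given as a function on lists of length \<open>l\<close>.\<close>

definition multilinear_norm ::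
    "nat \<Rightarrow> ('a::real_normed_vector list \<Rightarrow> 'b::real_normed_vector) \<Rightarrow> ennreal" where
  "multilinear_norm l A =
     (SUP vs\<in>{vs. length vs = l \<and> (\<forall>v\<in>set vs. norm v \<le> 1)}. ennreal (norm (A vs)))"

definition holder_norm ::
    "nat \<Rightarrow> real \<Rightarrow> ('a::euclidean_space \<Rightarrow> 'b::euclidean_space) \<Rightarrow> ennreal" where
  "holder_norm n \<alpha> f =
     max (SUP l\<in>{..n}. SUP x. multilinear_norm l (\<lambda>vs. iter_deriv f vs x))
         (SUP (x, y)\<in>{(x, y). x \<noteq> y}.
            multilinear_norm n (\<lambda>vs. iter_deriv f vs x - iter_deriv f vs y)
              / ennreal (norm (x - y) powr \<alpha>))"

definition C0_holder :: "nat \<Rightarrow> real \<Rightarrow> ('a::euclidean_space \<Rightarrow> 'b::euclidean_space) set" where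
  "C0_holder n \<alpha> =
     {f. Cn_map n f \<and>
         (\<forall>l\<le>n. ((\<lambda>x. multilinear_norm l (\<lambda>vs. iter_deriv f vs x)) \<longlongrightarrow> 0) at_infinity) \<and>
         holder_norm n \<alpha> f < \<infinity>}"


section \<open>Diffeomorphisms and strong flows\<close>

definition Diff_holder :: "nat \<Rightarrow> real \<Rightarrow> (real ^ 'd \<Rightarrow> real ^ 'd) set" where
  "Diff_holder n \<alpha> =
     {\<Phi>. \<Phi> - id \<in> C0_holder n \<alpha> \<and>
         (\<forall>x. det (matrix (frechet_derivative \<Phi> (at x))) > 0)}"

text \<open>Continuity is with respect to the metric \<open>holder_norm n \<alpha> (\<Phi>\<^sub>1 - \<Phi>\<^sub>2)\<close>; the topology
  that the library puts on function types (pointwise convergence) plays no role.\<close>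

definition strong_flow ::
    "nat \<Rightarrow> real \<Rightarrow> (real \<Rightarrow> real ^ 'd \<Rightarrow> real ^ 'd) \<Rightarrow> (real \<Rightarrow> real ^ 'd \<Rightarrow> real ^ 'd) \<Rightarrow> bool" where
  "strong_flow n \<alpha> u \<Phi> \<longleftrightarrow>
     (\<forall>t\<in>{0..1}. \<Phi> t \<in> Diff_holder n \<alpha>) \<and>
     (\<forall>t\<in>{0..1}. ((\<lambda>s. holder_norm n \<alpha> (\<Phi> s - \<Phi> t)) \<longlongrightarrow> 0) (at t within {0..1})) \<and>
     (\<forall>t\<in>{0..1}. has_bochner_integral_in (C0_holder n \<alpha>) (holder_norm n \<alpha>)
        (lebesgue_on {0..t}) (\<lambda>s. u s \<circ> \<Phi> s) (\<Phi> t - id))"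

end

theory Submission
  imports Defs
begin

text \<open>A flow with an a priori bound in \<open>C\<^sup>n\<^sup>,\<^sup>\<beta>\<close> only has to satisfy the integral equation pointwise:
  by interpolation, sup-norm convergence of maps bounded in \<open>C\<^sup>n\<^sup>,\<^sup>\<beta>\<close> is convergence in
  \<open>C\<^sup>n\<^sup>,\<^sup>\<alpha>\<close>, so \<open>s \<mapsto> u s \<circ> \<Phi> s\<close> is strongly measurable and Bochner integrable in
  \<open>C\<^sup>n\<^sup>,\<^sup>\<alpha>\<^sub>0\<close>, and \<open>\<Phi>\<close> is continuous there. If \<open>\<integral>\<parallel>u\<parallel>\<close> is small, Picard iteration
  preserves a small \<open>C\<^sup>n\<^sup>,\<^sup>\<beta>\<close>-ball around the identity, contracts in the sup norm, and the Jacobian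
  determinant stays near 1. In general \<open>[0,1]\<close> is cut into intervals on which \<open>\<integral>\<parallel>u\<parallel>\<close> is small and
  the flows of the restricted fields are composed. Uniqueness is Gronwall's argument in the sup
  norm.\<close>

section \<open>Recursive Hoelder bounds\<close>

text \<open>Composition is the obstacle. For fixed phi the map from w to w o phi is linear and
  bounded on C^{n,\<beta>}, but w o phi does not in general depend continuously on phi in that norm,
  since the top derivative of w is only Hoelder. So neither a contraction nor strong measurability
  of \<open>u s \<circ> \<Phi> s\<close> can be expected in C^{n,\<beta>}. The sup norm asks only
  for a Lipschitz constant of \<open>u s\<close>, which n \<ge> 1 supplies, and the surplus \<beta>
  - \<alpha> leads back to C^{n,\<alpha>}. Iteration does not lose exponent: differentiating under
  the integral shows that the C^{n,\<alpha>}-valued integral inherits the C^{n,\<beta>} bound of its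
  integrand. Estimates are a predicate with an explicit constant instead of a norm, because
  composition constants must be uniform in w and phi, and the smallness threshold must depend on n,
  \<beta> and the dimension alone for finitely many cuts to suffice. The pieces of the field are
  extended by zero to all of [0,1], so time is never rescaled; the composition estimate and
  multiplicativity of the determinant carry the bound and the positive Jacobian to the composite
  flow.\<close>

definition dirder :: "('a::real_normed_vector \<Rightarrow> 'b::real_normed_vector) \<Rightarrow> 'a \<Rightarrow> 'a \<Rightarrow> 'b" where
  "dirder f v x = frechet_derivative f (at x) v"

lemma dirder_eqI: "(f has_derivative D) (at x) \<Longrightarrow> dirder f v x = D v"
  unfolding dirder_def by (metis frechet_derivative_at)

lemma has_derivative_dirder:
  "f differentiable (at x) \<Longrightarrow> (f has_derivative (\<lambda>v. dirder f v x)) (at x)"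
  unfolding dirder_def by (simp add: frechet_derivative_works[symmetric])

lemma dirder_add:
  assumes "\<And>x. f differentiable (at x)" "\<And>x. g differentiable (at x)"
  shows "dirder (\<lambda>x. f x + g x) v = (\<lambda>x. dirder f v x + dirder g v x)"
  by (intro ext dirder_eqI)
     (rule has_derivative_add[OF has_derivative_dirder has_derivative_dirder], (rule assms)+)

lemma dirder_bounded_linear:
  assumes "bounded_linear T" "\<And>x. f differentiable (at x)"
  shows "dirder (\<lambda>x. T (f x)) v = (\<lambda>x. T (dirder f v x))"
  by (intro ext dirder_eqI)
     (rule bounded_linear.has_derivative[OF assms(1) has_derivative_dirder[OF assms(2)]])

lemma differentiable_bounded_linear:
  "bounded_linear T \<Longrightarrow> f differentiable (at x) \<Longrightarrow> (\<lambda>x. T (f x)) differentiable (at x)"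
  by (metis bounded_linear.has_derivative differentiable_def)

lemma dirder_scaleR:
  assumes "\<And>x. f differentiable (at x)"
  shows "dirder f (c *\<^sub>R v) = (\<lambda>x. c *\<^sub>R dirder f v x)"
  using linear_frechet_derivative[OF assms] by (auto simp: dirder_def linear_cmul)

lemma dirder_mult:
  fixes f :: "'a::real_normed_vector \<Rightarrow> real"
  assumes "\<And>x. f differentiable (at x)" "\<And>x. g differentiable (at x)"
  shows "dirder (\<lambda>x. f x *\<^sub>R g x) v = (\<lambda>x. f x *\<^sub>R dirder g v x + dirder f v x *\<^sub>R g x)"
proof (intro ext)
  show "dirder (\<lambda>x. f x *\<^sub>R g x) v x = f x *\<^sub>R dirder g v x + dirder f v x *\<^sub>R g x" for x
    by (rule dirder_eqI[OF has_derivative_scaleR[OF has_derivative_dirder has_derivative_dirder]])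
       (rule assms)+
qed

lemma dirder_comp:
  assumes "w differentiable (at (\<phi> x))" "\<phi> differentiable (at x)"
  shows "dirder (\<lambda>x. w (\<phi> x)) v x = dirder w (dirder \<phi> v x) (\<phi> x)"
  using diff_chain_at[OF has_derivative_dirder[OF assms(2)] has_derivative_dirder[OF assms(1)]]
  by (intro dirder_eqI) (auto simp: o_def)

text \<open>In the chain rule the direction \<open>v\<close> itself varies with the point. Expanding
  it in the basis leaves products of scalar functions with fixed-direction derivatives, to which
  \<open>holder_bd_mult\<close> applies.\<close>

lemma dirder_basis:
  fixes w :: "'a::euclidean_space \<Rightarrow> 'b::real_normed_vector"
  assumes "w differentiable (at y)"
  shows "dirder w v y = (\<Sum>b\<in>Basis. (v \<bullet> b) *\<^sub>R dirder w b y)"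
proof -
  have "linear (\<lambda>v. dirder w v y)"
    using linear_frechet_derivative[OF assms] by (simp add: dirder_def)
  from linear_sum[OF this, of "\<lambda>b. (v \<bullet> b) *\<^sub>R b" Basis] linear_cmul[OF this]
  show ?thesis
    by (simp add: euclidean_representation)
qed

text \<open>Derivatives are peeled off from the inside, whereas \<^const>\<open>iter_deriv\<close> adds them outside: the
  recursion on \<open>n\<close> can then vary \<open>f\<close>.\<close>

primrec holder_bd :: "nat \<Rightarrow> real \<Rightarrow> real \<Rightarrow> ('a::euclidean_space \<Rightarrow> 'b::euclidean_space) \<Rightarrow> bool" where
  "holder_bd 0 \<gamma> K f \<longleftrightarrow> (\<forall>x. norm (f x) \<le> K) \<and> (\<forall>x y. norm (f x - f y) \<le> K * norm (x - y) powr \<gamma>)"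
| "holder_bd (Suc n) \<gamma> K f \<longleftrightarrow> (\<forall>x. norm (f x) \<le> K) \<and> (\<forall>x. f differentiable (at x)) \<and>
     (\<forall>v. norm v \<le> 1 \<longrightarrow> holder_bd n \<gamma> K (dirder f v))"

lemma holder_bd_norm: "holder_bd n \<gamma> K f \<Longrightarrow> norm (f x) \<le> K"
  by (cases n) auto

lemma holder_bd_nonneg: "holder_bd n \<gamma> K f \<Longrightarrow> 0 \<le> K"
  using holder_bd_norm norm_ge_zero order_trans by blast

lemma holder_bd_mono: "holder_bd n \<gamma> K f \<Longrightarrow> K \<le> L \<Longrightarrow> holder_bd n \<gamma> L f"
proof (induction n arbitrary: f)
  case 0
  then show ?case
    by (auto intro: order_trans) (meson mult_right_mono order_trans powr_ge_zero)
next
  case (Suc n)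
  then show ?case
    by (auto intro: order_trans)
qed

lemma holder_bd_differentiable: "holder_bd n \<gamma> K f \<Longrightarrow> n \<ge> 1 \<Longrightarrow> f differentiable (at x)"
  by (cases n) auto

lemma holder_bd_bounded_linear:
  assumes "bounded_linear T" "\<And>y. norm (T y) \<le> c * norm y" "c \<ge> 0"
  shows "holder_bd n \<gamma> K f \<Longrightarrow> holder_bd n \<gamma> (c * K) (\<lambda>x. T (f x))"
proof (induction n arbitrary: f)
  case 0
  have *: "norm (T y) \<le> c * B" if "norm y \<le> B" for y B
    using assms(2)[of y] mult_left_mono[OF that assms(3)] by linarith
  have **: "T (f x) - T (f y) = T (f x - f y)" for x y
    using assms(1) by (simp add: bounded_linear.linear linear_diff)
  show ?case
    using 0 by (auto simp: ** mult.assoc intro!: *)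
next
  case (Suc n)
  have *: "norm (T y) \<le> c * K" if "norm y \<le> K" for y
    using assms(2)[of y] mult_left_mono[OF that assms(3)] by linarith
  show ?case
    using Suc by (auto intro!: * simp: dirder_bounded_linear[OF assms(1)] differentiable_bounded_linear[OF assms(1)])
qed

lemma holder_bd_scaleR: "holder_bd n \<gamma> K f \<Longrightarrow> holder_bd n \<gamma> (\<bar>c\<bar> * K) (\<lambda>x. c *\<^sub>R f x)"
  by (rule holder_bd_bounded_linear) (auto intro: bounded_linear_scaleR_right)

lemma holder_bd_minus: "holder_bd n \<gamma> K f \<Longrightarrow> holder_bd n \<gamma> K (\<lambda>x. - f x)"
  using holder_bd_scaleR[of n \<gamma> K f "-1"] by simp

lemma holder_bd_add:
  "holder_bd n \<gamma> K f \<Longrightarrow> holder_bd n \<gamma> L g \<Longrightarrow> holder_bd n \<gamma> (K + L) (\<lambda>x. f x + g x)"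
proof (induction n arbitrary: f g)
  case 0
  have "norm (f x + g x - (f y + g y)) \<le> norm (f x - f y) + norm (g x - g y)" for x y
    by (metis add_diff_add norm_triangle_ineq)
  with 0 show ?case
    apply (auto simp: ring_distribs intro: order_trans[OF norm_triangle_ineq add_mono])
    by (meson add_mono order_trans)
next
  case (Suc n)
  then show ?case
    by (auto simp: dirder_add intro: order_trans[OF norm_triangle_ineq add_mono])
qed

lemma holder_bd_diff:
  "holder_bd n \<gamma> K f \<Longrightarrow> holder_bd n \<gamma> L g \<Longrightarrow> holder_bd n \<gamma> (K + L) (\<lambda>x. f x - g x)"
  using holder_bd_add[OF _ holder_bd_minus] by fastforce

lemma holder_bd_zero: "holder_bd n \<gamma> 0 (\<lambda>x. 0)"
proof (induction n)
  case (Suc n)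
  have "dirder (\<lambda>x::'a. 0::'b) v = (\<lambda>x. 0)" for v
    by (simp add: dirder_def fun_eq_iff)
  with Suc show ?case by simp
qed simp

lemma holder_bd_sum:
  assumes "finite A" "\<And>b. b \<in> A \<Longrightarrow> holder_bd n \<gamma> (K b) (f b)"
  shows "holder_bd n \<gamma> (\<Sum>b\<in>A. K b) (\<lambda>x. \<Sum>b\<in>A. f b x)"
  using assms by (induction A rule: finite_induct) (auto simp: holder_bd_zero intro: holder_bd_add)

text \<open>Homogeneity in the direction: vectors outside the unit ball, about which
  \<open>holder_bd\<close> says nothing directly, are rescaled to unit length.\<close>

lemma holder_bd_dirder:
  assumes "holder_bd (Suc n) \<gamma> K f"
  shows "holder_bd n \<gamma> (norm v * K) (dirder f v)"
proof (cases "v = 0")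
  case True
  have "dirder f 0 = (\<lambda>x. 0)"
    using dirder_scaleR[of f 0 0] assms by auto
  then show ?thesis using True by (simp add: holder_bd_zero)
next
  case False
  have "holder_bd n \<gamma> K (dirder f (v /\<^sub>R norm v))"
    using assms False by simp
  from holder_bd_scaleR[OF this, of "norm v"] show ?thesis
    using assms False dirder_scaleR[of f "norm v" "v /\<^sub>R norm v"] by auto
qed

lemma norm_dirder_le: "holder_bd (Suc n) \<gamma> K f \<Longrightarrow> norm (dirder f v x) \<le> K * norm v"
  using holder_bd_norm[OF holder_bd_dirder] by (metis mult.commute)

text \<open>Mean value inequality. It is the source of the Lipschitz constants in the contraction
  and uniqueness estimates.\<close>

lemma holder_bd_lipschitz:
  assumes "holder_bd (Suc n) \<gamma> K f"
  shows "norm (f x - f y) \<le> K * norm (x - y)"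
proof (rule differentiable_bound[of UNIV f "\<lambda>x v. dirder f v x"])
  show "(f has_derivative (\<lambda>v. dirder f v x)) (at x within UNIV)" for x
    using assms by (auto intro: has_derivative_dirder)
  show "onorm (\<lambda>v. dirder f v x) \<le> K" for x
    using norm_dirder_le[OF assms] by (intro onorm_le)
qed auto

text \<open>For d \<le> 1 the smaller exponent gives the larger power; for d > 1 the plain bound
  \<open>2 * K\<close> is already enough. That bound is the one \<open>norm_diff_le_2\<close> gives
  for a difference of two values, hence the factor 2.\<close>

lemma le_powr_of_le_min:
  fixes d :: real
  assumes "0 \<le> d" "0 \<le> K" "a \<le> K * d powr \<beta>" "a \<le> 2 * K" "0 < \<alpha>" "\<alpha> \<le> \<beta>"
  shows "a \<le> 2 * K * d powr \<alpha>"
proof (cases "d \<le> 1")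
  case True
  have "d powr \<beta> \<le> d powr \<alpha>"
    using True assms powr_mono'[of \<alpha> \<beta> d] by auto
  then have "K * d powr \<beta> \<le> K * d powr \<alpha>" "0 \<le> K * d powr \<alpha>"
    using assms by (auto intro: mult_left_mono)
  with assms show ?thesis by linarith
next
  case False
  have "1 \<le> d powr \<alpha>"
    using False assms by (intro ge_one_powr_ge_zero) auto
  then have "2 * K * 1 \<le> 2 * K * d powr \<alpha>"
    using assms by (intro mult_left_mono) auto
  with assms show ?thesis by linarith
qed

lemma norm_diff_le_2:
  assumes "\<And>x. norm (f x) \<le> K" shows "norm (f x - f y) \<le> 2 * K"
  using norm_triangle_ineq4[of "f x" "f y"] assms[of x] assms[of y] by linarith

lemma holder_bd_exponent:
  assumes "0 < \<alpha>" "\<alpha> \<le> \<beta>"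
  shows "holder_bd n \<beta> K f \<Longrightarrow> holder_bd n \<alpha> (2 * K) f"
proof (induction n arbitrary: f)
  case 0
  have K: "0 \<le> K" using holder_bd_nonneg[OF 0] .
  have "norm (f x) \<le> 2 * K" for x
    using 0 K by (auto intro: order_trans[of _ K])
  moreover have "norm (f x - f y) \<le> 2 * K * norm (x - y) powr \<alpha>" for x y
    using 0 K assms by (intro le_powr_of_le_min[where \<beta>=\<beta>] norm_diff_le_2) auto
  ultimately show ?case by simp
next
  case (Suc n)
  have K: "0 \<le> K" using holder_bd_nonneg[OF Suc.prems] .
  have "norm (f x) \<le> 2 * K" for x
    using holder_bd_norm[OF Suc.prems, of x] K by linarith
  with Suc show ?case by simp
qed

text \<open>At the bottom of the recursion a Lipschitz bound, that is exponent 1, is weakened to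
  exponent \<gamma>; this costs the factor 2. Higher orders only pass the claim on to the
  directional derivatives.\<close>

lemma holder_bd_Suc_imp:
  assumes "0 < \<gamma>" "\<gamma> \<le> 1"
  shows "holder_bd (Suc n) \<gamma> K f \<Longrightarrow> holder_bd n \<gamma> (2 * K) f"
proof (induction n arbitrary: f)
  case 0
  have K: "0 \<le> K" using holder_bd_nonneg[OF 0] .
  have "norm (f x) \<le> 2 * K" for x
    using holder_bd_norm[OF 0, of x] K by linarith
  moreover have "norm (f x - f y) \<le> 2 * K * norm (x - y) powr \<gamma>" for x y
    using holder_bd_lipschitz[OF 0, of x y] K assms
    by (intro le_powr_of_le_min[where \<beta>=1] norm_diff_le_2 holder_bd_norm[OF 0]) auto
  ultimately show ?case by simp
next
  case (Suc n)
  have K: "0 \<le> K" using holder_bd_nonneg[OF Suc.prems] .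
  have "norm (f x) \<le> 2 * K" for x
    using holder_bd_norm[OF Suc.prems, of x] K by linarith
  moreover have "f differentiable (at x)" for x
    using Suc.prems by simp
  moreover have "holder_bd n \<gamma> (2 * K) (dirder f v)" if "norm v \<le> 1" for v
    using Suc.prems that by (intro Suc.IH) auto
  ultimately show ?case by simp
qed

text \<open>The 2 comes from the two terms in the difference of a product. Each further order costs
  a factor 4: the product rule has two terms, and in each the undifferentiated factor is lowered by
  one order, which doubles its constant.\<close>

lemma holder_bd_mult:
  assumes "0 < \<gamma>" "\<gamma> \<le> 1"
  shows "holder_bd n \<gamma> K f \<Longrightarrow> holder_bd n \<gamma> L g \<Longrightarrow>
    holder_bd n \<gamma> (2 * 4 ^ n * K * L) (\<lambda>x. f x *\<^sub>R g x)"
proof (induction n arbitrary: f g K L)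
  case 0
  have KL: "0 \<le> K" "0 \<le> L" using 0 holder_bd_nonneg by blast+
  have "norm (f x *\<^sub>R g x) \<le> 2 * K * L" for x
  proof -
    have "norm (f x *\<^sub>R g x) \<le> K * L" 
      using 0 KL by (auto intro!: mult_mono)
    then show ?thesis using mult_nonneg_nonneg[OF KL] by linarith
  qed
  moreover have "norm (f x *\<^sub>R g x - f y *\<^sub>R g y) \<le> 2 * K * L * norm (x - y) powr \<gamma>" for x y
  proof -
    have "f x *\<^sub>R g x - f y *\<^sub>R g y = f x *\<^sub>R (g x - g y) + (f x - f y) *\<^sub>R g y"
      by (simp add: algebra_simps)
    then have "norm (f x *\<^sub>R g x - f y *\<^sub>R g y) \<le> \<bar>f x\<bar> * norm (g x - g y) + \<bar>f x - f y\<bar> * norm (g y)"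
      by (metis norm_scaleR norm_triangle_ineq)
    also have "\<dots> \<le> K * (L * norm (x - y) powr \<gamma>) + (K * norm (x - y) powr \<gamma>) * L"
      using 0 KL by (intro add_mono mult_mono) auto
    finally show ?thesis by (simp add: algebra_simps)
  qed
  ultimately show ?case by simp
next
  case (Suc n)
  have KL: "0 \<le> K" "0 \<le> L" using Suc.prems holder_bd_nonneg by blast+
  have "norm (f x *\<^sub>R g x) \<le> 2 * 4 ^ Suc n * K * L" for x
  proof -
    have "norm (f x *\<^sub>R g x) \<le> K * L" 
      using Suc.prems KL by (auto intro!: mult_mono)
    also have "\<dots> \<le> (2 * 4 ^ Suc n) * (K * L)"
      using mult_right_mono[of 1 "2 * 4 ^ Suc n" "K * L"] mult_nonneg_nonneg[OF KL]
        one_le_power[of "4::real" n] by (simp del: one_le_power)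
    finally show ?thesis by simp
  qed
  moreover have "holder_bd n \<gamma> (2 * 4 ^ Suc n * K * L) (dirder (\<lambda>x. f x *\<^sub>R g x) v)" if "norm v \<le> 1" for v
  proof -
    have "holder_bd n \<gamma> (2 * 4 ^ n * (2 * K) * L + 2 * 4 ^ n * K * (2 * L))
      (\<lambda>x. f x *\<^sub>R dirder g v x + dirder f v x *\<^sub>R g x)"
    proof (intro holder_bd_add Suc.IH)
      show "holder_bd n \<gamma> (2 * K) f" "holder_bd n \<gamma> (2 * L) g"
        using holder_bd_Suc_imp[OF assms] Suc.prems by blast+
    qed (use Suc.prems that in auto)
    moreover have "2 * 4 ^ n * (2 * K) * L + 2 * 4 ^ n * K * (2 * L) = 2 * 4 ^ Suc n * K * L"
      by simp
    moreover have "dirder (\<lambda>x. f x *\<^sub>R g x) v = (\<lambda>x. f x *\<^sub>R dirder g v x + dirder f v x *\<^sub>R g x)"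
      using Suc.prems by (intro dirder_mult) auto
    ultimately show ?thesis
      by (simp only:)
  qed
  moreover have "(\<lambda>x. f x *\<^sub>R g x) differentiable (at x)" for x
    using Suc.prems by (intro differentiable_scaleR) auto
  ultimately show ?case by (simp del: power_Suc)
qed

text \<open>For \<open>n = 0\<close> the Lipschitz bound on \<open>\<phi>\<close> is needed, and a \<open>C\<^sup>0\<^sup>,\<^sup>\<gamma>\<close> bound would not give
  it; hence the two separate hypotheses on \<open>\<phi>\<close> in the induction.\<close>

lemma holder_bd_comp_aux:
  assumes "0 < \<gamma>" "\<gamma> \<le> 1" "0 \<le> M"
  shows "\<exists>C\<ge>1. \<forall>(w :: 'a::euclidean_space \<Rightarrow> 'b::euclidean_space) (\<phi> :: 'a \<Rightarrow> 'a) K.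
    holder_bd n \<gamma> K w \<longrightarrow> (\<forall>x y. norm (\<phi> x - \<phi> y) \<le> (1 + M) * norm (x - y)) \<longrightarrow>
    (n \<ge> 1 \<longrightarrow> holder_bd n \<gamma> M (\<lambda>x. \<phi> x - x)) \<longrightarrow> holder_bd n \<gamma> (C * K) (\<lambda>x. w (\<phi> x))"
  using assms(3)
proof (induction n arbitrary: M)
  case 0
  have "holder_bd 0 \<gamma> ((1 + M) * K) (\<lambda>x. w (\<phi> x))"
    if w: "holder_bd 0 \<gamma> K w" and lip: "\<And>x y. norm (\<phi> x - \<phi> y) \<le> (1 + M) * norm (x - y)"
    for w :: "'a \<Rightarrow> 'b" and \<phi> :: "'a \<Rightarrow> 'a" and K
  proof -
    have K: "0 \<le> K" using holder_bd_nonneg[OF w] .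
    have "K \<le> (1 + M) * K" using K 0 mult_right_mono[of 1 "1 + M" K] by simp
    then have "norm (w (\<phi> x)) \<le> (1 + M) * K" for x
      using holder_bd_norm[OF w, of "\<phi> x"] by linarith
    moreover have "norm (w (\<phi> x) - w (\<phi> y)) \<le> (1 + M) * K * norm (x - y) powr \<gamma>" for x y
    proof -
      have "norm (w (\<phi> x) - w (\<phi> y)) \<le> K * norm (\<phi> x - \<phi> y) powr \<gamma>"
        using w by simp
      also have "\<dots> \<le> K * ((1 + M) * norm (x - y)) powr \<gamma>"
        using lip K assms by (intro mult_left_mono powr_mono2) auto
      also have "\<dots> = (1 + M) powr \<gamma> * (K * norm (x - y) powr \<gamma>)"
        using 0 by (simp add: powr_mult)
      also have "\<dots> \<le> (1 + M) * (K * norm (x - y) powr \<gamma>)"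
        using powr_mono[of \<gamma> 1 "1 + M"] 0 assms K by (intro mult_right_mono) auto
      finally show ?thesis by simp
    qed
    ultimately show ?thesis by simp
  qed
  then show ?case using 0 by (intro exI[of _ "1 + M"]) auto
next
  case (Suc n)
  \<comment> \<open>The induction hypothesis is taken at \<open>2 * M\<close> because \<phi> - id
    has to be lowered by one order, and \<open>holder_bd_Suc_imp\<close> doubles its
    constant.\<close>
  obtain C where C: "C \<ge> 1" and IH: "\<And>(w :: 'a \<Rightarrow> 'b) (\<phi> :: 'a \<Rightarrow> 'a) K.
    holder_bd n \<gamma> K w \<Longrightarrow> (\<And>x y. norm (\<phi> x - \<phi> y) \<le> (1 + 2 * M) * norm (x - y)) \<Longrightarrow>
    (n \<ge> 1 \<Longrightarrow> holder_bd n \<gamma> (2 * M) (\<lambda>x. \<phi> x - x)) \<Longrightarrow> holder_bd n \<gamma> (C * K) (\<lambda>x. w (\<phi> x))"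
    using Suc.IH[of "2 * M"] Suc.prems by auto
  \<comment> \<open>\<open>C\<close> accounts for \<open>dirder w v\<close> along \<phi>. Each
    summand accounts for a component of the derivative of \<phi> - id (bound \<open>M\<close>) times
    \<open>dirder w b\<close> along \<phi> (bound \<open>C * K\<close>), with the factor from
    \<open>holder_bd_mult\<close>.\<close>
  define C' where "C' = C + (\<Sum>b\<in>(Basis::'a set). 2 * 4 ^ n * M * C)"
  have "0 \<le> (\<Sum>b\<in>(Basis::'a set). 2 * 4 ^ n * M * C)"
    using Suc.prems C by (intro sum_nonneg mult_nonneg_nonneg) auto
  then have C': "C' \<ge> 1" using C unfolding C'_def by linarith
  have "holder_bd (Suc n) \<gamma> (C' * K) (\<lambda>x. w (\<phi> x))"
    if w: "holder_bd (Suc n) \<gamma> K w" and lip: "\<And>x y. norm (\<phi> x - \<phi> y) \<le> (1 + M) * norm (x - y)"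
      and \<phi>: "holder_bd (Suc n) \<gamma> M (\<lambda>x. \<phi> x - x)"
    for w :: "'a \<Rightarrow> 'b" and \<phi> :: "'a \<Rightarrow> 'a" and K
  proof -
    define g where "g = (\<lambda>x. \<phi> x - x)"
    have K: "0 \<le> K" using holder_bd_nonneg[OF w] .
    have g: "holder_bd (Suc n) \<gamma> M g" using \<phi> by (simp add: g_def)
    have \<phi>g: "\<phi> = (\<lambda>x. x + g x)" by (simp add: g_def)
    have gd: "g differentiable (at x)" for x using g by simp
    have wd: "w differentiable (at x)" for x using w by simp
    have \<phi>d: "\<phi> differentiable (at x)" for x
      unfolding \<phi>g using gd by (intro differentiable_add) auto
    have d\<phi>: "dirder \<phi> v x = v + dirder g v x" for v x
      unfolding \<phi>g by (intro dirder_eqI has_derivative_add has_derivative_ident has_derivative_dirder gd)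
    have lip': "norm (\<phi> x - \<phi> y) \<le> (1 + 2 * M) * norm (x - y)" for x y
      using lip[of x y] Suc.prems mult_right_mono[of "1 + M" "1 + 2 * M" "norm (x - y)"] by simp
    have g2: "holder_bd n \<gamma> (2 * M) g" using holder_bd_Suc_imp[OF assms(1,2) g] .
    have "norm (w (\<phi> x)) \<le> C' * K" for x
      using holder_bd_norm[OF w, of "\<phi> x"] mult_right_mono[OF C' K] by simp
    moreover have "(\<lambda>x. w (\<phi> x)) differentiable (at x)" for x
      using differentiable_chain_at[OF \<phi>d wd] by (simp add: o_def)
    moreover have "holder_bd n \<gamma> (C' * K) (dirder (\<lambda>x. w (\<phi> x)) v)" if v: "norm v \<le> 1" for v
    proof -
      have "dirder (\<lambda>x. w (\<phi> x)) v =
        (\<lambda>x. dirder w v (\<phi> x) + (\<Sum>b\<in>Basis. (dirder g v x \<bullet> b) *\<^sub>R dirder w b (\<phi> x)))"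
      proof
        fix x
        have "linear (\<lambda>v. dirder w v (\<phi> x))"
          using linear_frechet_derivative[OF wd] by (simp add: dirder_def)
        from linear_add[OF this, of v "dirder g v x"]
        show "dirder (\<lambda>x. w (\<phi> x)) v x =
          dirder w v (\<phi> x) + (\<Sum>b\<in>Basis. (dirder g v x \<bullet> b) *\<^sub>R dirder w b (\<phi> x))"
          by (simp add: dirder_comp[OF wd \<phi>d] d\<phi> dirder_basis[OF wd, of "dirder g v x"])
      qed
      moreover have "holder_bd n \<gamma> (C * K + (\<Sum>b\<in>(Basis::'a set). 2 * 4 ^ n * M * (C * K)))
        (\<lambda>x. dirder w v (\<phi> x) + (\<Sum>b\<in>Basis. (dirder g v x \<bullet> b) *\<^sub>R dirder w b (\<phi> x)))"
      proof (intro holder_bd_add holder_bd_sum holder_bd_mult assms IH lip')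
        show "holder_bd n \<gamma> M (\<lambda>x. dirder g v x \<bullet> b)" if "b \<in> Basis" for b
          using holder_bd_bounded_linear[OF bounded_linear_inner_left, of b 1 n \<gamma> M "dirder g v"]
            Cauchy_Schwarz_ineq2[of _ b] that g v by auto
      qed (use w v g2 in \<open>auto simp: g_def\<close>)
      moreover have "C * K + (\<Sum>b\<in>(Basis::'a set). 2 * 4 ^ n * M * (C * K)) = C' * K"
        by (simp add: C'_def algebra_simps)
      ultimately show ?thesis by simp
    qed
    ultimately show ?thesis by simp
  qed
  with C' show ?case by (intro exI[of _ C']) auto
qed

text \<open>For n \<ge> 1 the Lipschitz hypothesis of the auxiliary lemma follows from the bound on
  \<phi> - id by the mean value inequality. \<open>C\<close> is chosen before \<open>w\<close>,
  \<open>\<phi>\<close> and \<open>K\<close>, and the estimate is linear in \<open>K\<close>; both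
  matter for iterating and integrating it.\<close>

lemma holder_bd_comp:
  assumes "0 < \<gamma>" "\<gamma> \<le> 1" "0 \<le> M" "n \<ge> 1"
  shows "\<exists>C\<ge>1. \<forall>(w :: 'a::euclidean_space \<Rightarrow> 'b::euclidean_space) (\<phi> :: 'a \<Rightarrow> 'a) K.
    holder_bd n \<gamma> K w \<longrightarrow> holder_bd n \<gamma> M (\<lambda>x. \<phi> x - x) \<longrightarrow> holder_bd n \<gamma> (C * K) (\<lambda>x. w (\<phi> x))"
proof -
  have lip: "norm (\<phi> x - \<phi> y) \<le> (1 + M) * norm (x - y)" if "holder_bd n \<gamma> M (\<lambda>x. \<phi> x - x)"
    for \<phi> :: "'a \<Rightarrow> 'a" and x y
  proof -
    obtain m where m: "n = Suc m" using assms(4) by (cases n) auto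
    have "\<phi> x - \<phi> y = ((\<phi> x - x) - (\<phi> y - y)) + (x - y)" by simp
    then have "norm (\<phi> x - \<phi> y) \<le> norm ((\<phi> x - x) - (\<phi> y - y)) + norm (x - y)"
      by (metis norm_triangle_ineq)
    also have "\<dots> \<le> M * norm (x - y) + norm (x - y)"
      using holder_bd_lipschitz[OF that[unfolded m], of x y] by simp
    finally show ?thesis by (simp add: algebra_simps)
  qed
  show ?thesis
    using holder_bd_comp_aux[OF assms(1-3), of n, where 'a='a and 'b='b] lip by meson
qed


section \<open>Interpolation and uniform limits\<close>

lemma holder_bd_holder:
  assumes "0 < \<gamma>" "\<gamma> \<le> 1" "holder_bd n \<gamma> K f"
  shows "norm (f x - f y) \<le> 2 * K * norm (x - y) powr \<gamma>"
proof (cases n)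
  case 0
  have "K * norm (x - y) powr \<gamma> \<le> 2 * K * norm (x - y) powr \<gamma>"
    using holder_bd_nonneg[OF assms(3)] by simp
  moreover have "norm (f x - f y) \<le> K * norm (x - y) powr \<gamma>"
    using assms(3) 0 by simp
  ultimately show ?thesis by linarith
next
  case (Suc m)
  show ?thesis
    using holder_bd_lipschitz[OF assms(3)[unfolded Suc], of x y] holder_bd_nonneg[OF assms(3)] assms
    by (intro le_powr_of_le_min[where \<beta>=1] norm_diff_le_2 holder_bd_norm[OF assms(3)]) auto
qed

text \<open>A Landau-Kolmogorov type inequality: a difference quotient of step h is at most 2 *
  \<delta> / h, and by Hoelder continuity of the derivative it differs from the derivative at y by
  at most 2 * K * h^\<gamma>.\<close>

lemma norm_dirder_interpolation:
  assumes \<gamma>: "0 < \<gamma>" "\<gamma> \<le> 1" and f: "holder_bd (Suc n) \<gamma> K f" and v: "norm v \<le> 1" and h: "0 < h"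
    and small: "norm (f y) \<le> \<delta>" "norm (f (y + h *\<^sub>R v)) \<le> \<delta>"
  shows "norm (dirder f v y) \<le> 2 * K * h powr \<gamma> + 2 * \<delta> / h"
proof -
  \<comment> \<open>Deviation of f from its tangent along the segment; its derivative is the
    oscillation of \<open>dirder f v\<close>, controlled by \<open>holder_bd_holder\<close>.\<close>
  define G where "G = (\<lambda>s. f (y + s *\<^sub>R v) - s *\<^sub>R dirder f v y)"
  have K: "0 \<le> K" using holder_bd_nonneg[OF f] .
  have dv: "holder_bd n \<gamma> K (dirder f v)" using f v by simp
  have lin: "dirder f (s *\<^sub>R v) z = s *\<^sub>R dirder f v z" for s z
    using f by (simp add: dirder_scaleR)
  have "norm (G h - G 0) \<le> (2 * K * h powr \<gamma>) * norm (h - 0)"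
  proof (rule differentiable_bound[of "{0..h}" G "\<lambda>s t. t *\<^sub>R (dirder f v (y + s *\<^sub>R v) - dirder f v y)"])
    fix s assume s: "s \<in> {0..h}"
    have 1: "((\<lambda>s. y + s *\<^sub>R v) has_derivative (\<lambda>t. t *\<^sub>R v)) (at s)"
      by (auto intro!: derivative_eq_intros)
    have 2: "(f has_derivative (\<lambda>w. dirder f w (y + s *\<^sub>R v))) (at (y + s *\<^sub>R v))"
      using f by (intro has_derivative_dirder) auto
    have "((\<lambda>s. f (y + s *\<^sub>R v)) has_derivative (\<lambda>t. dirder f (t *\<^sub>R v) (y + s *\<^sub>R v))) (at s)"
      using diff_chain_at[OF 1 2] by (simp add: o_def)
    then have "(G has_derivative (\<lambda>t. dirder f (t *\<^sub>R v) (y + s *\<^sub>R v) - t *\<^sub>R dirder f v y)) (at s)"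
      unfolding G_def by (intro has_derivative_diff) (auto intro!: derivative_eq_intros)
    then show "(G has_derivative (\<lambda>t. t *\<^sub>R (dirder f v (y + s *\<^sub>R v) - dirder f v y))) (at s within {0..h})"
      by (simp add: lin has_derivative_at_withinI scaleR_diff_right)
    have "norm (dirder f v (y + s *\<^sub>R v) - dirder f v y) \<le> 2 * K * norm (s *\<^sub>R v) powr \<gamma>"
      using holder_bd_holder[OF \<gamma> dv, of "y + s *\<^sub>R v" y] by simp
    also have "\<dots> \<le> 2 * K * h powr \<gamma>"
      using K s v h mult_mono[of s h "norm v" 1] \<gamma> by (intro mult_left_mono powr_mono2) auto
    finally show "onorm (\<lambda>t. t *\<^sub>R (dirder f v (y + s *\<^sub>R v) - dirder f v y)) \<le> 2 * K * h powr \<gamma>"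
      by (intro onorm_le) (simp add: mult.commute mult_left_mono)
  qed (use h in auto)
  moreover have "h *\<^sub>R dirder f v y = (f (y + h *\<^sub>R v) - f y) - (G h - G 0)"
    by (simp add: G_def)
  then have "h * norm (dirder f v y) \<le> norm (f (y + h *\<^sub>R v) - f y) + norm (G h - G 0)"
    using h by (metis abs_of_pos norm_scaleR norm_triangle_ineq4)
  moreover have "norm (f (y + h *\<^sub>R v) - f y) \<le> 2 * \<delta>"
    using norm_triangle_ineq4[of "f (y + h *\<^sub>R v)" "f y"] small by linarith
  ultimately have "h * norm (dirder f v y) \<le> 2 * \<delta> + (2 * K * h powr \<gamma>) * h"
    using h by simp
  then show ?thesis using h by (simp add: field_simps)
qed

lemma exists_small_powr:
  fixes K :: real
  assumes "0 < \<gamma>" "0 < \<epsilon>" "0 < r"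
  shows "\<exists>h. 0 < h \<and> h < r \<and> K * h powr \<gamma> < \<epsilon>"
proof -
  have "((\<lambda>h::real. K * h powr \<gamma>) \<longlongrightarrow> K * 0 powr \<gamma>) (at_right 0)"
    using assms by (intro tendsto_intros tendsto_powr2) (auto simp: eventually_at_filter)
  then have "\<forall>\<^sub>F h in at_right 0. K * h powr \<gamma> < \<epsilon>"
    using assms by (auto intro: order_tendstoD)
  moreover have "\<forall>\<^sub>F h in at_right (0::real). h < r \<and> 0 < h"
    using assms eventually_at_right[of 0 r] by (auto simp: eventually_at_right_field)
  ultimately have "\<forall>\<^sub>F h in at_right 0. 0 < h \<and> h < r \<and> K * h powr \<gamma> < \<epsilon>"
    by eventually_elim auto
  then show ?thesis
    using eventually_happens trivial_limit_at_right_real by blast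
qed

text \<open>First h makes the Hoelder term at most \<epsilon> / 2, then \<delta> = \<epsilon> * h /
  4 makes 2 * \<delta> / h equal to \<epsilon> / 2. Both are uniform in f, and smallness is asked at
  two points only, which are less than r apart; this is what the local version at infinity
  needs.\<close>

lemma dirder_interpolation_small:
  assumes "0 < \<gamma>" "\<gamma> \<le> 1" "0 < \<epsilon>" "0 < r"
  obtains h \<delta> where "0 < h" "h < r" "0 < \<delta>"
    "\<And>(f :: 'a::euclidean_space \<Rightarrow> 'b::euclidean_space) v y. holder_bd (Suc n) \<gamma> K f \<Longrightarrow> norm v \<le> 1 \<Longrightarrow>
      norm (f y) \<le> \<delta> \<Longrightarrow> norm (f (y + h *\<^sub>R v)) \<le> \<delta> \<Longrightarrow> norm (dirder f v y) \<le> \<epsilon>"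
proof -
  obtain h where h: "0 < h" "h < r" "2 * K * h powr \<gamma> < \<epsilon> / 2"
    using exists_small_powr[of \<gamma> "\<epsilon> / 2" r "2 * K"] assms by auto
  have *: "norm (dirder f v y) \<le> \<epsilon>"
    if "holder_bd (Suc n) \<gamma> K f" "norm v \<le> 1" "norm (f y) \<le> \<epsilon> * h / 4" "norm (f (y + h *\<^sub>R v)) \<le> \<epsilon> * h / 4"
    for f :: "'a \<Rightarrow> 'b" and v y
    using norm_dirder_interpolation[OF assms(1,2) that(1,2) h(1) that(3,4)] h
    by (simp add: field_simps)
  show thesis
    by (rule that[of h "\<epsilon> * h / 4", OF h(1,2) _ *]) (use h assms in auto)
qed

lemma iter_deriv_snoc: "iter_deriv f (vs @ [v]) = iter_deriv (dirder f v) vs"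
  by (induction vs) (auto simp: dirder_def)

text \<open>A local interpolation: every order of differentiation uses up half of the radius, since
  the difference quotient looks at a point less than r / 2 away. Smallness is assumed only near x
  because a decaying function is small only far out.\<close>

lemma iter_deriv_small:
  assumes "0 < \<gamma>" "\<gamma> \<le> 1"
  shows "0 < \<epsilon> \<Longrightarrow> 0 < r \<Longrightarrow> \<exists>\<delta>>0. \<forall>(f :: 'a::euclidean_space \<Rightarrow> 'b::euclidean_space) x vs. holder_bd n \<gamma> K f \<longrightarrow>
    (\<forall>y. norm (x - y) < r \<longrightarrow> norm (f y) \<le> \<delta>) \<longrightarrow> length vs \<le> n \<longrightarrow> (\<forall>v\<in>set vs. norm v \<le> 1) \<longrightarrow>
    norm (iter_deriv f vs x) \<le> \<epsilon>"
proof (induction n arbitrary: \<epsilon> r)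
  case 0
  then show ?case by (intro exI[of _ \<epsilon>]) auto
next
  case (Suc n)
  obtain \<delta>1 where \<delta>1: "\<delta>1 > 0" and IH: "\<forall>(f :: 'a \<Rightarrow> 'b) x vs. holder_bd n \<gamma> K f \<longrightarrow>
    (\<forall>y. norm (x - y) < r / 2 \<longrightarrow> norm (f y) \<le> \<delta>1) \<longrightarrow> length vs \<le> n \<longrightarrow> (\<forall>v\<in>set vs. norm v \<le> 1) \<longrightarrow>
    norm (iter_deriv f vs x) \<le> \<epsilon>"
    using Suc.IH[OF Suc.prems(1) half_gt_zero[OF Suc.prems(2)]]
    by (elim exE conjE) (rule that; assumption)
  obtain h \<delta> where h: "0 < h" "h < r / 2" "0 < \<delta>" and
    d: "\<And>(f :: 'a \<Rightarrow> 'b) v y. holder_bd (Suc n) \<gamma> K f \<Longrightarrow> norm v \<le> 1 \<Longrightarrow>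
      norm (f y) \<le> \<delta> \<Longrightarrow> norm (f (y + h *\<^sub>R v)) \<le> \<delta> \<Longrightarrow> norm (dirder f v y) \<le> \<delta>1"
    by (rule dirder_interpolation_small[OF assms \<delta>1 half_gt_zero[OF Suc.prems(2)], of n K]) (rule that; assumption)
  have "norm (iter_deriv f vs x) \<le> \<epsilon>"
    if f: "holder_bd (Suc n) \<gamma> K f" and small: "\<And>y. norm (x - y) < r \<Longrightarrow> norm (f y) \<le> min \<epsilon> \<delta>"
      and vs: "length vs \<le> Suc n" "\<forall>v\<in>set vs. norm v \<le> 1"
    for f :: "'a \<Rightarrow> 'b" and x vs
  proof (cases vs rule: rev_cases)
    case Nil
    then show ?thesis using small[of x] Suc.prems by simp
  next
    case (snoc ws v)
    have v: "norm v \<le> 1" using vs snoc by auto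
    have "norm (dirder f v y) \<le> \<delta>1" if y: "norm (x - y) < r / 2" for y
    proof (rule d[OF f v])
      have "norm (x - (y + h *\<^sub>R v)) \<le> norm (x - y) + norm (h *\<^sub>R v)"
        using norm_triangle_ineq4[of "x - y" "h *\<^sub>R v"] by (simp add: algebra_simps)
      moreover have "norm (h *\<^sub>R v) \<le> h" using v h by (simp add: mult_left_le)
      ultimately have "norm (x - (y + h *\<^sub>R v)) < r" using y h by linarith
      then show "norm (f (y + h *\<^sub>R v)) \<le> \<delta>" using small by fastforce
      show "norm (f y) \<le> \<delta>" using small[of y] y Suc.prems by simp
    qed
    then show ?thesis
      using f v vs snoc IH[rule_format, of "dirder f v" x ws] by (auto simp: iter_deriv_snoc)
  qed
  then show ?case using Suc.prems h by (intro exI[of _ "min \<epsilon> \<delta>"]) auto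
qed

text \<open>In order 0, points within distance h gain the factor h^(\<beta> - \<alpha>), which
  strictness of \<alpha> < \<beta> makes small; farther points use the sup bound. For higher orders
  the directional derivatives are first made uniformly small by
  \<open>dirder_interpolation_small\<close>.\<close>

lemma holder_bd_interpolation:
  assumes "0 < \<alpha>" "\<alpha> < \<beta>" "\<beta> \<le> 1" "0 \<le> K"
  shows "0 < \<epsilon> \<Longrightarrow> \<exists>\<delta>>0. \<forall>f :: 'a::euclidean_space \<Rightarrow> 'b::euclidean_space.
    holder_bd n \<beta> K f \<longrightarrow> (\<forall>x. norm (f x) \<le> \<delta>) \<longrightarrow> holder_bd n \<alpha> \<epsilon> f"
proof (induction n arbitrary: \<epsilon>)
  case 0
  obtain h where h: "0 < h" "h < 1" "K * h powr (\<beta> - \<alpha>) < \<epsilon>"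
    using exists_small_powr[of "\<beta> - \<alpha>" \<epsilon> 1 K] assms 0 by auto
  \<comment> \<open>The second entry gives 2 * \<delta> \<le> \<epsilon> * h^\<alpha>, the estimate
    needed for points at distance more than h.\<close>
  define \<delta> where "\<delta> = min \<epsilon> (\<epsilon> * h powr \<alpha> / 2)"
  have "holder_bd 0 \<alpha> \<epsilon> f" if f: "holder_bd 0 \<beta> K f" and small: "\<And>x. norm (f x) \<le> \<delta>" for f :: "'a \<Rightarrow> 'b"
  proof -
    have "norm (f x - f y) \<le> \<epsilon> * norm (x - y) powr \<alpha>" for x y
    proof (cases "norm (x - y) \<le> h")
      case True
      have "norm (f x - f y) \<le> K * norm (x - y) powr \<beta>" using f by simp
      also have "\<dots> = K * norm (x - y) powr (\<beta> - \<alpha>) * norm (x - y) powr \<alpha>"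
        by (simp flip: powr_add)
      also have "\<dots> \<le> K * h powr (\<beta> - \<alpha>) * norm (x - y) powr \<alpha>"
        using True assms by (intro mult_right_mono mult_left_mono powr_mono2) auto
      also have "\<dots> \<le> \<epsilon> * norm (x - y) powr \<alpha>"
        using h by (intro mult_right_mono) auto
      finally show ?thesis .
    next
      case False
      have "norm (f x - f y) \<le> 2 * \<delta>" using norm_diff_le_2[of f \<delta>] small by blast
      also have "\<dots> \<le> \<epsilon> * h powr \<alpha>" by (simp add: \<delta>_def)
      also have "\<dots> \<le> \<epsilon> * norm (x - y) powr \<alpha>"
        using False h 0 assms by (intro mult_left_mono powr_mono2) auto
      finally show ?thesis .
    qed
    moreover have "norm (f x) \<le> \<epsilon>" for x using small[of x] by (simp add: \<delta>_def)
    ultimately show ?thesis by simp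
  qed
  moreover have "\<delta> > 0" using h 0 by (simp add: \<delta>_def)
  ultimately show ?case by (intro exI[of _ \<delta>]) auto
next
  case (Suc n)
  obtain \<delta>1 where \<delta>1: "\<delta>1 > 0" and IH: "\<forall>f :: 'a \<Rightarrow> 'b.
    holder_bd n \<beta> K f \<longrightarrow> (\<forall>x. norm (f x) \<le> \<delta>1) \<longrightarrow> holder_bd n \<alpha> \<epsilon> f"
    using Suc.IH[OF Suc.prems] by (elim exE conjE) (rule that; assumption)
  obtain h \<delta> where h: "0 < h" "h < 1" "0 < \<delta>" and
    d: "\<And>(f :: 'a \<Rightarrow> 'b) v y. holder_bd (Suc n) \<beta> K f \<Longrightarrow> norm v \<le> 1 \<Longrightarrow>
      norm (f y) \<le> \<delta> \<Longrightarrow> norm (f (y + h *\<^sub>R v)) \<le> \<delta> \<Longrightarrow> norm (dirder f v y) \<le> \<delta>1"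
    by (rule dirder_interpolation_small[OF less_trans[OF assms(1,2)] assms(3) \<delta>1 zero_less_one, of n K]) (rule that; assumption)
  have "holder_bd (Suc n) \<alpha> \<epsilon> f"
    if f: "holder_bd (Suc n) \<beta> K f" and small: "\<And>x. norm (f x) \<le> min \<epsilon> \<delta>" for f :: "'a \<Rightarrow> 'b"
    using f small by (auto intro!: IH[rule_format] d)
  then show ?case using Suc.prems h by (intro exI[of _ "min \<epsilon> \<delta>"]) auto
qed

text \<open>Convergence of the derivatives need not be assumed: the differences F i - F j are
  bounded by K + K, so interpolation turns a uniform Cauchy property of the functions into one of
  their directional derivatives. Hence Hoelder balls are closed under uniform convergence.\<close>

lemma holder_bd_uniform_limit:
  fixes F :: "nat \<Rightarrow> 'a::euclidean_space \<Rightarrow> 'b::euclidean_space"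
  assumes "0 < \<gamma>" "\<gamma> \<le> 1"
  shows "uniform_limit UNIV F f sequentially \<Longrightarrow> (\<And>i. holder_bd n \<gamma> K (F i)) \<Longrightarrow> holder_bd n \<gamma> K f"
proof (induction n arbitrary: F f)
  case 0
  have lim: "(\<lambda>i. F i x) \<longlonglongrightarrow> f x" for x
    using tendsto_uniform_limitI[OF 0(1)] by simp
  have "norm (f x) \<le> K" for x
    by (rule LIMSEQ_le_const2[OF tendsto_norm[OF lim]]) (use 0 in auto)
  moreover have "norm (f x - f y) \<le> K * norm (x - y) powr \<gamma>" for x y
    by (rule LIMSEQ_le_const2[OF tendsto_norm[OF tendsto_diff[OF lim lim]]]) (use 0 in auto)
  ultimately show ?case by simp
next
  case (Suc n)
  have lim: "(\<lambda>i. F i x) \<longlonglongrightarrow> f x" for x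
    using tendsto_uniform_limitI[OF Suc.prems(1)] by simp
  have Fd: "F i differentiable (at x)" for i x using Suc.prems(2)[of i] by simp
  \<comment> \<open>The bound is proportional to \<open>norm v\<close>, as termwise differentiation
    by \<open>has_derivative_sequence\<close> requires; unit directions are treated first and then
    rescaled.\<close>
  have cauchy: "\<exists>N. \<forall>i\<ge>N. \<forall>j\<ge>N. \<forall>x v. norm (dirder (F i) v x - dirder (F j) v x) \<le> e * norm v"
    if e: "e > 0" for e
  proof -
    obtain h \<delta> where h: "0 < h" "0 < \<delta>" and
      d: "\<And>(f :: 'a \<Rightarrow> 'b) v y. holder_bd (Suc n) \<gamma> (K + K) f \<Longrightarrow> norm v \<le> 1 \<Longrightarrow>
        norm (f y) \<le> \<delta> \<Longrightarrow> norm (f (y + h *\<^sub>R v)) \<le> \<delta> \<Longrightarrow> norm (dirder f v y) \<le> e"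
      by (rule dirder_interpolation_small[OF assms e zero_less_one, of n "K + K"]) (rule that; assumption)
    have "\<forall>\<^sub>F i in sequentially. \<forall>x\<in>UNIV. dist (F i x) (f x) < \<delta> / 2"
      using uniform_limitD[OF Suc.prems(1), of "\<delta> / 2"] h by simp
    then obtain N where N: "\<And>i x. i \<ge> N \<Longrightarrow> dist (F i x) (f x) < \<delta> / 2"
      by (auto simp: eventually_sequentially)
    have "norm (dirder (F i) v x - dirder (F j) v x) \<le> e * norm v" if ij: "i \<ge> N" "j \<ge> N" for i j x v
    proof -
      have hd: "holder_bd (Suc n) \<gamma> (K + K) (\<lambda>x. F i x - F j x)"
        by (intro holder_bd_diff Suc.prems)
      have sm: "norm (F i x - F j x) \<le> \<delta>" for x
        using N[OF ij(1), of x] N[OF ij(2), of x] dist_triangle2[of "F i x" "F j x" "f x"]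
        by (simp add: dist_norm)
      have dd: "dirder (\<lambda>x. F i x - F j x) v = (\<lambda>x. dirder (F i) v x - dirder (F j) v x)" for v
        by (intro ext dirder_eqI has_derivative_diff has_derivative_dirder Fd)
      have unit: "norm (dirder (F i) v x - dirder (F j) v x) \<le> e" if "norm v \<le> 1" for v
        using d[OF hd that sm sm] unfolding dd .
      show ?thesis
      proof (cases "v = 0")
        case True
        have "dirder (F i) (0 *\<^sub>R v) x = 0" for i
          using dirder_scaleR[of "F i" 0 v] Fd by simp
        with True show ?thesis by simp
      next
        case False
        have "dirder (F i) v = (\<lambda>x. norm v *\<^sub>R dirder (F i) (v /\<^sub>R norm v) x)" for i
          using dirder_scaleR[of "F i" "norm v" "v /\<^sub>R norm v"] Fd False by simp
        then have "norm (dirder (F i) v x - dirder (F j) v x) =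
            norm v * norm (dirder (F i) (v /\<^sub>R norm v) x - dirder (F j) (v /\<^sub>R norm v) x)"
          by (metis (no_types, lifting) abs_norm_cancel norm_scaleR scaleR_diff_right)
        also have "\<dots> \<le> norm v * e"
          using unit[of "v /\<^sub>R norm v"] False by (intro mult_left_mono) auto
        finally show ?thesis by (simp add: mult.commute)
      qed
    qed
    then show ?thesis by blast
  qed
  define g' where "g' = (\<lambda>x v. lim (\<lambda>i. dirder (F i) v x))"
  have conv: "(\<lambda>i. dirder (F i) v x) \<longlonglongrightarrow> g' x v" for x v
  proof -
    have "Cauchy (\<lambda>i. dirder (F i) v x)"
    proof (rule CauchyI)
      fix e :: real assume e: "e > 0"
      \<comment> \<open>The added 1 keeps the divisor positive for v = 0.\<close>
      define e' where "e' = e / (2 * (norm v + 1))"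
      have e': "e' > 0" using e by (auto simp: e'_def add_nonneg_pos)
      have "e' * norm v \<le> e' * (norm v + 1)" using e' by simp
      also have "\<dots> = e / 2" by (simp add: e'_def field_simps add_nonneg_eq_0_iff)
      finally have "e' * norm v < e" using e by simp
      with cauchy[OF e'] show "\<exists>M. \<forall>m\<ge>M. \<forall>n\<ge>M. norm (dirder (F m) v x - dirder (F n) v x) < e"
        by (meson le_less_trans)
    qed
    then show ?thesis
      unfolding g'_def using Cauchy_convergent convergent_LIMSEQ_iff by blast
  qed
  have unif: "\<exists>N. \<forall>i\<ge>N. \<forall>x v. norm (dirder (F i) v x - g' x v) \<le> e * norm v" if e: "e > 0" for e
  proof -
    obtain N where N: "\<And>i j x v. i \<ge> N \<Longrightarrow> j \<ge> N \<Longrightarrow> norm (dirder (F i) v x - dirder (F j) v x) \<le> e * norm v"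
      using cauchy[OF e] by blast
    have "norm (dirder (F i) v x - g' x v) \<le> e * norm v" if "i \<ge> N" for i x v
      by (rule LIMSEQ_le_const2[OF tendsto_norm[OF tendsto_diff[OF tendsto_const conv]]])
         (use N that in blast)
    then show ?thesis by blast
  qed
  have "\<exists>g. \<forall>x\<in>UNIV. (\<lambda>i. F i x) \<longlonglongrightarrow> g x \<and> (g has_derivative g' x) (at x within UNIV)"
  proof (rule has_derivative_sequence)
    show "(F i has_derivative (\<lambda>v. dirder (F i) v x)) (at x within UNIV)" for i x
      by (simp add: has_derivative_dirder Fd)
    show "\<forall>\<^sub>F i in sequentially. \<forall>x\<in>UNIV. \<forall>v. norm (dirder (F i) v x - g' x v) \<le> e * norm v" if "e > 0" for e
      using unif[OF that] by (auto simp: eventually_sequentially)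
    show "(\<lambda>i. F i 0) \<longlonglongrightarrow> f 0" by (rule lim)
  qed auto
  then obtain g where g: "\<And>x. (\<lambda>i. F i x) \<longlonglongrightarrow> g x" "\<And>x. (g has_derivative g' x) (at x)" by auto
  have "g = f" using LIMSEQ_unique[OF g(1) lim] by blast
  with g have fd: "(f has_derivative g' x) (at x)" for x by simp
  have "norm (f x) \<le> K" for x
    by (rule LIMSEQ_le_const2[OF tendsto_norm[OF lim]]) (use holder_bd_norm[OF Suc.prems(2)] in auto)
  moreover have "f differentiable (at x)" for x using fd differentiable_def by blast
  moreover have "holder_bd n \<gamma> K (dirder f v)" if v: "norm v \<le> 1" for v
  proof (rule Suc.IH)
    show "holder_bd n \<gamma> K (dirder (F i) v)" for i using Suc.prems(2)[of i] v by simp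
    show "uniform_limit UNIV (\<lambda>i. dirder (F i) v) (dirder f v) sequentially"
    proof (rule uniform_limitI)
      fix e :: real assume "e > 0"
      then obtain N where N: "\<And>i x v. i \<ge> N \<Longrightarrow> norm (dirder (F i) v x - g' x v) \<le> e / 2 * norm v"
        using unif[of "e / 2"] by auto
      have "dist (dirder (F i) v x) (dirder f v x) < e" if "i \<ge> N" for i x
      proof -
        have "e / 2 * norm v \<le> e / 2 * 1" using v \<open>e > 0\<close> by (intro mult_left_mono) auto
        then have "norm (dirder (F i) v x - g' x v) < e"
          using N[OF that, of v x] \<open>e > 0\<close> by linarith
        then show ?thesis by (simp add: dist_norm dirder_eqI[OF fd])
      qed
      then show "\<forall>\<^sub>F i in sequentially. \<forall>x\<in>UNIV. dist (dirder (F i) v x) (dirder f v x) < e"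
        by (auto simp: eventually_sequentially)
    qed
  qed
  ultimately show ?case by simp
qed

lemma holder_norm_le_iff:
  assumes "0 \<le> K"
  shows "holder_norm n \<gamma> f \<le> ennreal K \<longleftrightarrow>
    (\<forall>vs x. length vs \<le> n \<longrightarrow> (\<forall>v\<in>set vs. norm v \<le> 1) \<longrightarrow> norm (iter_deriv f vs x) \<le> K) \<and>
    (\<forall>vs x y. length vs = n \<longrightarrow> (\<forall>v\<in>set vs. norm v \<le> 1) \<longrightarrow>
       norm (iter_deriv f vs x - iter_deriv f vs y) \<le> K * norm (x - y) powr \<gamma>)"
    (is "_ \<longleftrightarrow> ?A \<and> ?B")
proof -
  have 1: "(SUP l\<in>{..n}. SUP x. multilinear_norm l (\<lambda>vs. iter_deriv f vs x)) \<le> ennreal K \<longleftrightarrow> ?A"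
    using assms by (auto simp: SUP_le_iff multilinear_norm_def)
  have *: "a / ennreal d \<le> ennreal K \<longleftrightarrow> a \<le> ennreal (K * d)" if "d > 0" for a d
  proof -
    have "a / ennreal d \<le> ennreal K \<longleftrightarrow> a \<le> ennreal K * ennreal d"
    proof
      assume "a / ennreal d \<le> ennreal K"
      then have "a / ennreal d * ennreal d \<le> ennreal K * ennreal d" by (intro mult_right_mono) auto
      moreover have "a / ennreal d * ennreal d = a"
        using that by (simp add: ennreal_divide_times divide_ennreal)
      ultimately show "a \<le> ennreal K * ennreal d" by simp
    qed (use that in \<open>auto intro!: divide_le_posI_ennreal simp: mult.commute\<close>)
    then show ?thesis using assms that by (simp add: ennreal_mult)
  qed
  have "(SUP (x, y)\<in>{(x, y). x \<noteq> y}. multilinear_norm n (\<lambda>vs. iter_deriv f vs x - iter_deriv f vs y)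
              / ennreal (norm (x - y) powr \<gamma>)) \<le> ennreal K \<longleftrightarrow>
    (\<forall>x y. x \<noteq> y \<longrightarrow> multilinear_norm n (\<lambda>vs. iter_deriv f vs x - iter_deriv f vs y) \<le> ennreal (K * norm (x - y) powr \<gamma>))"
    by (auto simp: SUP_le_iff *)
  \<comment> \<open>The case x = y, absent from the supremum, adds nothing to \<open>?B\<close>:
    both sides vanish, since \<open>0 powr \<gamma>\<close> is 0.\<close>
  also have "\<dots> \<longleftrightarrow> ?B"
    using assms by (auto simp: SUP_le_iff multilinear_norm_def) (metis mult_eq_0_iff norm_zero order_refl powr_0 right_minus_eq)
  finally show ?thesis using 1 by (simp add: holder_norm_def)
qed


section \<open>The spaces \<open>C\<^sup>n\<^sup>,\<^sup>\<alpha>\<^sub>0\<close> in terms of Hoelder bounds\<close>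

text \<open>Peels off the innermost derivative by \<open>iter_deriv_snoc\<close>, to match the
  recursion of \<open>holder_bd\<close>.\<close>

lemma Cn_map_Suc:
  "Cn_map (Suc n) f \<longleftrightarrow> (\<forall>x. f differentiable (at x)) \<and> (\<forall>v. Cn_map n (dirder f v))"
    (is "?L \<longleftrightarrow> ?R")
proof
  assume L: ?L
  have "f differentiable (at x)" for x
    using L[unfolded Cn_map_def, THEN conjunct1, rule_format, of "[]" x] by simp
  moreover have "Cn_map n (dirder f v)" for v
    unfolding Cn_map_def
  proof (intro conjI allI impI)
    show "iter_deriv (dirder f v) vs differentiable (at x)" if "length vs < n" for vs x
      using L[unfolded Cn_map_def, THEN conjunct1, rule_format, of "vs @ [v]" x] that
      by (simp add: iter_deriv_snoc)
    show "continuous_on UNIV (iter_deriv (dirder f v) vs)" if "length vs \<le> n" for vs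
      using L[unfolded Cn_map_def, THEN conjunct2, rule_format, of "vs @ [v]"] that
      by (simp add: iter_deriv_snoc)
  qed
  ultimately show ?R by blast
next
  assume R: ?R
  show ?L
    unfolding Cn_map_def
  proof (intro conjI allI impI)
    show "iter_deriv f vs differentiable (at x)" if "length vs < Suc n" for vs x
      using R that by (cases vs rule: rev_cases) (auto simp: iter_deriv_snoc Cn_map_def)
    show "continuous_on UNIV (iter_deriv f vs)" if "length vs \<le> Suc n" for vs
      using R that
      by (cases vs rule: rev_cases)
         (auto simp: iter_deriv_snoc Cn_map_def intro!: differentiable_imp_continuous_on
            differentiable_at_imp_differentiable_on)
  qed
qed

lemma continuous_on_holder:
  fixes f :: "'a::euclidean_space \<Rightarrow> 'b::euclidean_space"
  assumes "0 < \<gamma>" "holder_bd 0 \<gamma> K f"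
  shows "continuous_on UNIV f"
proof (intro continuous_at_imp_continuous_on ballI)
  fix x :: 'a
  have "((\<lambda>y. K * norm (y - x) powr \<gamma>) \<longlongrightarrow> K * norm (x - x) powr \<gamma>) (at x)"
    using assms by (intro tendsto_intros tendsto_powr2) auto
  then have "((\<lambda>y. f y - f x) \<longlongrightarrow> 0) (at x)"
    using assms by (intro Lim_null_comparison[of "\<lambda>y. f y - f x" "\<lambda>y. K * norm (y - x) powr \<gamma>"]) auto
  then show "isCont f x" by (simp add: isCont_def LIM_zero_iff)
qed

text \<open>Ties the recursive predicate to the derivatives in the definition of the spaces.
  Continuity of the top derivative comes from its Hoelder condition, that of the lower ones from
  differentiability.\<close>

lemma holder_bd_iff_iter_deriv:
  assumes "0 < \<gamma>"
  shows "holder_bd n \<gamma> K f \<longleftrightarrow> Cn_map n f \<and>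
    (\<forall>vs x. length vs \<le> n \<longrightarrow> (\<forall>v\<in>set vs. norm v \<le> 1) \<longrightarrow> norm (iter_deriv f vs x) \<le> K) \<and>
    (\<forall>vs x y. length vs = n \<longrightarrow> (\<forall>v\<in>set vs. norm v \<le> 1) \<longrightarrow>
       norm (iter_deriv f vs x - iter_deriv f vs y) \<le> K * norm (x - y) powr \<gamma>)"
proof (induction n arbitrary: f K)
  case 0
  show ?case
    using continuous_on_holder[OF assms, of K f] by (auto simp: Cn_map_def)
next
  case (Suc n)
  show ?case (is "?L \<longleftrightarrow> ?R")
  proof
    assume L: ?L
    \<comment> \<open>\<open>Cn_map\<close> quantifies over all directions, not only over the unit
      ball, hence the rescaled bound.\<close>
    have "Cn_map n (dirder f v)" for v
      using holder_bd_dirder[OF L, of v] Suc.IH by blast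
    then have "Cn_map (Suc n) f" using L by (simp add: Cn_map_Suc)
    moreover have "norm (iter_deriv f vs x) \<le> K"
      if "length vs \<le> Suc n" "\<forall>v\<in>set vs. norm v \<le> 1" for vs x
      using L that by (cases vs rule: rev_cases) (auto simp: iter_deriv_snoc Suc.IH)
    moreover have "norm (iter_deriv f vs x - iter_deriv f vs y) \<le> K * norm (x - y) powr \<gamma>"
      if "length vs = Suc n" "\<forall>v\<in>set vs. norm v \<le> 1" for vs x y
      using L that by (cases vs rule: rev_cases) (auto simp: iter_deriv_snoc Suc.IH)
    ultimately show ?R by blast
  next
    assume R: ?R
    have "norm (f x) \<le> K" for x
      using R[THEN conjunct2, THEN conjunct1, rule_format, of "[]" x] by simp
    moreover have "holder_bd n \<gamma> K (dirder f v)" if v: "norm v \<le> 1" for v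
      unfolding Suc.IH
    proof (intro conjI allI impI)
      show "Cn_map n (dirder f v)" using R by (simp add: Cn_map_Suc)
      show "norm (iter_deriv (dirder f v) vs x) \<le> K"
        if "length vs \<le> n" "\<forall>v\<in>set vs. norm v \<le> 1" for vs x
        using R[THEN conjunct2, THEN conjunct1, rule_format, of "vs @ [v]" x] that v
        by (auto simp: iter_deriv_snoc)
      show "norm (iter_deriv (dirder f v) vs x - iter_deriv (dirder f v) vs y) \<le> K * norm (x - y) powr \<gamma>"
        if "length vs = n" "\<forall>v\<in>set vs. norm v \<le> 1" for vs x y
        using R[THEN conjunct2, THEN conjunct2, rule_format, of "vs @ [v]" x y] that v
        by (auto simp: iter_deriv_snoc)
    qed
    ultimately show ?L using R by (simp add: Cn_map_Suc)
  qed
qed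

text \<open>\<open>0 \<le> K\<close> has to be stated on the right because \<open>ennreal\<close>
  sends negative reals to 0.\<close>

lemma holder_bd_iff_holder_norm:
  assumes "0 < \<gamma>"
  shows "holder_bd n \<gamma> K f \<longleftrightarrow> 0 \<le> K \<and> Cn_map n f \<and> holder_norm n \<gamma> f \<le> ennreal K"
  using holder_bd_nonneg[of n \<gamma> K f] holder_bd_iff_iter_deriv[OF assms, of n K f]
    holder_norm_le_iff[of K n \<gamma> f] by auto

lemma multilinear_norm_0 [simp]: "multilinear_norm 0 A = ennreal (norm (A []))"
proof -
  have "{vs :: 'a list. length vs = 0 \<and> (\<forall>v\<in>set vs. norm v \<le> 1)} = {[]}" by auto
  then show ?thesis by (simp add: multilinear_norm_def)
qed

text \<open>By interpolation, decay of \<open>f\<close> alone forces decay of its derivatives.\<close>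

lemma tendsto_iter_deriv_at_infinity:
  fixes f :: "'a::euclidean_space \<Rightarrow> 'b::euclidean_space"
  assumes \<gamma>: "0 < \<gamma>" "\<gamma> \<le> 1" and f: "holder_bd n \<gamma> K f" and lim: "(f \<longlongrightarrow> 0) at_infinity" and l: "l \<le> n"
  shows "((\<lambda>x. multilinear_norm l (\<lambda>vs. iter_deriv f vs x)) \<longlongrightarrow> 0) at_infinity"
proof (rule order_tendstoI)
  fix a :: ennreal assume "0 < a"
  then obtain b where b: "0 < b" "b < a" using dense by blast
  then obtain \<epsilon> where \<epsilon>: "b = ennreal \<epsilon>" "0 < \<epsilon>"
    by (cases b) (auto simp: top_unique)
  obtain \<delta> where \<delta>: "\<delta> > 0" and small: "\<forall>(f :: 'a \<Rightarrow> 'b) x vs. holder_bd n \<gamma> K f \<longrightarrow>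
    (\<forall>y. norm (x - y) < 1 \<longrightarrow> norm (f y) \<le> \<delta>) \<longrightarrow> length vs \<le> n \<longrightarrow> (\<forall>v\<in>set vs. norm v \<le> 1) \<longrightarrow>
    norm (iter_deriv f vs x) \<le> \<epsilon>"
    using iter_deriv_small[OF \<gamma> \<epsilon>(2) zero_less_one, of n K] by (elim exE conjE) (rule that; assumption)
  have "\<forall>\<^sub>F x in at_infinity. dist (f x) 0 < \<delta>" using tendstoD[OF lim \<delta>] .
  then obtain B where B: "\<And>x. B \<le> norm x \<Longrightarrow> norm (f x) < \<delta>"
    by (auto simp: eventually_at_infinity)
  \<comment> \<open>With B + 1 the whole unit ball around x stays where f is already small.\<close>
  have "multilinear_norm l (\<lambda>vs. iter_deriv f vs x) < a" if x: "B + 1 \<le> norm x" for x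
  proof -
    have "norm (f y) \<le> \<delta>" if "norm (x - y) < 1" for y
    proof -
      have "norm x \<le> norm (x - y) + norm y" using norm_triangle_ineq[of "x - y" y] by simp
      then show ?thesis using B[of y] that x by auto
    qed
    then have "norm (iter_deriv f vs x) \<le> \<epsilon>" if "length vs = l" "\<forall>v\<in>set vs. norm v \<le> 1" for vs
      using small[rule_format, OF f, of x vs] that l by blast
    then have "multilinear_norm l (\<lambda>vs. iter_deriv f vs x) \<le> b"
      using \<epsilon> by (auto simp: multilinear_norm_def SUP_le_iff)
    then show ?thesis using b by simp
  qed
  then show "\<forall>\<^sub>F x in at_infinity. multilinear_norm l (\<lambda>vs. iter_deriv f vs x) < a"
    unfolding eventually_at_infinity by blast
qed auto

text \<open>The working description of the space: decay of the derivatives follows from decay of f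
  by interpolation, so only a Hoelder bound and a limit of f have to be tracked.\<close>

lemma C0_holder_iff:
  assumes "0 < \<gamma>" "\<gamma> \<le> 1"
  shows "f \<in> C0_holder n \<gamma> \<longleftrightarrow> (\<exists>K. holder_bd n \<gamma> K f) \<and> (f \<longlongrightarrow> 0) at_infinity" (is "?L \<longleftrightarrow> ?R")
proof
  assume L: ?L
  then have "\<forall>l\<le>n. ((\<lambda>x. multilinear_norm l (\<lambda>vs. iter_deriv f vs x)) \<longlongrightarrow> 0) at_infinity"
    by (simp add: C0_holder_def)
  from this[rule_format, of 0] have "((\<lambda>x. ennreal (norm (f x))) \<longlongrightarrow> ennreal 0) at_infinity" by simp
  then have "((\<lambda>x. norm (f x)) \<longlongrightarrow> 0) at_infinity"
    by (subst (asm) tendsto_ennreal_iff) auto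
  then have "(f \<longlongrightarrow> 0) at_infinity" by (simp add: tendsto_norm_zero_iff)
  moreover have "holder_bd n \<gamma> (enn2real (holder_norm n \<gamma> f)) f"
    using L assms by (auto simp: holder_bd_iff_holder_norm C0_holder_def)
  ultimately show ?R by blast
next
  assume ?R
  then obtain K where "holder_bd n \<gamma> K f" "(f \<longlongrightarrow> 0) at_infinity" by blast
  moreover from this have "holder_norm n \<gamma> f < \<infinity>"
    using assms by (auto simp: holder_bd_iff_holder_norm intro: le_less_trans)
  ultimately show ?L
    using assms tendsto_iter_deriv_at_infinity[OF assms] by (auto simp: C0_holder_def holder_bd_iff_holder_norm)
qed

lemma C0_holder_tendsto:
  "0 < \<gamma> \<Longrightarrow> \<gamma> \<le> 1 \<Longrightarrow> f \<in> C0_holder n \<gamma> \<Longrightarrow> (f \<longlongrightarrow> 0) at_infinity"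
  by (simp add: C0_holder_iff)

lemma holder_bd_enn2real:
  "0 < \<gamma> \<Longrightarrow> f \<in> C0_holder n \<gamma> \<Longrightarrow> holder_bd n \<gamma> (enn2real (holder_norm n \<gamma> f)) f"
  by (auto simp: holder_bd_iff_holder_norm C0_holder_def)

lemma holder_norm_leI: "0 < \<gamma> \<Longrightarrow> holder_bd n \<gamma> K f \<Longrightarrow> holder_norm n \<gamma> f \<le> ennreal K"
  by (simp add: holder_bd_iff_holder_norm)

lemma C0_holder_zero: "0 < \<gamma> \<Longrightarrow> \<gamma> \<le> 1 \<Longrightarrow> 0 \<in> C0_holder n \<gamma>"
  using holder_bd_zero[of n \<gamma>] by (auto simp: C0_holder_iff zero_fun_def)

lemma C0_holder_add:
  assumes "0 < \<gamma>" "\<gamma> \<le> 1" "f \<in> C0_holder n \<gamma>" "g \<in> C0_holder n \<gamma>"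
  shows "f + g \<in> C0_holder n \<gamma>"
  using assms holder_bd_add[of n \<gamma> _ f _ g] tendsto_add[of f 0 at_infinity g 0]
  by (auto simp: C0_holder_iff plus_fun_def)

lemma C0_holder_scaleR:
  assumes "0 < \<gamma>" "\<gamma> \<le> 1" "f \<in> C0_holder n \<gamma>"
  shows "c *\<^sub>R f \<in> C0_holder n \<gamma>"
  using assms holder_bd_scaleR[of n \<gamma> _ f c] tendsto_scaleR[OF tendsto_const, of f 0 at_infinity c]
  by (auto simp: C0_holder_iff scaleR_fun_def)

lemma holder_norm_add:
  assumes "0 < \<gamma>" "f \<in> C0_holder n \<gamma>" "g \<in> C0_holder n \<gamma>"
  shows "holder_norm n \<gamma> (f + g) \<le> holder_norm n \<gamma> f + holder_norm n \<gamma> g"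
proof -
  have "holder_norm n \<gamma> (f + g) \<le> ennreal (enn2real (holder_norm n \<gamma> f) + enn2real (holder_norm n \<gamma> g))"
    using holder_bd_add[OF holder_bd_enn2real[OF assms(1,2)] holder_bd_enn2real[OF assms(1,3)]]
    by (intro holder_norm_leI[OF assms(1)]) (simp add: plus_fun_def)
  also have "\<dots> = holder_norm n \<gamma> f + holder_norm n \<gamma> g"
    using assms by (simp add: C0_holder_def)
  finally show ?thesis .
qed

lemma holder_norm_scaleR:
  assumes "0 < \<gamma>" "f \<in> C0_holder n \<gamma>"
  shows "holder_norm n \<gamma> (c *\<^sub>R f) \<le> ennreal \<bar>c\<bar> * holder_norm n \<gamma> f"
proof -
  have "holder_norm n \<gamma> (c *\<^sub>R f) \<le> ennreal (\<bar>c\<bar> * enn2real (holder_norm n \<gamma> f))"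
    using holder_bd_scaleR[OF holder_bd_enn2real[OF assms], of c]
    by (intro holder_norm_leI[OF assms(1)]) (simp add: scaleR_fun_def)
  also have "\<dots> = ennreal \<bar>c\<bar> * holder_norm n \<gamma> f"
    using assms by (simp add: C0_holder_def ennreal_mult)
  finally show ?thesis .
qed

text \<open>\<open>frechet_derivative\<close> is additive only where both functions are
  differentiable, hence the hypotheses and the length bound. Together with
  \<open>iter_deriv_scaleR\<close> this makes evaluation of a derivative a linear functional on
  \<open>C0_holder\<close>, through which integrals are passed.\<close>

lemma iter_deriv_add:
  assumes "Cn_map n f" "Cn_map n g"
  shows "length vs \<le> n \<Longrightarrow> iter_deriv (f + g) vs = (\<lambda>x. iter_deriv f vs x + iter_deriv g vs x)"
proof (induction vs)
  case Nil
  then show ?case by (simp add: plus_fun_def)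
next
  case (Cons v vs)
  have "dirder (\<lambda>x. iter_deriv f vs x + iter_deriv g vs x) v =
    (\<lambda>x. dirder (iter_deriv f vs) v x + dirder (iter_deriv g vs) v x)"
    using assms Cons by (intro dirder_add) (auto simp: Cn_map_def)
  then show ?case using Cons by (simp add: dirder_def[abs_def])
qed

lemma iter_deriv_scaleR:
  assumes "Cn_map n f"
  shows "length vs \<le> n \<Longrightarrow> iter_deriv (c *\<^sub>R f) vs = (\<lambda>x. c *\<^sub>R iter_deriv f vs x)"
proof (induction vs)
  case Nil
  then show ?case by (simp add: scaleR_fun_def)
next
  case (Cons v vs)
  have "dirder (\<lambda>x. c *\<^sub>R iter_deriv f vs x) v = (\<lambda>x. c *\<^sub>R dirder (iter_deriv f vs) v x)"
    using assms Cons by (intro dirder_bounded_linear bounded_linear_scaleR_right) (auto simp: Cn_map_def)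
  then show ?case using Cons by (simp add: dirder_def[abs_def])
qed

text \<open>A map at bounded distance from the identity tends to infinity at infinity.\<close>

lemma tendsto_comp_at_infinity:
  fixes w :: "'a::euclidean_space \<Rightarrow> 'b::euclidean_space"
  assumes "(w \<longlongrightarrow> 0) at_infinity" "\<And>x. norm (\<phi> x - x) \<le> M"
  shows "((\<lambda>x. w (\<phi> x)) \<longlongrightarrow> 0) at_infinity"
proof (rule filterlim_compose[OF assms(1)])
  show "filterlim \<phi> at_infinity at_infinity"
    unfolding filterlim_at_infinity[OF order_refl] eventually_at_infinity
  proof (intro allI impI exI)
    fix r and x :: 'a assume "r + M \<le> norm x"
    moreover have "norm x \<le> norm (\<phi> x - x) + norm (\<phi> x)"
      using norm_triangle_ineq4[of "\<phi> x" "\<phi> x - x"] by simp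
    ultimately show "r \<le> norm (\<phi> x)" using assms(2)[of x] by linarith
  qed
qed


section \<open>Bochner integrals in a normed carrier\<close>

text \<open>Preimages under g differ from those under the pointwise \<open>lim\<close> by a subset
  of a null set, and completeness makes such sets measurable.\<close>

lemma (in complete_measure) borel_measurable_AE_LIMSEQ:
  fixes f :: "nat \<Rightarrow> 'a \<Rightarrow> 'b::{banach, second_countable_topology}"
  assumes "\<And>i. f i \<in> borel_measurable M" and lim: "AE x in M. (\<lambda>i. f i x) \<longlonglongrightarrow> g x"
  shows "g \<in> borel_measurable M"
proof (rule measurableI)
  let ?l = "\<lambda>x. lim (\<lambda>i. f i x)"
  have l: "?l \<in> borel_measurable M" using assms(1) by (rule borel_measurable_lim_metric)
  fix A :: "'b set" assume "A \<in> sets borel"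
  with l have "?l -` A \<inter> space M \<in> sets M" by (rule measurable_sets)
  moreover have "AE x in M. x \<in> ?l -` A \<inter> space M \<longleftrightarrow> x \<in> g -` A \<inter> space M"
    using lim AE_space by eventually_elim (auto simp: limI)
  ultimately show "g -` A \<inter> space M \<in> sets M"
    by (elim in_sets_AE[rotated]) auto
qed simp

lemma complete_measure_lebesgue_on:
  assumes "S \<in> sets lebesgue"
  shows "complete_measure (lebesgue_on S)"
proof
  fix A B assume "B \<subseteq> A" "A \<in> null_sets (lebesgue_on S)"
  then have "B \<in> null_sets lebesgue" "B \<subseteq> S"
    using assms completion.complete2[of B A lborel] by (auto simp: null_sets_restrict_space)
  then show "B \<in> sets (lebesgue_on S)"
    using assms by (auto simp: sets_restrict_space_iff)
qed

text \<open>The linear structure and norm estimates that integration needs, separated from Hoelder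
  spaces because they are instantiated for several exponents. The inequality in
  \<open>norm_scale\<close> already yields \<open>nr 0 = 0\<close> and, by scaling with -1, symmetry
  of the distance.\<close>

locale normed_carrier =
  fixes E :: "'v::real_vector set" and N :: "'v \<Rightarrow> ennreal"
  assumes zero_mem: "0 \<in> E"
    and add_mem: "x \<in> E \<Longrightarrow> y \<in> E \<Longrightarrow> x + y \<in> E"
    and scale_mem: "x \<in> E \<Longrightarrow> c *\<^sub>R x \<in> E"
    and norm_finite: "x \<in> E \<Longrightarrow> N x < \<infinity>"
    and norm_add: "x \<in> E \<Longrightarrow> y \<in> E \<Longrightarrow> N (x + y) \<le> N x + N y"
    and norm_scale: "x \<in> E \<Longrightarrow> N (c *\<^sub>R x) \<le> ennreal \<bar>c\<bar> * N x"
begin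

definition nr :: "'v \<Rightarrow> real" where "nr x = enn2real (N x)"

lemma nr_nonneg [simp]: "0 \<le> nr x" by (simp add: nr_def)

lemma N_eq: "x \<in> E \<Longrightarrow> N x = ennreal (nr x)"
  using norm_finite by (simp add: nr_def)

lemma nr_add: "x \<in> E \<Longrightarrow> y \<in> E \<Longrightarrow> nr (x + y) \<le> nr x + nr y"
  using norm_add[of x y] by (simp add: N_eq add_mem flip: ennreal_plus)

lemma nr_scale: "x \<in> E \<Longrightarrow> nr (c *\<^sub>R x) \<le> \<bar>c\<bar> * nr x"
  using norm_scale[of x c] by (simp add: N_eq scale_mem flip: ennreal_mult)

lemma nr_0 [simp]: "nr 0 = 0"
  using nr_scale[OF zero_mem, of 0] nr_nonneg[of 0] by simp

lemma diff_mem: "x \<in> E \<Longrightarrow> y \<in> E \<Longrightarrow> x - y \<in> E"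
  using add_mem[of x "(-1) *\<^sub>R y"] scale_mem[of y "-1"] by simp

lemma sum_mem: "(\<And>i. i \<in> A \<Longrightarrow> f i \<in> E) \<Longrightarrow> sum f A \<in> E"
  by (induction A rule: infinite_finite_induct) (auto intro: zero_mem add_mem)

lemma nr_sum: "finite A \<Longrightarrow> (\<And>i. i \<in> A \<Longrightarrow> f i \<in> E) \<Longrightarrow> nr (sum f A) \<le> (\<Sum>i\<in>A. nr (f i))"
  by (induction A rule: finite_induct) (auto intro!: order_trans[OF nr_add] sum_mem)

lemma nr_minus_commute: "x \<in> E \<Longrightarrow> y \<in> E \<Longrightarrow> nr (x - y) = nr (y - x)"
  using nr_scale[OF diff_mem, of x y "-1"] nr_scale[OF diff_mem, of y x "-1"] by simp

lemma nr_triangle: "x \<in> E \<Longrightarrow> y \<in> E \<Longrightarrow> z \<in> E \<Longrightarrow> nr (x - z) \<le> nr (x - y) + nr (y - z)"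
  using nr_add[of "x - y" "y - z"] by (simp add: diff_mem)

lemma nr_diff_le: "x \<in> E \<Longrightarrow> y \<in> E \<Longrightarrow> \<bar>nr x - nr y\<bar> \<le> nr (x - y)"
  using nr_triangle[of x y 0] nr_triangle[of y x 0] nr_minus_commute[of x y]
  by (simp add: zero_mem abs_le_iff)

lemma strongly_measurable_in_obtain:
  assumes "strongly_measurable_in E N M f"
  obtains s where "\<And>i. simple_function M (s i)" "\<And>i x. x \<in> space M \<Longrightarrow> s i x \<in> E"
    "\<And>x. x \<in> space M \<Longrightarrow> f x \<in> E" "AE x in M. (\<lambda>i. nr (f x - s i x)) \<longlonglongrightarrow> 0"
proof -
  obtain s where s: "\<And>i. simple_function M (s i)" "\<And>i. s i ` space M \<subseteq> E"
    and f: "\<And>x. x \<in> space M \<Longrightarrow> f x \<in> E" and lim: "AE x in M. (\<lambda>i. N (f x - s i x)) \<longlonglongrightarrow> 0"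
    using assms unfolding strongly_measurable_in_def by blast
  have sE: "s i x \<in> E" if "x \<in> space M" for i x using s(2)[of i] that by blast
  have "AE x in M. (\<lambda>i. nr (f x - s i x)) \<longlonglongrightarrow> 0"
    using lim AE_space
  proof eventually_elim
    case (elim x)
    then have "(\<lambda>i. ennreal (nr (f x - s i x))) \<longlonglongrightarrow> ennreal 0"
      using f sE by (simp add: N_eq diff_mem)
    then show ?case by (subst (asm) tendsto_ennreal_iff) auto
  qed
  with that s f sE show thesis by blast
qed

text \<open>\<open>nr (s i x - g x)\<close> is a simple function for simple s i and g, and the
  reverse triangle inequality carries the a.e. convergence over to the norms. No Borel structure on
  \<open>E\<close> is involved.\<close>

lemma nr_diff_measurable:
  assumes "complete_measure M" "strongly_measurable_in E N M f"
    and g: "simple_function M g" "\<And>x. x \<in> space M \<Longrightarrow> g x \<in> E"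
  shows "(\<lambda>x. nr (f x - g x)) \<in> borel_measurable M"
proof -
  interpret complete_measure M by fact
  obtain s where s: "\<And>i. simple_function M (s i)" "\<And>i x. x \<in> space M \<Longrightarrow> s i x \<in> E"
    and f: "\<And>x. x \<in> space M \<Longrightarrow> f x \<in> E" and lim: "AE x in M. (\<lambda>i. nr (f x - s i x)) \<longlonglongrightarrow> 0"
    by (rule strongly_measurable_in_obtain[OF assms(2)]) blast
  show ?thesis
  proof (rule borel_measurable_AE_LIMSEQ)
    show "(\<lambda>x. nr (s i x - g x)) \<in> borel_measurable M" for i
      by (intro borel_measurable_simple_function simple_function_compose2[of M "s i" g "\<lambda>a b. nr (a - b)"] s g)
    show "AE x in M. (\<lambda>i. nr (s i x - g x)) \<longlonglongrightarrow> nr (f x - g x)"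
      using lim AE_space
    proof eventually_elim
      case (elim x)
      have "\<bar>nr (s i x - g x) - nr (f x - g x)\<bar> \<le> nr (f x - s i x)" for i
        using nr_diff_le[of "s i x - g x" "f x - g x"] nr_minus_commute[of "s i x" "f x"] elim s f g
        by (simp add: diff_mem)
      then have "(\<lambda>i. nr (s i x - g x) - nr (f x - g x)) \<longlonglongrightarrow> 0"
        by (intro tendsto_0_le[OF elim(1), of _ 1]) auto
      then show ?case by (simp add: LIM_zero_iff)
    qed
  qed
qed

lemma nr_measurable:
  assumes "complete_measure M" "strongly_measurable_in E N M f"
  shows "(\<lambda>x. nr (f x)) \<in> borel_measurable M"
  using nr_diff_measurable[OF assms, of "\<lambda>x. 0"] by (simp add: zero_mem)

text \<open>Dominated convergence turns a.e. approximation into approximation in mean. Finiteness of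
  the measure makes the simple functions and the constant in the majorant integrable.\<close>

lemma simple_approximation:
  assumes M: "complete_measure M" "finite_measure M" and f: "strongly_measurable_in E N M f"
    and g: "integrable M g" "\<And>x. x \<in> space M \<Longrightarrow> nr (f x) \<le> g x"
  obtains s where "\<And>i. Bochner_Integration.simple_bochner_integrable M (s i)" "\<And>i x. x \<in> space M \<Longrightarrow> s i x \<in> E"
    "(\<lambda>i::nat. \<integral>\<^sup>+x. nr (f x - s i x) \<partial>M) \<longlonglongrightarrow> 0"
proof -
  interpret finite_measure M by fact
  obtain s where s: "\<And>i. simple_function M (s i)" "\<And>i x. x \<in> space M \<Longrightarrow> s i x \<in> E"
    and fE: "\<And>x. x \<in> space M \<Longrightarrow> f x \<in> E" and lim: "AE x in M. (\<lambda>i. nr (f x - s i x)) \<longlonglongrightarrow> 0"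
    by (rule strongly_measurable_in_obtain[OF f]) blast
  \<comment> \<open>the truncation supplies an integrable majorant and is eventually inactive at almost every point\<close>
  define t where "t = (\<lambda>i x. if nr (s i x) \<le> g x + 1 then s i x else 0)"
  have [measurable]: "(\<lambda>x. nr (s i x)) \<in> borel_measurable M" for i
    by (intro borel_measurable_simple_function simple_function_compose1[of M "s i" nr] s)
  have [measurable]: "g \<in> borel_measurable M" using g by simp
  have t: "simple_function M (t i)" for i
    unfolding t_def by (intro simple_function_If s simple_function_const) measurable
  have tE: "t i x \<in> E" if "x \<in> space M" for i x
    using s that by (auto simp: t_def zero_mem)
  have g0: "0 \<le> g x" if "x \<in> space M" for x using g(2)[OF that] nr_nonneg[of "f x"] by linarith
  \<comment> \<open>The convergence theorem speaks of the distance to a limit function, here 0. The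
    majorant 2 * g + 1 adds the bound g for f and the bound g + 1 for the truncated
    functions.\<close>
  have "(\<lambda>i. \<integral>\<^sup>+x. norm (0 - nr (f x - t i x)) \<partial>M) \<longlonglongrightarrow> 0"
  proof (rule nn_integral_dominated_convergence_norm[where w="\<lambda>x. 2 * g x + 1"])
    show "(\<lambda>x. nr (f x - t i x)) \<in> borel_measurable M" for i
      by (rule nr_diff_measurable[OF M(1) f t tE])
    show "AE x in M. norm (nr (f x - t i x)) \<le> 2 * g x + 1" for i
      using AE_space
    proof eventually_elim
      case (elim x)
      have "nr (t i x) \<le> g x + 1" using g0[OF elim] by (auto simp: t_def)
      then show ?case
        using nr_triangle[of "f x" 0 "t i x"] g(2)[OF elim] nr_minus_commute[of 0 "t i x"] fE[OF elim] tE[OF elim]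
        by (simp add: zero_mem)
    qed
    have "integrable M (\<lambda>x. 2 * g x + 1)" using g by auto
    then have "(\<integral>\<^sup>+x. norm (2 * g x + 1) \<partial>M) < \<infinity>" by (simp add: integrable_iff_bounded)
    moreover have "(\<integral>\<^sup>+x. norm (2 * g x + 1) \<partial>M) = (\<integral>\<^sup>+x. ennreal (2 * g x + 1) \<partial>M)"
      using g0 by (intro nn_integral_cong) auto
    ultimately show "(\<integral>\<^sup>+x. ennreal (2 * g x + 1) \<partial>M) < \<infinity>" by simp
    show "AE x in M. (\<lambda>i. nr (f x - t i x)) \<longlonglongrightarrow> 0"
      using lim AE_space
    proof eventually_elim
      case (elim x)
      have "\<forall>\<^sub>F i in sequentially. nr (f x - s i x) < 1"
        using order_tendstoD(2)[OF elim(1)] by simp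
      then have "\<forall>\<^sub>F i in sequentially. nr (f x - s i x) = nr (f x - t i x)"
      proof eventually_elim
        case (elim i)
        then have "nr (s i x) \<le> g x + 1"
          using nr_diff_le[of "f x" "s i x"] g(2)[of x] s fE \<open>x \<in> space M\<close> by fastforce
        then show ?case by (simp add: t_def)
      qed
      with elim(1) show ?case by (rule Lim_transform_eventually)
    qed
  qed auto
  then have "(\<lambda>i. \<integral>\<^sup>+x. nr (f x - t i x) \<partial>M) \<longlonglongrightarrow> 0" by simp
  moreover have "Bochner_Integration.simple_bochner_integrable M (t i)" for i
    using t by (auto intro!: simple_bochner_integrable.intros)
  ultimately show thesis using tE that by blast
qed

lemma simple_bochner_integral_mem:
  assumes "\<And>x. x \<in> space M \<Longrightarrow> s x \<in> E"
  shows "Bochner_Integration.simple_bochner_integral M s \<in> E"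
  unfolding simple_bochner_integral_def using assms by (auto intro!: sum_mem scale_mem)

lemma nr_simple_bochner_integral_le:
  assumes s: "Bochner_Integration.simple_bochner_integrable M s" "\<And>x. x \<in> space M \<Longrightarrow> s x \<in> E"
  shows "ennreal (nr (Bochner_Integration.simple_bochner_integral M s)) \<le> (\<integral>\<^sup>+x. nr (s x) \<partial>M)"
proof -
  have sf: "simple_function M s" using s by (auto elim: simple_bochner_integrable.cases)
  have ns: "Bochner_Integration.simple_bochner_integrable M (\<lambda>x. nr (s x))"
    using simple_bochner_integrable_compose2[of "\<lambda>x y. nr x", OF _ s(1) s(1)] by simp
  have "nr (Bochner_Integration.simple_bochner_integral M s) \<le> (\<Sum>y\<in>s ` space M. nr (measure M {x\<in>space M. s x = y} *\<^sub>R y))"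
    unfolding simple_bochner_integral_def
    using s sf by (intro nr_sum) (auto simp: simple_function_def intro!: scale_mem)
  also have "\<dots> \<le> (\<Sum>y\<in>s ` space M. measure M {x\<in>space M. s x = y} *\<^sub>R nr y)"
    using s by (intro sum_mono) (auto intro!: order_trans[OF nr_scale])
  also have "\<dots> = Bochner_Integration.simple_bochner_integral M (\<lambda>x. nr (s x))"
    by (rule simple_bochner_integral_partition[OF ns sf, symmetric]) auto
  finally have "ennreal (nr (Bochner_Integration.simple_bochner_integral M s)) \<le> ennreal (Bochner_Integration.simple_bochner_integral M (\<lambda>x. nr (s x)))"
    by (rule ennreal_leI)
  also have "\<dots> = (\<integral>\<^sup>+x. nr (s x) \<partial>M)"
    by (rule simple_bochner_integral_eq_nn_integral[OF ns]) simp
  finally show ?thesis .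
qed

lemma has_bochner_integral_in_obtain:
  assumes "has_bochner_integral_in E N M f v"
  obtains s where "\<And>i. Bochner_Integration.simple_bochner_integrable M (s i)" "\<And>i x. x \<in> space M \<Longrightarrow> s i x \<in> E"
    "(\<lambda>i::nat. \<integral>\<^sup>+x. nr (f x - s i x) \<partial>M) \<longlonglongrightarrow> 0"
    "(\<lambda>i. nr (Bochner_Integration.simple_bochner_integral M (s i) - v)) \<longlonglongrightarrow> 0"
proof -
  obtain s where s: "\<And>i. Bochner_Integration.simple_bochner_integrable M (s i)" "\<And>i. s i ` space M \<subseteq> E"
    and lim: "(\<lambda>i::nat. \<integral>\<^sup>+x. N (f x - s i x) \<partial>M) \<longlonglongrightarrow> 0"
    "(\<lambda>i. N (Bochner_Integration.simple_bochner_integral M (s i) - v)) \<longlonglongrightarrow> 0"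
    using assms unfolding has_bochner_integral_in_def by (elim conjE exE) (rule that; simp)
  have f: "\<And>x. x \<in> space M \<Longrightarrow> f x \<in> E" and v: "v \<in> E"
    using assms by (auto simp: has_bochner_integral_in_def strongly_measurable_in_def)
  have sE: "s i x \<in> E" if "x \<in> space M" for i x using s(2)[of i] that by blast
  have "(\<integral>\<^sup>+x. N (f x - s i x) \<partial>M) = (\<integral>\<^sup>+x. nr (f x - s i x) \<partial>M)" for i
    using sE f by (intro nn_integral_cong) (simp add: N_eq diff_mem)
  moreover have "(\<lambda>i. ennreal (nr (Bochner_Integration.simple_bochner_integral M (s i) - v))) \<longlonglongrightarrow> ennreal 0"
    using lim(2) v simple_bochner_integral_mem[of M "s _"] sE by (simp add: N_eq diff_mem)
  then have "(\<lambda>i. nr (Bochner_Integration.simple_bochner_integral M (s i) - v)) \<longlonglongrightarrow> 0"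
    by (subst (asm) tendsto_ennreal_iff) auto
  ultimately show thesis
    using lim(1) by (intro that[of s] s sE) simp_all
qed

text \<open>One simple function at mean distance less than 1 from f is enough: its norm is
  integrable, and the triangle inequality bounds the norm of f.\<close>

lemma integrable_nr:
  assumes M: "complete_measure M" and f: "has_bochner_integral_in E N M f v"
  shows "integrable M (\<lambda>x. nr (f x))"
proof -
  obtain s where s: "\<And>i. Bochner_Integration.simple_bochner_integrable M (s i)" "\<And>i x. x \<in> space M \<Longrightarrow> s i x \<in> E"
    and lim: "(\<lambda>i::nat. \<integral>\<^sup>+x. nr (f x - s i x) \<partial>M) \<longlonglongrightarrow> 0"
    by (rule has_bochner_integral_in_obtain[OF f]) (rule that; assumption)
  have sf: "simple_function M (s i)" for i using s by (auto elim: simple_bochner_integrable.cases)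
  have fm: "strongly_measurable_in E N M f" using f by (simp add: has_bochner_integral_in_def)
  have fE: "f x \<in> E" if "x \<in> space M" for x using fm that by (simp add: strongly_measurable_in_def)
  have m: "(\<lambda>x. nr (f x)) \<in> borel_measurable M" by (rule nr_measurable[OF M fm])
  have "\<forall>\<^sub>F i in sequentially. (\<integral>\<^sup>+x. nr (f x - s i x) \<partial>M) < 1"
    using order_tendstoD(2)[OF lim] by simp
  then obtain i where i: "(\<integral>\<^sup>+x. nr (f x - s i x) \<partial>M) < 1"
    by (meson eventually_happens sequentially_bot)
  have ns: "Bochner_Integration.simple_bochner_integrable M (\<lambda>x. nr (s i x))"
    using simple_bochner_integrable_compose2[of "\<lambda>x y. nr x", OF _ s(1) s(1)] by simp
  have "(\<integral>\<^sup>+x. nr (f x) \<partial>M) \<le> (\<integral>\<^sup>+x. ennreal (nr (f x - s i x)) + ennreal (nr (s i x)) \<partial>M)"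
    using nr_triangle[of "f _" "s i _" 0] fE s
    by (intro nn_integral_mono) (simp add: zero_mem flip: ennreal_plus)
  also have "\<dots> = (\<integral>\<^sup>+x. nr (f x - s i x) \<partial>M) + (\<integral>\<^sup>+x. nr (s i x) \<partial>M)"
    using nr_diff_measurable[OF M fm sf s(2), of i]
      borel_measurable_simple_function[OF simple_function_compose1[OF sf, of nr]]
    by (intro nn_integral_add) auto
  also have "\<dots> < \<infinity>"
  proof -
    have "(\<integral>\<^sup>+x. nr (f x - s i x) \<partial>M) < top" using i by (rule less_trans) simp
    then show ?thesis
      using simple_bochner_integral_eq_nn_integral[OF ns, symmetric] by (simp add: less_top[symmetric])
  qed
  finally show ?thesis using m by (simp add: integrable_iff_bounded)
qed

text \<open>The bridge to the library integral. With T an evaluation of a derivative at a point, it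
  turns statements about the integral in the carrier into statements about integrals of
  finite-dimensional vectors.\<close>

lemma has_bochner_integral_functional:
  fixes T :: "'v \<Rightarrow> 'b::{banach, second_countable_topology}"
  assumes M: "complete_measure M" and f: "has_bochner_integral_in E N M f v"
    and T: "\<And>x y. x \<in> E \<Longrightarrow> y \<in> E \<Longrightarrow> T (x + y) = T x + T y"
      "\<And>c x. x \<in> E \<Longrightarrow> T (c *\<^sub>R x) = c *\<^sub>R T x" "\<And>x. x \<in> E \<Longrightarrow> norm (T x) \<le> nr x"
  shows "has_bochner_integral M (\<lambda>x. T (f x)) (T v)"
proof -
  interpret complete_measure M by fact
  have T0: "T 0 = 0" using T(2)[OF zero_mem, of 0] by simp
  have Tdiff: "T (x - y) = T x - T y" if "x \<in> E" "y \<in> E" for x y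
    using T(1)[of "x - y" y] that by (simp add: diff_mem algebra_simps)
  have Tsum: "T (sum h A) = (\<Sum>i\<in>A. T (h i))" if "finite A" "\<And>i. i \<in> A \<Longrightarrow> h i \<in> E" for h :: "'v \<Rightarrow> 'v" and A
    using that by (induction A rule: finite_induct) (auto simp: T0 T(1) sum_mem)
  have fm: "strongly_measurable_in E N M f" and vE: "v \<in> E" using f by (auto simp: has_bochner_integral_in_def)
  \<comment> \<open>Two approximating sequences are needed: \<open>t\<close> converges a.e. and
    gives measurability, \<open>s\<close> below converges in mean and gives the value.\<close>
  obtain t where t: "\<And>i. simple_function M (t i)" "\<And>i x. x \<in> space M \<Longrightarrow> t i x \<in> E"
    and fE: "\<And>x. x \<in> space M \<Longrightarrow> f x \<in> E" and tlim: "AE x in M. (\<lambda>i. nr (f x - t i x)) \<longlonglongrightarrow> 0"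
    by (rule strongly_measurable_in_obtain[OF fm]) blast
  obtain s where s: "\<And>i. Bochner_Integration.simple_bochner_integrable M (s i)" "\<And>i x. x \<in> space M \<Longrightarrow> s i x \<in> E"
    and lim: "(\<lambda>i::nat. \<integral>\<^sup>+x. nr (f x - s i x) \<partial>M) \<longlonglongrightarrow> 0"
    and lim2: "(\<lambda>i. nr (Bochner_Integration.simple_bochner_integral M (s i) - v)) \<longlonglongrightarrow> 0"
    by (rule has_bochner_integral_in_obtain[OF f]) (rule that; assumption)
  have sf: "simple_function M (s i)" for i using s by (auto elim: simple_bochner_integrable.cases)
  have Ts: "Bochner_Integration.simple_bochner_integrable M (\<lambda>x. T (s i x))" for i
    using simple_bochner_integrable_compose2[of "\<lambda>x y. T x", OF _ s(1) s(1)] T0 by simp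
  show ?thesis
  proof (rule has_bochner_integral.intros)
    show "(\<lambda>x. T (f x)) \<in> borel_measurable M"
    proof (rule borel_measurable_AE_LIMSEQ)
      show "(\<lambda>x. T (t i x)) \<in> borel_measurable M" for i
        by (rule borel_measurable_simple_function[OF simple_function_compose1[OF t(1), of T]])
      show "AE x in M. (\<lambda>i. T (t i x)) \<longlonglongrightarrow> T (f x)"
        using tlim AE_space
      proof eventually_elim
        case (elim x)
        have "norm (T (f x) - T (t i x)) \<le> nr (f x - t i x)" for i
          using T(3)[of "f x - t i x"] Tdiff fE t elim by (simp add: diff_mem)
        then have "(\<lambda>i. T (f x) - T (t i x)) \<longlonglongrightarrow> 0"
          using elim(1) by (intro Lim_null_comparison[of "\<lambda>i. T (f x) - T (t i x)"]) auto
        from tendsto_diff[OF tendsto_const[of "T (f x)"] this] show ?case by simp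
      qed
    qed
    show "Bochner_Integration.simple_bochner_integrable M (\<lambda>x. T (s i x))" for i by (rule Ts)
    show "(\<lambda>i. \<integral>\<^sup>+x. norm (T (f x) - T (s i x)) \<partial>M) \<longlonglongrightarrow> 0"
    proof (rule tendsto_sandwich[OF _ _ tendsto_const lim])
      show "\<forall>\<^sub>F i in sequentially. (\<integral>\<^sup>+x. norm (T (f x) - T (s i x)) \<partial>M) \<le> (\<integral>\<^sup>+x. nr (f x - s i x) \<partial>M)"
        using fE s
        by (intro always_eventually allI nn_integral_mono ennreal_leI) (simp add: T(3) diff_mem flip: Tdiff)
    qed auto
    have eq: "Bochner_Integration.simple_bochner_integral M (\<lambda>x. T (s i x)) = T (Bochner_Integration.simple_bochner_integral M (s i))" for i
    proof -
      have "Bochner_Integration.simple_bochner_integral M (\<lambda>x. T (s i x)) =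
          (\<Sum>y\<in>s i ` space M. measure M {x\<in>space M. s i x = y} *\<^sub>R T y)"
        by (rule simple_bochner_integral_partition[OF Ts sf]) auto
      also have "\<dots> = (\<Sum>y\<in>s i ` space M. T (measure M {x\<in>space M. s i x = y} *\<^sub>R y))"
        using s by (intro sum.cong) (auto simp: T(2))
      also have "\<dots> = T (Bochner_Integration.simple_bochner_integral M (s i))"
        unfolding simple_bochner_integral_def
        using s sf by (intro Tsum[symmetric]) (auto simp: simple_function_def intro!: scale_mem)
      finally show ?thesis .
    qed
    have vsE: "Bochner_Integration.simple_bochner_integral M (s i) \<in> E" for i
      by (rule simple_bochner_integral_mem[OF s(2)])
    have "norm (T (Bochner_Integration.simple_bochner_integral M (s i)) - T v) \<le> nr (Bochner_Integration.simple_bochner_integral M (s i) - v)" for i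
      using T(3)[OF diff_mem[OF vsE vE]] by (simp add: Tdiff[OF vsE vE])
    then have "(\<lambda>i. T (Bochner_Integration.simple_bochner_integral M (s i)) - T v) \<longlonglongrightarrow> 0"
      using lim2 by (intro Lim_null_comparison[of "\<lambda>i. T (Bochner_Integration.simple_bochner_integral M (s i)) - T v"]) auto
    then show "(\<lambda>i. Bochner_Integration.simple_bochner_integral M (\<lambda>x. T (s i x))) \<longlonglongrightarrow> T v"
      unfolding eq by (simp add: LIM_zero_iff)
  qed
qed

text \<open>The integrals of simple functions that approximate f in mean form a Cauchy sequence.
  Completeness is a hypothesis here, since \<open>E\<close> and \<open>N\<close> are arbitrary; for
  Hoelder spaces it is \<open>C0_holder_complete\<close>.\<close>

lemma has_bochner_integral_in_exists:
  assumes M: "complete_measure M" "finite_measure M" and f: "strongly_measurable_in E N M f"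
    and g: "integrable M g" "\<And>x. x \<in> space M \<Longrightarrow> nr (f x) \<le> g x"
    and complete: "\<And>v :: nat \<Rightarrow> 'v. (\<And>i. v i \<in> E) \<Longrightarrow> (\<And>e. 0 < e \<Longrightarrow> \<exists>k. \<forall>i\<ge>k. \<forall>j\<ge>k. nr (v i - v j) \<le> e) \<Longrightarrow>
      \<exists>x\<in>E. (\<lambda>i. nr (v i - x)) \<longlonglongrightarrow> 0"
  shows "\<exists>v. has_bochner_integral_in E N M f v"
proof -
  obtain s where s: "\<And>i. Bochner_Integration.simple_bochner_integrable M (s i)" "\<And>i x. x \<in> space M \<Longrightarrow> s i x \<in> E"
    and lim: "(\<lambda>i::nat. \<integral>\<^sup>+x. nr (f x - s i x) \<partial>M) \<longlonglongrightarrow> 0"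
    by (rule simple_approximation[OF M f g]) auto
  have sf: "simple_function M (s i)" for i using s by (auto elim: simple_bochner_integrable.cases)
  have fE: "f x \<in> E" if "x \<in> space M" for x using f that by (simp add: strongly_measurable_in_def)
  let ?v = "\<lambda>i. Bochner_Integration.simple_bochner_integral M (s i)"
  have vE: "?v i \<in> E" for i by (rule simple_bochner_integral_mem[OF s(2)])
  have vdiff: "ennreal (nr (?v i - ?v j)) \<le> (\<integral>\<^sup>+x. nr (f x - s i x) \<partial>M) + (\<integral>\<^sup>+x. nr (f x - s j x) \<partial>M)" for i j
  proof -
    have "?v i - ?v j = Bochner_Integration.simple_bochner_integral M (\<lambda>x. s i x - s j x)"
      by (rule simple_bochner_integral_diff[symmetric]) (rule s)+
    moreover have "Bochner_Integration.simple_bochner_integrable M (\<lambda>x. s i x - s j x)"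
      by (intro simple_bochner_integrable_compose2[of "\<lambda>x y. x - y"] s) simp
    ultimately have "ennreal (nr (?v i - ?v j)) \<le> (\<integral>\<^sup>+x. nr (s i x - s j x) \<partial>M)"
      using nr_simple_bochner_integral_le[of M "\<lambda>x. s i x - s j x"] s by (simp add: diff_mem)
    also have "\<dots> \<le> (\<integral>\<^sup>+x. ennreal (nr (f x - s i x)) + ennreal (nr (f x - s j x)) \<partial>M)"
      using nr_triangle[of "s i _" "f _" "s j _"] nr_minus_commute[of "s i _" "f _"] fE s
      by (intro nn_integral_mono) (simp flip: ennreal_plus)
    also have "\<dots> = (\<integral>\<^sup>+x. nr (f x - s i x) \<partial>M) + (\<integral>\<^sup>+x. nr (f x - s j x) \<partial>M)"
      using nr_diff_measurable[OF M(1) f sf s(2)] by (intro nn_integral_add) auto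
    finally show ?thesis .
  qed
  have "\<exists>x\<in>E. (\<lambda>i. nr (?v i - x)) \<longlonglongrightarrow> 0"
  proof (rule complete[OF vE])
    fix e :: real assume e: "0 < e"
    then have "\<forall>\<^sub>F i in sequentially. (\<integral>\<^sup>+x. nr (f x - s i x) \<partial>M) < ennreal (e / 2)"
      by (intro order_tendstoD(2)[OF lim]) auto
    then obtain k where k: "\<And>i. i \<ge> k \<Longrightarrow> (\<integral>\<^sup>+x. nr (f x - s i x) \<partial>M) < ennreal (e / 2)"
      by (auto simp: eventually_sequentially)
    have "nr (?v i - ?v j) \<le> e" if "i \<ge> k" "j \<ge> k" for i j
    proof -
      have "ennreal (nr (?v i - ?v j)) \<le> ennreal (e / 2) + ennreal (e / 2)"
        using vdiff[of i j] add_mono[OF less_imp_le[OF k[OF that(1)]] less_imp_le[OF k[OF that(2)]]]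
        by (rule order_trans)
      also have "\<dots> = ennreal e" using e by (simp flip: ennreal_plus)
      finally show ?thesis using e by simp
    qed
    then show "\<exists>k. \<forall>i\<ge>k. \<forall>j\<ge>k. nr (?v i - ?v j) \<le> e" by blast
  qed
  then obtain v where v: "v \<in> E" "(\<lambda>i. nr (?v i - v)) \<longlonglongrightarrow> 0" by blast
  have "(\<lambda>i. N (?v i - v)) \<longlonglongrightarrow> 0"
  proof -
    have "(\<lambda>i. ennreal (nr (?v i - v))) \<longlonglongrightarrow> ennreal 0" using v(2) by (intro tendsto_ennrealI)
    then show ?thesis using v(1) vE by (simp add: N_eq diff_mem)
  qed
  moreover have "(\<integral>\<^sup>+x. N (f x - s i x) \<partial>M) = (\<integral>\<^sup>+x. nr (f x - s i x) \<partial>M)" for i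
    using s fE by (intro nn_integral_cong) (simp add: N_eq diff_mem)
  ultimately have "has_bochner_integral_in E N M f v"
    unfolding has_bochner_integral_in_def using f v(1) s lim
    by (intro conjI exI[of _ s]) auto
  then show ?thesis by blast
qed

end

lemma strongly_measurable_in_restrict_space:
  assumes "A \<in> sets M" "strongly_measurable_in E N M f"
  shows "strongly_measurable_in E N (restrict_space M A) f"
proof -
  have sub: "space (restrict_space M A) \<subseteq> space M" by (auto simp: space_restrict_space)
  obtain s where s: "\<And>i. simple_function M (s i)" "\<And>i. s i ` space M \<subseteq> E"
    and f: "\<And>x. x \<in> space M \<Longrightarrow> f x \<in> E" and lim: "AE x in M. (\<lambda>i. N (f x - s i x)) \<longlonglongrightarrow> 0"
    using assms unfolding strongly_measurable_in_def by blast
  have "simple_function (restrict_space M A) (s i)" for i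
    unfolding simple_function_def
  proof (intro conjI ballI)
    show "finite (s i ` space (restrict_space M A))"
      using s(1)[of i] finite_subset[OF image_mono[OF sub]] by (auto simp: simple_function_def)
    fix x assume "x \<in> s i ` space (restrict_space M A)"
    then have "s i -` {x} \<inter> space M \<in> sets M"
      using s(1)[of i] sub by (auto simp: simple_function_def)
    then have "A \<inter> (s i -` {x} \<inter> space M) \<in> sets M"
      using assms(1) by blast
    moreover have "A \<inter> (s i -` {x} \<inter> space M) = s i -` {x} \<inter> A"
      using sets.sets_into_space[OF assms(1)] by auto
    ultimately show "s i -` {x} \<inter> space (restrict_space M A) \<in> sets (restrict_space M A)"
      using assms(1) by (simp add: sets_restrict_space_iff)
  qed
  moreover have "AE x in restrict_space M A. (\<lambda>i. N (f x - s i x)) \<longlonglongrightarrow> 0"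
    using lim assms(1) by (subst AE_restrict_space_iff) auto
  ultimately show ?thesis
    unfolding strongly_measurable_in_def using s(2) f sub by blast
qed


section \<open>Integrating along curves of maps\<close>

lemma normed_carrier_C0_holder:
  assumes "0 < \<gamma>" "\<gamma> \<le> 1"
  shows "normed_carrier (C0_holder n \<gamma> :: ('a::euclidean_space \<Rightarrow> 'b::euclidean_space) set) (holder_norm n \<gamma>)"
proof
  show "holder_norm n \<gamma> f < \<infinity>" if "f \<in> C0_holder n \<gamma>" for f :: "'a \<Rightarrow> 'b"
    using that by (simp add: C0_holder_def)
qed (use assms in \<open>auto intro: C0_holder_zero C0_holder_add C0_holder_scaleR holder_norm_add holder_norm_scaleR\<close>)

lemma holder_norm_diff_leI:
  "0 < \<gamma> \<Longrightarrow> holder_bd n \<gamma> K (\<lambda>x. f x - g x) \<Longrightarrow> enn2real (holder_norm n \<gamma> (f - g)) \<le> K"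
  using holder_norm_leI[of \<gamma> n K "f - g"] holder_bd_nonneg
  by (auto simp: fun_diff_def intro!: enn2real_leI)

lemma tendsto_zero_uniform_limit:
  fixes F :: "nat \<Rightarrow> 'a::real_normed_vector \<Rightarrow> 'b::real_normed_vector"
  assumes "uniform_limit UNIV F f sequentially" "\<And>i. (F i \<longlongrightarrow> 0) at_infinity"
  shows "(f \<longlongrightarrow> 0) at_infinity"
proof (rule tendstoI)
  fix e :: real assume e: "0 < e"
  then obtain i where i: "\<And>x. dist (F i x) (f x) < e / 2"
    using uniform_limitD[OF assms(1), of "e / 2"] by (auto simp: eventually_sequentially)
  have "\<forall>\<^sub>F x in at_infinity. dist (F i x) 0 < e / 2" by (rule tendstoD[OF assms(2)]) (use e in simp)
  then show "\<forall>\<^sub>F x in at_infinity. dist (f x) 0 < e"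
  proof eventually_elim
    case (elim x)
    then show ?case using i[of x] dist_triangle[of "f x" 0 "F i x"] by (simp add: dist_commute)
  qed
qed

text \<open>A Cauchy sequence has a uniform limit. Fixing i and letting j grow in the bound of v i -
  v j, closedness of Hoelder balls under uniform limits transfers the bound to v i - f, which gives
  both membership and convergence in norm.\<close>

lemma C0_holder_complete:
  fixes v :: "nat \<Rightarrow> 'a::euclidean_space \<Rightarrow> 'b::euclidean_space"
  assumes \<gamma>: "0 < \<gamma>" "\<gamma> \<le> 1" and v: "\<And>i. v i \<in> C0_holder n \<gamma>"
    and cauchy: "\<And>e. 0 < e \<Longrightarrow> \<exists>k. \<forall>i\<ge>k. \<forall>j\<ge>k. enn2real (holder_norm n \<gamma> (v i - v j)) \<le> e"
  shows "\<exists>f\<in>C0_holder n \<gamma>. (\<lambda>i. enn2real (holder_norm n \<gamma> (v i - f))) \<longlonglongrightarrow> 0"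
proof -
  interpret H: normed_carrier "C0_holder n \<gamma>" "holder_norm n \<gamma> :: ('a \<Rightarrow> 'b) \<Rightarrow> ennreal"
    by (rule normed_carrier_C0_holder[OF \<gamma>])
  have cauchy_bd: "\<exists>k. \<forall>i\<ge>k. \<forall>j\<ge>k. holder_bd n \<gamma> e (\<lambda>x. v i x - v j x)" if e: "0 < e" for e
  proof -
    obtain k where k: "\<And>i j. i \<ge> k \<Longrightarrow> j \<ge> k \<Longrightarrow> enn2real (holder_norm n \<gamma> (v i - v j)) \<le> e"
      using cauchy[OF e] by blast
    have "holder_bd n \<gamma> e (\<lambda>x. v i x - v j x)" if "i \<ge> k" "j \<ge> k" for i j
      using holder_bd_mono[OF holder_bd_enn2real[OF \<gamma>(1) H.diff_mem[OF v v]] k[OF that]]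
      by (simp add: fun_diff_def)
    then show ?thesis by blast
  qed
  have "uniformly_convergent_on UNIV v"
  proof (intro Cauchy_uniformly_convergent uniformly_Cauchy_onI)
    fix e :: real assume e: "0 < e"
    then obtain k where k: "\<And>i j. i \<ge> k \<Longrightarrow> j \<ge> k \<Longrightarrow> holder_bd n \<gamma> (e / 2) (\<lambda>x. v i x - v j x)"
      using cauchy_bd[of "e / 2"] by auto
    have "dist (v i x) (v j x) < e" if "i \<ge> k" "j \<ge> k" for i j x
      using holder_bd_norm[OF k[OF that], of x] e by (simp add: dist_norm)
    then show "\<exists>M. \<forall>x\<in>UNIV. \<forall>m\<ge>M. \<forall>n\<ge>M. dist (v m x) (v n x) < e" by blast
  qed
  then obtain f where f: "uniform_limit UNIV v f sequentially"
    by (auto simp: uniformly_convergent_on_def)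
  have lim_bd: "\<exists>k. \<forall>i\<ge>k. holder_bd n \<gamma> e (\<lambda>x. v i x - f x)" if e: "0 < e" for e
  proof -
    obtain k where k: "\<And>i j. i \<ge> k \<Longrightarrow> j \<ge> k \<Longrightarrow> holder_bd n \<gamma> e (\<lambda>x. v i x - v j x)"
      using cauchy_bd[OF e] by auto
    have "holder_bd n \<gamma> e (\<lambda>x. v i x - f x)" if "i \<ge> k" for i
    proof (rule holder_bd_uniform_limit[OF \<gamma>])
      \<comment> \<open>\<open>holder_bd_uniform_limit\<close> wants the bound for every index,
        hence the shift by k.\<close>
      have "filterlim (\<lambda>j. j + k) sequentially sequentially" by (rule filterlim_add_const_nat_at_top)
      then have "uniform_limit UNIV (\<lambda>j. v (j + k)) f sequentially"
        using f by (rule filterlim_compose[rotated])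
      then show "uniform_limit UNIV (\<lambda>j x. v i x - v (j + k) x) (\<lambda>x. v i x - f x) sequentially"
        by (intro uniform_limit_intros)
      show "holder_bd n \<gamma> e (\<lambda>x. v i x - v (j + k) x)" for j using k that by simp
    qed
    then show ?thesis by blast
  qed
  obtain k where "holder_bd n \<gamma> 1 (\<lambda>x. v k x - f x)" using lim_bd[of 1] by auto
  from holder_bd_diff[OF holder_bd_enn2real[OF \<gamma>(1) v[of k]] this]
  have "\<exists>K. holder_bd n \<gamma> K f" by auto
  moreover have "(f \<longlongrightarrow> 0) at_infinity"
    using tendsto_zero_uniform_limit[OF f C0_holder_tendsto[OF \<gamma> v]] .
  ultimately have fE: "f \<in> C0_holder n \<gamma>" using \<gamma> by (simp add: C0_holder_iff)
  have "(\<lambda>i. enn2real (holder_norm n \<gamma> (v i - f))) \<longlonglongrightarrow> 0"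
  proof (rule LIMSEQ_I)
    fix e :: real assume e: "0 < e"
    then obtain k where k: "\<And>i. i \<ge> k \<Longrightarrow> holder_bd n \<gamma> (e / 2) (\<lambda>x. v i x - f x)"
      using lim_bd[of "e / 2"] by auto
    have "norm (enn2real (holder_norm n \<gamma> (v i - f)) - 0) < e" if "i \<ge> k" for i
      using holder_norm_diff_leI[OF \<gamma>(1) k[OF that]] e by simp
    then show "\<exists>k. \<forall>i\<ge>k. norm (enn2real (holder_norm n \<gamma> (v i - f)) - 0) < e" by blast
  qed
  with fE show ?thesis by blast
qed

lemma C0_holder_comp:
  fixes w :: "'a::euclidean_space \<Rightarrow> 'b::euclidean_space"
  assumes "0 < \<gamma>" "\<gamma> \<le> 1" "n \<ge> 1" "w \<in> C0_holder n \<gamma>" "holder_bd n \<gamma> M (\<lambda>x. \<phi> x - x)"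
  shows "w \<circ> \<phi> \<in> C0_holder n \<gamma>"
proof -
  obtain C where C: "\<forall>(w :: 'a \<Rightarrow> 'b) \<phi> K. holder_bd n \<gamma> K w \<longrightarrow> holder_bd n \<gamma> M (\<lambda>x. \<phi> x - x) \<longrightarrow>
      holder_bd n \<gamma> (C * K) (\<lambda>x. w (\<phi> x))"
    using holder_bd_comp[OF assms(1,2) holder_bd_nonneg[OF assms(5)] assms(3)] by blast
  have "holder_bd n \<gamma> (C * enn2real (holder_norm n \<gamma> w)) (\<lambda>x. w (\<phi> x))"
    using C[rule_format, OF holder_bd_enn2real[OF assms(1,4)] assms(5)] .
  then show ?thesis
    using tendsto_comp_at_infinity[OF C0_holder_tendsto[OF assms(1,2,4)] holder_bd_norm[OF assms(5)]] assms(1,2)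
    by (auto simp: C0_holder_iff o_def)
qed

lemma C0_holder_exponent:
  assumes "0 < \<alpha>" "\<alpha> \<le> \<beta>" "\<beta> \<le> 1" "f \<in> C0_holder n \<beta>"
  shows "f \<in> C0_holder n \<alpha>"
  using assms holder_bd_exponent[OF assms(1,2)] by (auto simp: C0_holder_iff)

text \<open>Bochner's criterion: strong measurability and an integrable norm. In this form
  integrability passes directly to restrictions of the field to measurable sets of times.\<close>

definition bochner_field :: "nat \<Rightarrow> real \<Rightarrow> (real \<Rightarrow> 'a::euclidean_space \<Rightarrow> 'a) \<Rightarrow> bool" where
  "bochner_field n \<beta> u \<longleftrightarrow>
    strongly_measurable_in (C0_holder n \<beta>) (holder_norm n \<beta>) (lebesgue_on {0..1}) u \<and>
    integrable (lebesgue_on {0..1}) (\<lambda>s. enn2real (holder_norm n \<beta> (u s)))"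

text \<open>Continuity in time for the sup norm over x, spelled out because the topology on function
  types is that of pointwise convergence.\<close>

definition sup_continuous :: "(real \<Rightarrow> 'a \<Rightarrow> 'a::real_normed_vector) \<Rightarrow> bool" where
  "sup_continuous \<Phi> \<longleftrightarrow> (\<forall>s\<in>{0..1}. \<forall>\<epsilon>>0. \<exists>\<delta>>0. \<forall>r\<in>{0..1}. \<bar>r - s\<bar> < \<delta> \<longrightarrow> (\<forall>x. norm (\<Phi> r x - \<Phi> s x) \<le> \<epsilon>))"

lemma bochner_field_mem: "bochner_field n \<beta> u \<Longrightarrow> s \<in> {0..1} \<Longrightarrow> u s \<in> C0_holder n \<beta>"
  by (auto simp: bochner_field_def strongly_measurable_in_def)

text \<open>Times are rounded down to multiples of 1 / (i + 1). Along the rounded times a curve of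
  maps takes finitely many values, so composing it with a simple field gives a simple
  function.\<close>

lemma simple_function_grid:
  "simple_function (lebesgue_on {0..1}) (\<lambda>s::real. of_int \<lfloor>s * real (Suc i)\<rfloor> / real (Suc i))"
proof (rule simple_function_borel_measurable)
  have "(\<lambda>s::real. of_int \<lfloor>s * real (Suc i)\<rfloor> / real (Suc i)) \<in> borel_measurable borel"
    by measurable
  then show "(\<lambda>s::real. of_int \<lfloor>s * real (Suc i)\<rfloor> / real (Suc i)) \<in> borel_measurable (lebesgue_on {0..1})"
    by (intro measurable_restrict_space1 measurable_completion) simp
  have "(\<lambda>s::real. of_int \<lfloor>s * real (Suc i)\<rfloor> / real (Suc i)) ` space (lebesgue_on {0..1})
    \<subseteq> (\<lambda>k. of_int k / real (Suc i)) ` {0..int (Suc i)}"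
  proof
    fix y assume "y \<in> (\<lambda>s::real. of_int \<lfloor>s * real (Suc i)\<rfloor> / real (Suc i)) ` space (lebesgue_on {0..1})"
    then obtain s where s: "0 \<le> s" "s \<le> 1" "y = of_int \<lfloor>s * real (Suc i)\<rfloor> / real (Suc i)" by auto
    have "0 \<le> s * real (Suc i)" using s by simp
    moreover have "s * real (Suc i) \<le> real_of_int (int (Suc i))"
      using s mult_right_mono[of s 1 "real (Suc i)"] by (simp del: of_nat_Suc)
    ultimately have "\<lfloor>s * real (Suc i)\<rfloor> \<in> {0..int (Suc i)}"
      using floor_mono[of "s * real (Suc i)" "real_of_int (int (Suc i))"]
      by (auto simp: le_floor_iff simp del: of_nat_Suc)
    with s show "y \<in> (\<lambda>k. of_int k / real (Suc i)) ` {0..int (Suc i)}" by blast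
  qed
  then show "finite ((\<lambda>s::real. of_int \<lfloor>s * real (Suc i)\<rfloor> / real (Suc i)) ` space (lebesgue_on {0..1}))"
    by (rule finite_subset) simp
qed

lemma grid_bounds:
  fixes s :: real
  assumes "s \<in> {0..1}"
  shows "of_int \<lfloor>s * real (Suc i)\<rfloor> / real (Suc i) \<in> {0..1}"
    "\<bar>of_int \<lfloor>s * real (Suc i)\<rfloor> / real (Suc i) - s\<bar> \<le> 1 / real (Suc i)"
proof -
  define k where "k = real (Suc i)"
  define m where "m = real_of_int \<lfloor>s * k\<rfloor>"
  have k: "0 < k" by (simp add: k_def)
  have sk: "0 \<le> s * k" "s * k \<le> k" using assms k by (auto simp: mult_le_cancel_right1)
  have m: "0 \<le> m" "m \<le> s * k" "s * k \<le> m + 1"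
    using sk unfolding m_def by (simp, linarith, linarith)
  show "of_int \<lfloor>s * real (Suc i)\<rfloor> / real (Suc i) \<in> {0..1}"
    using m(1) order_trans[OF m(2) sk(2)] k unfolding k_def[symmetric] m_def[symmetric] by simp
  have "m / k - s = (m - s * k) / k" using k by (simp add: field_simps)
  moreover have "\<bar>m - s * k\<bar> \<le> 1" using m by linarith
  ultimately show "\<bar>of_int \<lfloor>s * real (Suc i)\<rfloor> / real (Suc i) - s\<bar> \<le> 1 / real (Suc i)"
    using k unfolding k_def[symmetric] m_def[symmetric] by (simp add: abs_divide divide_right_mono)
qed

text \<open>The approximants compose the simple approximants of u with \<Phi> at rounded times.
  Replacing \<Phi> r by \<Phi> at the rounded time is small in the sup norm by the Lipschitz bound
  of \<open>u r\<close>, and small in C^{n,\<alpha>} only by interpolation; replacing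
  \<open>u r\<close> by its approximant is harmless already in C^{n,\<beta>}, since composition is
  linear in the outer map.\<close>

lemma strongly_measurable_in_comp:
  fixes u :: "real \<Rightarrow> 'a::euclidean_space \<Rightarrow> 'a"
  assumes \<alpha>\<beta>: "0 < \<alpha>" "\<alpha> < \<beta>" "\<beta> \<le> 1" and n: "n \<ge> 1"
    and u: "bochner_field n \<beta> u"
    and \<Phi>: "\<And>s. s \<in> {0..1} \<Longrightarrow> holder_bd n \<beta> M (\<lambda>x. \<Phi> s x - x)" "sup_continuous \<Phi>"
  shows "strongly_measurable_in (C0_holder n \<alpha>) (holder_norm n \<alpha>) (lebesgue_on {0..1}) (\<lambda>s. u s \<circ> \<Phi> s)"
proof -
  have \<beta>0: "0 < \<beta>" using \<alpha>\<beta> by linarith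
  have M: "0 \<le> M" using holder_bd_nonneg[OF \<Phi>(1)[of 0]] by simp
  interpret B: normed_carrier "C0_holder n \<beta>" "holder_norm n \<beta> :: ('a \<Rightarrow> 'a) \<Rightarrow> ennreal"
    by (rule normed_carrier_C0_holder[OF \<beta>0 \<alpha>\<beta>(3)])
  obtain C where C1: "C \<ge> 1" and C: "\<forall>(w :: 'a \<Rightarrow> 'a) \<phi> K. holder_bd n \<beta> K w \<longrightarrow> holder_bd n \<beta> M (\<lambda>x. \<phi> x - x) \<longrightarrow>
      holder_bd n \<beta> (C * K) (\<lambda>x. w (\<phi> x))"
    using holder_bd_comp[OF \<beta>0 \<alpha>\<beta>(3) M n] by blast
  have um: "strongly_measurable_in (C0_holder n \<beta>) (holder_norm n \<beta>) (lebesgue_on {0..1}) u"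
    using u by (simp add: bochner_field_def)
  obtain s where s: "\<And>i. simple_function (lebesgue_on {0..1}) (s i)"
    "\<And>i x. x \<in> space (lebesgue_on {0..1}) \<Longrightarrow> s i x \<in> C0_holder n \<beta>"
    and uE: "\<And>x. x \<in> space (lebesgue_on {0..1}) \<Longrightarrow> u x \<in> C0_holder n \<beta>"
    and lim: "AE x in lebesgue_on {0..1}. (\<lambda>i. B.nr (u x - s i x)) \<longlonglongrightarrow> 0"
    by (rule B.strongly_measurable_in_obtain[OF um]) (rule that; assumption)
  define p where "p = (\<lambda>i (s::real). of_int \<lfloor>s * real (Suc i)\<rfloor> / real (Suc i) :: real)"
  have p01: "p i r \<in> {0..1}" if "r \<in> {0..1}" for i r
    using grid_bounds(1)[OF that] by (simp add: p_def del: of_nat_Suc)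
  have plim: "\<bar>p i r - r\<bar> \<le> 1 / real (Suc i)" if "r \<in> {0..1}" for i r
    using grid_bounds(2)[OF that] by (simp add: p_def del: of_nat_Suc)
  define q where "q = (\<lambda>i r. s i r \<circ> \<Phi> (p i r))"
  have q: "simple_function (lebesgue_on {0..1}) (q i)" for i
    unfolding q_def p_def
    by (rule simple_function_compose2[OF s(1) simple_function_grid, of "\<lambda>w r. w \<circ> \<Phi> r"])
  have qE: "q i r \<in> C0_holder n \<alpha>" if "r \<in> {0..1}" for i r
    using C0_holder_comp[OF \<beta>0 \<alpha>\<beta>(3) n s(2) \<Phi>(1)[OF p01[OF that]]] that \<alpha>\<beta>
    by (intro C0_holder_exponent[of \<alpha> \<beta>]) (auto simp: q_def)
  have fE: "u r \<circ> \<Phi> r \<in> C0_holder n \<alpha>" if "r \<in> {0..1}" for r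
    using C0_holder_comp[OF \<beta>0 \<alpha>\<beta>(3) n uE \<Phi>(1)[OF that]] that \<alpha>\<beta>
    by (intro C0_holder_exponent[of \<alpha> \<beta>]) auto
  have "AE r in lebesgue_on {0..1}. (\<lambda>i. holder_norm n \<alpha> ((u r \<circ> \<Phi> r) - q i r)) \<longlonglongrightarrow> 0"
    using lim AE_space
  proof eventually_elim
    case (elim r)
    then have r: "r \<in> {0..1}" by simp
    let ?L = "enn2real (holder_norm n \<beta> (u r))"
    have ub: "holder_bd n \<beta> ?L (u r)" using holder_bd_enn2real[OF \<beta>0 uE[OF elim(2)]] .
    show ?case
    proof (rule order_tendstoI)
      fix a :: ennreal assume "0 < a"
      then obtain b where b: "0 < b" "b < a" using dense by blast
      then obtain \<epsilon> where \<epsilon>: "b = ennreal \<epsilon>" "0 < \<epsilon>"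
        by (cases b) (auto simp: top_unique)
      have KL: "0 \<le> C * ?L + C * ?L" using C1 by simp
      have e2: "0 < \<epsilon> / 2" using \<epsilon> by simp
      obtain \<delta> where \<delta>: "\<delta> > 0" and int: "\<forall>f :: 'a \<Rightarrow> 'a. holder_bd n \<beta> (C * ?L + C * ?L) f \<longrightarrow>
          (\<forall>x. norm (f x) \<le> \<delta>) \<longrightarrow> holder_bd n \<alpha> (\<epsilon> / 2) f"
        using holder_bd_interpolation[OF \<alpha>\<beta> KL e2, of n] by (elim exE conjE) (rule that; assumption)
      obtain m where m: "n = Suc m" using n by (cases n) auto
      \<comment> \<open>\<open>?L\<close> is a Lipschitz constant of \<open>u r\<close>, so this
        closeness of the flows keeps the composites within \<delta>; the added 1 covers
        \<open>?L\<close> = 0.\<close>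
      have "\<delta> / (?L + 1) > 0" using \<delta> by (intro divide_pos_pos) (auto intro: add_nonneg_pos)
      then obtain \<eta> where \<eta>: "\<eta> > 0" "\<And>t x. t \<in> {0..1} \<Longrightarrow> \<bar>t - r\<bar> < \<eta> \<Longrightarrow> norm (\<Phi> t x - \<Phi> r x) \<le> \<delta> / (?L + 1)"
        using \<Phi>(2) r unfolding sup_continuous_def by meson
      have "(\<lambda>i. 1 / real (Suc i)) \<longlonglongrightarrow> 0" using LIMSEQ_inverse_real_of_nat by (simp add: inverse_eq_divide)
      then have ev1: "\<forall>\<^sub>F i in sequentially. 1 / real (Suc i) < \<eta>" using \<eta>(1) by (rule order_tendstoD(2))
      \<comment> \<open>Composition multiplies by C and lowering the exponent by 2, so \<epsilon> /
        (4 * C) leaves \<epsilon> / 2.\<close>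
      have ev2: "\<forall>\<^sub>F i in sequentially. B.nr (u r - s i r) < \<epsilon> / (4 * C)"
        using elim(1) \<epsilon> C1 by (intro order_tendstoD(2)) auto
      show "\<forall>\<^sub>F i in sequentially. holder_norm n \<alpha> ((u r \<circ> \<Phi> r) - q i r) < a"
        using ev1 ev2
      proof eventually_elim
        case (elim i)
        have pr: "p i r \<in> {0..1}" "\<bar>p i r - r\<bar> < \<eta>" using p01[OF r] plim[OF r, of i] elim(1) by auto
        have 1: "holder_bd n \<alpha> (\<epsilon> / 2) (\<lambda>x. u r (\<Phi> r x) - u r (\<Phi> (p i r) x))"
        proof (rule int[rule_format])
          show "holder_bd n \<beta> (C * ?L + C * ?L) (\<lambda>x. u r (\<Phi> r x) - u r (\<Phi> (p i r) x))"
            by (intro holder_bd_diff C[rule_format] ub \<Phi> r pr)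
          fix x
          have "norm (u r (\<Phi> r x) - u r (\<Phi> (p i r) x)) \<le> ?L * norm (\<Phi> r x - \<Phi> (p i r) x)"
            using holder_bd_lipschitz[OF ub[unfolded m]] unfolding m .
          also have "\<dots> \<le> ?L * (\<delta> / (?L + 1))"
            using \<eta>(2)[OF pr] by (intro mult_left_mono) (auto simp: norm_minus_commute)
          also have "\<dots> \<le> \<delta>"
          proof -
            have "0 < ?L + 1" by (simp add: add_nonneg_pos)
            then show ?thesis using \<delta> by (simp add: pos_divide_le_eq algebra_simps)
          qed
          finally show "norm (u r (\<Phi> r x) - u r (\<Phi> (p i r) x)) \<le> \<delta>" .
        qed
        have "holder_bd n \<beta> (B.nr (u r - s i r)) (\<lambda>x. u r x - s i r x)"
          using holder_bd_enn2real[OF \<beta>0 B.diff_mem[OF uE s(2)], of r r i] r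
          by (simp add: B.nr_def fun_diff_def)
        then have "holder_bd n \<beta> (C * B.nr (u r - s i r)) (\<lambda>x. u r (\<Phi> (p i r) x) - s i r (\<Phi> (p i r) x))"
          using C[rule_format, of _ "\<lambda>x. u r x - s i r x"] \<Phi>(1)[OF pr(1)] by blast
        from holder_bd_exponent[OF \<alpha>\<beta>(1) less_imp_le[OF \<alpha>\<beta>(2)] this]
        have "holder_bd n \<alpha> (\<epsilon> / 2) (\<lambda>x. u r (\<Phi> (p i r) x) - s i r (\<Phi> (p i r) x))"
          by (rule holder_bd_mono) (use elim(2) C1 in \<open>simp add: field_simps\<close>)
        from holder_bd_add[OF 1 this]
        have "holder_bd n \<alpha> \<epsilon> (\<lambda>x. u r (\<Phi> r x) - s i r (\<Phi> (p i r) x))"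
          by simp
        then have "holder_norm n \<alpha> ((u r \<circ> \<Phi> r) - q i r) \<le> b"
          using holder_norm_leI[OF \<alpha>\<beta>(1)] \<epsilon> by (simp add: q_def fun_diff_def o_def)
        then show ?case using b by simp
      qed
    qed auto
  qed
  then show ?thesis
    unfolding strongly_measurable_in_def using q qE fE by (intro conjI exI[of _ q]) auto
qed

text \<open>The integral exists only in C^{n,\<alpha>}, but its derivatives are the integrals of the
  derivatives of the integrand, and integrating their pointwise bounds restores exponent \<beta> for
  the value. This is why a Picard step maps C^{n,\<beta>} bounds to C^{n,\<beta>} bounds.\<close>

lemma has_bochner_integral_in_comp:
  fixes u :: "real \<Rightarrow> 'a::euclidean_space \<Rightarrow> 'a"
  assumes \<alpha>\<beta>: "0 < \<alpha>" "\<alpha> < \<beta>" "\<beta> \<le> 1" and n: "n \<ge> 1"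
    and u: "bochner_field n \<beta> u"
    and \<Phi>: "\<And>s. s \<in> {0..1} \<Longrightarrow> holder_bd n \<beta> M (\<lambda>x. \<Phi> s x - x)" "sup_continuous \<Phi>"
    and C: "\<forall>(w :: 'a \<Rightarrow> 'a) \<phi> K. holder_bd n \<beta> K w \<longrightarrow> holder_bd n \<beta> M (\<lambda>x. \<phi> x - x) \<longrightarrow>
      holder_bd n \<beta> (C * K) (\<lambda>x. w (\<phi> x))"
    and t: "t \<in> {0..1}"
  shows "\<exists>v. has_bochner_integral_in (C0_holder n \<alpha>) (holder_norm n \<alpha>) (lebesgue_on {0..t}) (\<lambda>s. u s \<circ> \<Phi> s) v \<and>
    holder_bd n \<beta> (C * (\<integral>s. enn2real (holder_norm n \<beta> (u s)) \<partial>lebesgue_on {0..t})) v \<and>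
    (\<forall>x. has_bochner_integral (lebesgue_on {0..t}) (\<lambda>s. u s (\<Phi> s x)) (v x))"
proof -
  let ?L = "\<lambda>s. enn2real (holder_norm n \<beta> (u s))"
  let ?M = "lebesgue_on {0..t}"
  have \<beta>0: "0 < \<beta>" and \<alpha>1: "\<alpha> \<le> 1" using \<alpha>\<beta> by linarith+
  interpret A: normed_carrier "C0_holder n \<alpha>" "holder_norm n \<alpha> :: ('a \<Rightarrow> 'a) \<Rightarrow> ennreal"
    by (rule normed_carrier_C0_holder[OF \<alpha>\<beta>(1) \<alpha>1])
  have sub: "{0..t} \<subseteq> {0..1}" using t by auto
  have fm01: "strongly_measurable_in (C0_holder n \<alpha>) (holder_norm n \<alpha>) (lebesgue_on {0..1}) (\<lambda>s. u s \<circ> \<Phi> s)"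
    by (rule strongly_measurable_in_comp[OF \<alpha>\<beta> n u \<Phi>])
  have "restrict_space (lebesgue_on {0..1}) {0..t} = ?M"
    using t by (simp add: restrict_restrict_space min_absorb2)
  then have fm: "strongly_measurable_in (C0_holder n \<alpha>) (holder_norm n \<alpha>) ?M (\<lambda>s. u s \<circ> \<Phi> s)"
    using strongly_measurable_in_restrict_space[OF _ fm01, of "{0..t}"] sub by (simp add: sets_restrict_space_iff)
  have L: "integrable ?M ?L"
    using u sub unfolding bochner_field_def by (blast intro: integrable_subinterval)
  have bd: "holder_bd n \<beta> (C * ?L s) (\<lambda>x. u s (\<Phi> s x))" if "s \<in> {0..t}" for s
    using C[rule_format, OF holder_bd_enn2real[OF \<beta>0 bochner_field_mem[OF u]] \<Phi>(1)] that sub by blast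
  have cm: "complete_measure ?M" by (rule complete_measure_lebesgue_on) simp
  have fin: "finite_measure ?M" by (rule finite_measureI) (simp add: emeasure_restrict_space emeasure_lborel_Icc_eq)
  have "\<exists>v. has_bochner_integral_in (C0_holder n \<alpha>) (holder_norm n \<alpha>) ?M (\<lambda>s. u s \<circ> \<Phi> s) v"
  proof (rule A.has_bochner_integral_in_exists[OF cm fin fm])
    show "integrable ?M (\<lambda>s. 2 * (C * ?L s))" using L by auto
    show "A.nr (u s \<circ> \<Phi> s) \<le> 2 * (C * ?L s)" if "s \<in> space ?M" for s
    proof -
      have h: "holder_bd n \<alpha> (2 * (C * ?L s)) (\<lambda>x. u s (\<Phi> s x))"
        using holder_bd_exponent[OF \<alpha>\<beta>(1) less_imp_le[OF \<alpha>\<beta>(2)] bd] that by simp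
      then show ?thesis
        using holder_norm_leI[OF \<alpha>\<beta>(1) h] holder_bd_nonneg[OF h]
        unfolding A.nr_def o_def by (intro enn2real_leI)
    qed
  qed (unfold A.nr_def, rule C0_holder_complete[OF \<alpha>\<beta>(1) \<alpha>1])
  then obtain v where v: "has_bochner_integral_in (C0_holder n \<alpha>) (holder_norm n \<alpha>) ?M (\<lambda>s. u s \<circ> \<Phi> s) v" by blast
  have vE: "v \<in> C0_holder n \<alpha>" using v by (simp add: has_bochner_integral_in_def)
  \<comment> \<open>Differentiation under the integral sign: evaluating a derivative along vectors
    of norm at most 1 is a linear functional bounded by the norm.\<close>
  have ev: "has_bochner_integral ?M (\<lambda>s. iter_deriv (u s \<circ> \<Phi> s) vs x) (iter_deriv v vs x)"
    if vs: "length vs \<le> n" "\<forall>v\<in>set vs. norm v \<le> 1" for vs x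
  proof (rule A.has_bochner_integral_functional[OF cm v, of "\<lambda>f. iter_deriv f vs x"])
    show "iter_deriv (f + g) vs x = iter_deriv f vs x + iter_deriv g vs x"
      if "f \<in> C0_holder n \<alpha>" "g \<in> C0_holder n \<alpha>" for f g :: "'a \<Rightarrow> 'a"
      using that vs by (subst iter_deriv_add[of n]) (auto simp: C0_holder_def)
    show "iter_deriv (c *\<^sub>R f) vs x = c *\<^sub>R iter_deriv f vs x"
      if "f \<in> C0_holder n \<alpha>" for f :: "'a \<Rightarrow> 'a" and c
      using that vs by (subst iter_deriv_scaleR[of n]) (auto simp: C0_holder_def)
    show "norm (iter_deriv f vs x) \<le> A.nr f" if "f \<in> C0_holder n \<alpha>" for f :: "'a \<Rightarrow> 'a"
      using holder_bd_enn2real[OF \<alpha>\<beta>(1) that] vs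
      unfolding A.nr_def holder_bd_iff_iter_deriv[OF \<alpha>\<beta>(1)] by blast
  qed
  have "holder_bd n \<beta> (C * (\<integral>s. ?L s \<partial>?M)) v"
    unfolding holder_bd_iff_iter_deriv[OF \<beta>0]
  proof (intro conjI allI impI)
    show "Cn_map n v" using vE by (simp add: C0_holder_def)
    fix vs :: "'a list" and x :: 'a assume vs: "length vs \<le> n" "\<forall>v\<in>set vs. norm v \<le> (1::real)"
    have "norm (\<integral>s. iter_deriv (u s \<circ> \<Phi> s) vs x \<partial>?M) \<le> (\<integral>s. C * ?L s \<partial>?M)"
    proof (rule Bochner_Integration.integral_norm_bound_integral)
      show "integrable ?M (\<lambda>s. iter_deriv (u s \<circ> \<Phi> s) vs x)" using ev[OF vs] by (auto simp: has_bochner_integral_iff)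
      show "integrable ?M (\<lambda>s. C * ?L s)" using L by auto
      show "norm (iter_deriv (u s \<circ> \<Phi> s) vs x) \<le> C * ?L s" if "s \<in> space ?M" for s
        using bd[of s] vs that unfolding holder_bd_iff_iter_deriv[OF \<beta>0] o_def by auto
    qed
    then show "norm (iter_deriv v vs x) \<le> C * (\<integral>s. ?L s \<partial>?M)"
      using has_bochner_integral_integral_eq[OF ev[OF vs]] by simp
  next
    fix vs :: "'a list" and x y :: 'a assume "length vs = n" and unit: "\<forall>v\<in>set vs. norm v \<le> (1::real)"
    then have vs: "length vs \<le> n" by simp
    note d = has_bochner_integral_diff[OF ev[OF vs unit, of x] ev[OF vs unit, of y]]
    have "norm (\<integral>s. iter_deriv (u s \<circ> \<Phi> s) vs x - iter_deriv (u s \<circ> \<Phi> s) vs y \<partial>?M)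
      \<le> (\<integral>s. (C * norm (x - y) powr \<beta>) * ?L s \<partial>?M)"
    proof (rule Bochner_Integration.integral_norm_bound_integral)
      show "integrable ?M (\<lambda>s. iter_deriv (u s \<circ> \<Phi> s) vs x - iter_deriv (u s \<circ> \<Phi> s) vs y)"
        using d by (auto simp: has_bochner_integral_iff)
      show "integrable ?M (\<lambda>s. (C * norm (x - y) powr \<beta>) * ?L s)" using L by auto
      show "norm (iter_deriv (u s \<circ> \<Phi> s) vs x - iter_deriv (u s \<circ> \<Phi> s) vs y) \<le> (C * norm (x - y) powr \<beta>) * ?L s"
        if "s \<in> space ?M" for s
        using bd[of s] \<open>length vs = n\<close> unit that unfolding holder_bd_iff_iter_deriv[OF \<beta>0] o_def
        by (auto simp: mult_ac)
    qed
    then show "norm (iter_deriv v vs x - iter_deriv v vs y) \<le> C * (\<integral>s. ?L s \<partial>?M) * norm (x - y) powr \<beta>"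
      using has_bochner_integral_integral_eq[OF d] by (simp add: mult_ac)
  qed
  moreover have "has_bochner_integral ?M (\<lambda>s. u s (\<Phi> s x)) (v x)" for x
    using ev[of "[]" x] by simp
  ultimately show ?thesis using v by blast
qed


section \<open>Integral flows\<close>

lemma integral_increment_bound:
  fixes f :: "real \<Rightarrow> 'b::euclidean_space" and g :: "real \<Rightarrow> real"
  assumes rt: "0 \<le> r" "r \<le> t" "t \<le> 1"
    and a: "has_bochner_integral (lebesgue_on {0..r}) f a" and b: "has_bochner_integral (lebesgue_on {0..t}) f b"
    and g: "integrable (lebesgue_on {0..1}) g" "\<And>s. s \<in> {r..t} \<Longrightarrow> norm (f s) \<le> g s"
  shows "norm (b - a) \<le> (\<integral>s. g s \<partial>lebesgue_on {0..t}) - (\<integral>s. g s \<partial>lebesgue_on {0..r})"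
proof -
  have f: "integrable (lebesgue_on {0..t}) f" using b by (simp add: has_bochner_integral_iff)
  have g': "integrable (lebesgue_on {0..t}) g" by (rule integrable_subinterval[OF g(1)]) (use rt in auto)
  have "b = a + (\<integral>s. f s \<partial>lebesgue_on {r..t})"
    using integral_combine[OF f rt(1,2)] a b by (simp add: has_bochner_integral_iff)
  then have "norm (b - a) = norm (\<integral>s. f s \<partial>lebesgue_on {r..t})" by simp
  also have "\<dots> \<le> (\<integral>s. g s \<partial>lebesgue_on {r..t})"
    by (rule Bochner_Integration.integral_norm_bound_integral[OF integrable_subinterval[OF f] integrable_subinterval[OF g']])
       (use g(2) rt in auto)
  also have "\<dots> = (\<integral>s. g s \<partial>lebesgue_on {0..t}) - (\<integral>s. g s \<partial>lebesgue_on {0..r})"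
    using integral_combine[OF g' rt(1,2)] by simp
  finally show ?thesis .
qed

text \<open>Increments in time are bounded by increments of the indefinite integral of L, which is
  continuous and does not involve x.\<close>

lemma sup_continuous_integral:
  fixes f :: "real \<Rightarrow> 'a \<Rightarrow> 'a::euclidean_space" and L :: "real \<Rightarrow> real"
  assumes int: "\<And>t x. t \<in> {0..1} \<Longrightarrow> has_bochner_integral (lebesgue_on {0..t}) (\<lambda>s. f s x) (\<Phi> t x - x)"
    and L: "integrable (lebesgue_on {0..1}) L" "\<And>s x. s \<in> {0..1} \<Longrightarrow> norm (f s x) \<le> L s"
  shows "sup_continuous \<Phi>"
  unfolding sup_continuous_def
proof (intro ballI allI impI)
  fix s \<epsilon> :: real assume s: "s \<in> {0..1}" and \<epsilon>: "0 < \<epsilon>"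
  let ?P = "\<lambda>t. \<integral>s. L s \<partial>lebesgue_on {0..t}"
  have le: "norm (\<Phi> t x - \<Phi> r x) \<le> ?P t - ?P r" if "r \<in> {0..1}" "t \<in> {0..1}" "r \<le> t" for r t x
  proof -
    have "norm ((\<Phi> t x - x) - (\<Phi> r x - x)) \<le> ?P t - ?P r"
      using that by (intro integral_increment_bound[where f="\<lambda>s. f s x"] int L) auto
    then show ?thesis by simp
  qed
  have "continuous_on {0..1} ?P" by (rule indefinite_integral_continuous_real[OF L(1)])
  then obtain \<delta> where \<delta>: "\<delta> > 0" "\<And>r. r \<in> {0..1} \<Longrightarrow> dist r s < \<delta> \<Longrightarrow> dist (?P r) (?P s) < \<epsilon>"
    using s \<epsilon> unfolding continuous_on_iff by meson
  have "norm (\<Phi> r x - \<Phi> s x) \<le> \<epsilon>" if "r \<in> {0..1}" "\<bar>r - s\<bar> < \<delta>" for r x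
    using \<delta>(2)[OF that(1)] that le[of r s x] le[of s r x] s
    by (cases "r \<le> s") (auto simp: dist_real_def norm_minus_commute)
  then show "\<exists>\<delta>>0. \<forall>r\<in>{0..1}. \<bar>r - s\<bar> < \<delta> \<longrightarrow> (\<forall>x. norm (\<Phi> r x - \<Phi> s x) \<le> \<epsilon>)"
    using \<delta>(1) by blast
qed

lemma sup_continuous_imp_continuous_on:
  "sup_continuous \<Phi> \<Longrightarrow> continuous_on {0..1} (\<lambda>s. \<Phi> s x)"
  unfolding continuous_on_iff sup_continuous_def dist_norm
proof (intro ballI allI impI)
  fix s e :: real
  assume *: "\<forall>s\<in>{0..1}. \<forall>\<epsilon>>0. \<exists>\<delta>>0. \<forall>r\<in>{0..1}. \<bar>r - s\<bar> < \<delta> \<longrightarrow> (\<forall>x. norm (\<Phi> r x - \<Phi> s x) \<le> \<epsilon>)"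
    and s: "s \<in> {0..1}" and e: "0 < e"
  from *[rule_format, OF s, of "e / 2"] e
  obtain \<delta> where \<delta>: "\<delta> > 0" "\<And>r x. r \<in> {0..1} \<Longrightarrow> \<bar>r - s\<bar> < \<delta> \<Longrightarrow> norm (\<Phi> r x - \<Phi> s x) \<le> e / 2"
    by auto
  have "norm (\<Phi> r x - \<Phi> s x) < e" if "r \<in> {0..1}" "\<bar>r - s\<bar> < \<delta>" for r
    using \<delta>(2)[OF that, of x] e by linarith
  then show "\<exists>d>0. \<forall>x'\<in>{0..1}. norm (x' - s) < d \<longrightarrow> norm (\<Phi> x' x - \<Phi> s x) < e"
    using \<delta>(1) unfolding real_norm_def by blast
qed

text \<open>The equation for each x separately, with the library integral of a finite-dimensional
  curve. It is the common ground of strong flows with exponent \<alpha> and of flows bounded with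
  exponent \<beta>.\<close>

definition integral_flow :: "(real \<Rightarrow> 'a::euclidean_space \<Rightarrow> 'a) \<Rightarrow> (real \<Rightarrow> 'a \<Rightarrow> 'a) \<Rightarrow> bool" where
  "integral_flow u \<Phi> \<longleftrightarrow>
    (\<forall>t\<in>{0..1}. \<forall>x. has_bochner_integral (lebesgue_on {0..t}) (\<lambda>s. u s (\<Phi> s x)) (\<Phi> t x - x))"

text \<open>One \<open>M\<close> serves all times, and it may be large; this makes the notion stable
  under composing flows, whereas the ball of the Picard iteration is not.\<close>

definition bounded_flow ::
    "nat \<Rightarrow> real \<Rightarrow> (real \<Rightarrow> real ^ 'd \<Rightarrow> real ^ 'd) \<Rightarrow> (real \<Rightarrow> real ^ 'd \<Rightarrow> real ^ 'd) \<Rightarrow> bool" where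
  "bounded_flow n \<beta> u \<Phi> \<longleftrightarrow>
     (\<exists>M. \<forall>t\<in>{0..1}. holder_bd n \<beta> M (\<lambda>x. \<Phi> t x - x)) \<and>
     (\<forall>t\<in>{0..1}. ((\<lambda>x. \<Phi> t x - x) \<longlongrightarrow> 0) at_infinity) \<and>
     (\<forall>t\<in>{0..1}. \<forall>x. 0 < det (matrix (frechet_derivative (\<Phi> t) (at x)))) \<and>
     integral_flow u \<Phi>"

lemma bochner_field_holder_bd:
  "0 < \<beta> \<Longrightarrow> bochner_field n \<beta> u \<Longrightarrow> s \<in> {0..1} \<Longrightarrow> holder_bd n \<beta> (enn2real (holder_norm n \<beta> (u s))) (u s)"
  by (intro holder_bd_enn2real bochner_field_mem)

lemma bochner_field_lipschitz:
  assumes "0 < \<beta>" "n \<ge> 1" "bochner_field n \<beta> u" "s \<in> {0..1}"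
  shows "norm (u s x - u s y) \<le> enn2real (holder_norm n \<beta> (u s)) * norm (x - y)"
proof -
  obtain m where m: "n = Suc m" using assms(2) by (cases n) auto
  show ?thesis
    using holder_bd_lipschitz[OF bochner_field_holder_bd[OF assms(1,3,4), unfolded m]] unfolding m .
qed

text \<open>The integrand is dominated by the norm of \<open>u s\<close> whatever the curve is, so
  any solution of the pointwise equation qualifies, including a competitor in the uniqueness
  proof.\<close>

lemma sup_continuous_integral_flow:
  assumes "0 < \<beta>" "bochner_field n \<beta> u" "integral_flow u \<Phi>"
  shows "sup_continuous \<Phi>"
proof (rule sup_continuous_integral[where f="\<lambda>s x. u s (\<Phi> s x)"])
  show "integrable (lebesgue_on {0..1}) (\<lambda>s. enn2real (holder_norm n \<beta> (u s)))"
    using assms(2) by (simp add: bochner_field_def)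
qed (use assms in \<open>auto simp: integral_flow_def intro: holder_bd_norm[OF bochner_field_holder_bd]\<close>)

text \<open>Gronwall's inequality replaced by a maximum argument, for fixed x: on a time step where
  the norms of u integrate to less than 1/2 and at whose start the difference \<open>D\<close>
  vanishes, the largest value of \<open>norm (D s)\<close> is at most half of itself. Uniform
  continuity of the indefinite integral gives one step length for all of [0,1].\<close>

lemma integral_flow_unique:
  fixes u :: "real \<Rightarrow> 'a::euclidean_space \<Rightarrow> 'a"
  assumes \<beta>: "0 < \<beta>" and n: "n \<ge> 1" and u: "bochner_field n \<beta> u"
    and \<Phi>: "integral_flow u \<Phi>" and \<Psi>: "integral_flow u \<Psi>" and t: "t \<in> {0..1}"
  shows "\<Psi> t = \<Phi> t"
proof
  fix x
  let ?L = "\<lambda>s. enn2real (holder_norm n \<beta> (u s))"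
  let ?P = "\<lambda>t. \<integral>s. ?L s \<partial>lebesgue_on {0..t}"
  define D where "D = (\<lambda>s. \<Phi> s x - \<Psi> s x)"
  have L: "integrable (lebesgue_on {0..1}) ?L" using u by (simp add: bochner_field_def)
  have int: "has_bochner_integral (lebesgue_on {0..t}) (\<lambda>s. u s (\<Phi> s x) - u s (\<Psi> s x)) (D t)" if "t \<in> {0..1}" for t
    using has_bochner_integral_diff[of "lebesgue_on {0..t}" "\<lambda>s. u s (\<Phi> s x)" "\<Phi> t x - x" "\<lambda>s. u s (\<Psi> s x)" "\<Psi> t x - x"]
      \<Phi> \<Psi> that by (simp add: integral_flow_def D_def)
  have D0: "D 0 = 0"
  proof -
    have "has_bochner_integral (lebesgue_on {0..0}) (\<lambda>s. u s (\<Phi> s x) - u s (\<Psi> s x)) 0"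
      by (rule has_bochner_integral_null) simp
    then show ?thesis using has_bochner_integral_eq[OF int[of 0]] by simp
  qed
  have "continuous_on {0..1} ?P" by (rule indefinite_integral_continuous_real[OF L])
  then have "uniformly_continuous_on {0..1} ?P" by (rule compact_uniformly_continuous) simp
  then obtain \<delta> where \<delta>: "\<delta> > 0" "\<And>r s. r \<in> {0..1} \<Longrightarrow> s \<in> {0..1} \<Longrightarrow> dist r s < \<delta> \<Longrightarrow> dist (?P r) (?P s) < 1 / 2"
    unfolding uniformly_continuous_on_def by (meson half_gt_zero zero_less_one)
  have Dcont: "continuous_on {0..1} (\<lambda>s. norm (D s))"
    unfolding D_def
    by (intro continuous_intros sup_continuous_imp_continuous_on sup_continuous_integral_flow[OF \<beta> u] \<Phi> \<Psi>)
  \<comment> \<open>Steps have length \<delta> / 2, so that the ends of a step are strictly closer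
    than \<delta>.\<close>
  have *: "t \<in> {0..1} \<Longrightarrow> t \<le> real k * (\<delta> / 2) \<Longrightarrow> D t = 0" for t k
  proof (induction k arbitrary: t)
    case 0
    then show ?case using D0 by simp
  next
    case (Suc k)
    define a where "a = real k * (\<delta> / 2)"
    show ?case
    proof (cases "t \<le> a")
      case True
      then show ?thesis using Suc by (simp add: a_def)
    next
      case False
      have a: "0 \<le> a" "a \<le> t" using False \<delta>(1) by (auto simp: a_def)
      have ta: "t \<le> a + \<delta> / 2" using Suc.prems(2) by (simp add: a_def algebra_simps)
      have "continuous_on {a..t} (\<lambda>s. norm (D s))"
        using Dcont by (rule continuous_on_subset) (use a Suc.prems in auto)
      then obtain r where r: "r \<in> {a..t}" "\<And>s. s \<in> {a..t} \<Longrightarrow> norm (D s) \<le> norm (D r)"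
        using continuous_attains_sup[of "{a..t}" "\<lambda>s. norm (D s)"] a by (auto; metis)
      have r01: "r \<in> {0..1}" "a \<in> {0..1}" using r a Suc.prems by auto
      have Da: "D a = 0" using Suc.IH[of a] r01 by (simp add: a_def)
      have "norm (D r - D a) \<le> (\<integral>s. norm (D r) * ?L s \<partial>lebesgue_on {0..r}) - (\<integral>s. norm (D r) * ?L s \<partial>lebesgue_on {0..a})"
      proof (rule integral_increment_bound[OF _ _ _ int int])
        show "norm (u s (\<Phi> s x) - u s (\<Psi> s x)) \<le> norm (D r) * ?L s" if "s \<in> {a..r}" for s
        proof -
          have s: "s \<in> {0..1}" "s \<in> {a..t}" using that r a Suc.prems by auto
          have "norm (u s (\<Phi> s x) - u s (\<Psi> s x)) \<le> ?L s * norm (D s)"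
            using bochner_field_lipschitz[OF \<beta> n u s(1)] by (simp add: D_def)
          also have "\<dots> \<le> ?L s * norm (D r)" using r(2)[OF s(2)] by (intro mult_left_mono) auto
          finally show ?thesis by (simp add: mult.commute)
        qed
      qed (use r r01 a L in auto)
      also have "\<dots> = norm (D r) * (?P r - ?P a)" by (simp add: algebra_simps)
      also have "\<dots> \<le> norm (D r) * (1 / 2)"
      proof (rule mult_left_mono)
        have "dist r a < \<delta>" using r ta \<delta>(1) by (auto simp: dist_real_def)
        then show "?P r - ?P a \<le> 1 / 2" using \<delta>(2)[OF r01] unfolding dist_real_def by linarith
      qed simp
      finally have "norm (D r) \<le> 0" by (simp add: Da)
      then show ?thesis using r(2)[of t] a by simp
    qed
  qed
  obtain k where "1 / (\<delta> / 2) \<le> real k" using real_arch_simple by blast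
  then have "1 \<le> real k * (\<delta> / 2)" using \<delta>(1) by (simp add: field_simps)
  then have "D t = 0" using t by (intro *[of t k]) auto
  then show "\<Psi> t x = \<Phi> t x" by (simp add: D_def)
qed

lemma strong_flow_imp_integral_flow:
  fixes u :: "real \<Rightarrow> real ^ 'd \<Rightarrow> real ^ 'd"
  assumes \<alpha>: "0 < \<alpha>" "\<alpha> \<le> 1" and \<Phi>: "strong_flow n \<alpha> u \<Phi>"
  shows "integral_flow u \<Phi>"
  unfolding integral_flow_def
proof (intro ballI allI)
  fix t :: real and x :: "real ^ 'd" assume t: "t \<in> {0..1}"
  interpret A: normed_carrier "C0_holder n \<alpha>" "holder_norm n \<alpha> :: (real ^ 'd \<Rightarrow> real ^ 'd) \<Rightarrow> ennreal"
    by (rule normed_carrier_C0_holder[OF \<alpha>])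
  have "has_bochner_integral (lebesgue_on {0..t}) (\<lambda>s. (u s \<circ> \<Phi> s) x) ((\<Phi> t - id) x)"
  proof (rule A.has_bochner_integral_functional[where T="\<lambda>f. f x"])
    show "complete_measure (lebesgue_on {0..t})" by (rule complete_measure_lebesgue_on) simp
    show "has_bochner_integral_in (C0_holder n \<alpha>) (holder_norm n \<alpha>) (lebesgue_on {0..t}) (\<lambda>s. u s \<circ> \<Phi> s) (\<Phi> t - id)"
      using \<Phi> t by (simp add: strong_flow_def)
    show "norm (f x) \<le> A.nr f" if "f \<in> C0_holder n \<alpha>" for f :: "real ^ 'd \<Rightarrow> real ^ 'd"
      using holder_bd_norm[OF holder_bd_enn2real[OF \<alpha>(1) that]] by (simp add: A.nr_def)
  qed auto
  then show "has_bochner_integral (lebesgue_on {0..t}) (\<lambda>s. u s (\<Phi> s x)) (\<Phi> t x - x)" by simp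
qed

lemma bounded_flow_imp_strong_flow:
  fixes u :: "real \<Rightarrow> real ^ 'd \<Rightarrow> real ^ 'd"
  assumes \<alpha>\<beta>: "0 < \<alpha>" "\<alpha> < \<beta>" "\<beta> \<le> 1" and n: "n \<ge> 1"
    and u: "bochner_field n \<beta> u" and \<Phi>: "bounded_flow n \<beta> u \<Phi>"
  shows "strong_flow n \<alpha> u \<Phi>"
proof -
  have \<beta>0: "0 < \<beta>" and \<alpha>1: "\<alpha> \<le> 1" using \<alpha>\<beta> by linarith+
  obtain M where M: "\<And>t. t \<in> {0..1} \<Longrightarrow> holder_bd n \<beta> M (\<lambda>x. \<Phi> t x - x)"
    using \<Phi> unfolding bounded_flow_def by blast
  have \<Phi>int: "integral_flow u \<Phi>" using \<Phi> by (simp add: bounded_flow_def)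
  have sc: "sup_continuous \<Phi>" by (rule sup_continuous_integral_flow[OF \<beta>0 u \<Phi>int])
  have M0: "0 \<le> M" using holder_bd_nonneg[OF M[of 0]] by simp
  obtain C where C: "\<forall>(w :: real ^ 'd \<Rightarrow> real ^ 'd) \<phi> K. holder_bd n \<beta> K w \<longrightarrow> holder_bd n \<beta> M (\<lambda>x. \<phi> x - x) \<longrightarrow>
      holder_bd n \<beta> (C * K) (\<lambda>x. w (\<phi> x))"
    using holder_bd_comp[OF \<beta>0 \<alpha>\<beta>(3) M0 n] by blast
  show ?thesis
    unfolding strong_flow_def
  proof (intro conjI ballI)
    fix t :: real assume t: "t \<in> {0..1}"
    have eq: "\<Phi> t - id = (\<lambda>x. \<Phi> t x - x)" by (simp add: fun_diff_def)
    have "\<Phi> t - id \<in> C0_holder n \<beta>"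
      using M[OF t] \<Phi> t \<beta>0 \<alpha>\<beta>(3) unfolding eq by (auto simp: C0_holder_iff bounded_flow_def)
    then show "\<Phi> t \<in> Diff_holder n \<alpha>"
      using \<Phi> t C0_holder_exponent[OF \<alpha>\<beta>(1) less_imp_le[OF \<alpha>\<beta>(2)] \<alpha>\<beta>(3)]
      by (auto simp: Diff_holder_def bounded_flow_def)
    show "((\<lambda>s. holder_norm n \<alpha> (\<Phi> s - \<Phi> t)) \<longlongrightarrow> 0) (at t within {0..1})"
    proof (rule order_tendstoI)
      fix a :: ennreal assume "0 < a"
      then obtain b where b: "0 < b" "b < a" using dense by blast
      then obtain \<epsilon> where \<epsilon>: "b = ennreal \<epsilon>" "0 < \<epsilon>"
        by (cases b) (auto simp: top_unique)
      have M2: "0 \<le> M + M" using M0 by simp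
      obtain \<delta> where \<delta>: "\<delta> > 0" and small: "\<forall>f :: real ^ 'd \<Rightarrow> real ^ 'd. holder_bd n \<beta> (M + M) f \<longrightarrow>
          (\<forall>x. norm (f x) \<le> \<delta>) \<longrightarrow> holder_bd n \<alpha> \<epsilon> f"
        using holder_bd_interpolation[OF \<alpha>\<beta> M2 \<epsilon>(2), of n] by (elim exE conjE) (rule that; assumption)
      obtain \<eta> where \<eta>: "\<eta> > 0" "\<And>s x. s \<in> {0..1} \<Longrightarrow> \<bar>s - t\<bar> < \<eta> \<Longrightarrow> norm (\<Phi> s x - \<Phi> t x) \<le> \<delta>"
        using sc \<delta> t unfolding sup_continuous_def by meson
      have "holder_norm n \<alpha> (\<Phi> s - \<Phi> t) < a" if "s \<in> {0..1}" "\<bar>s - t\<bar> < \<eta>" for s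
      proof -
        have "holder_bd n \<alpha> \<epsilon> (\<lambda>x. \<Phi> s x - \<Phi> t x)"
        proof (rule small[rule_format])
          show "holder_bd n \<beta> (M + M) (\<lambda>x. \<Phi> s x - \<Phi> t x)"
            using holder_bd_diff[OF M[OF that(1)] M[OF t]] by simp
        qed (rule \<eta>(2)[OF that])
        then have "holder_norm n \<alpha> (\<Phi> s - \<Phi> t) \<le> b"
          using holder_norm_leI[OF \<alpha>\<beta>(1)] \<epsilon> by (simp add: fun_diff_def)
        then show ?thesis using b by simp
      qed
      then show "\<forall>\<^sub>F s in at t within {0..1}. holder_norm n \<alpha> (\<Phi> s - \<Phi> t) < a"
        using \<eta>(1) unfolding eventually_at by (auto simp: dist_real_def intro!: exI[of _ \<eta>])
    qed auto
    obtain v where v: "has_bochner_integral_in (C0_holder n \<alpha>) (holder_norm n \<alpha>) (lebesgue_on {0..t}) (\<lambda>s. u s \<circ> \<Phi> s) v"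
      "\<And>x. has_bochner_integral (lebesgue_on {0..t}) (\<lambda>s. u s (\<Phi> s x)) (v x)"
      using has_bochner_integral_in_comp[OF \<alpha>\<beta> n u M sc C t] by blast
    \<comment> \<open>The Bochner integral is identified point by point: at each x both sides are
      the library integral of the same curve.\<close>
    have "v = \<Phi> t - id"
    proof
      fix x
      have "has_bochner_integral (lebesgue_on {0..t}) (\<lambda>s. u s (\<Phi> s x)) (\<Phi> t x - x)"
        using \<Phi>int t by (simp add: integral_flow_def)
      from has_bochner_integral_eq[OF v(2) this] show "v x = (\<Phi> t - id) x" by simp
    qed
    with v(1) show "has_bochner_integral_in (C0_holder n \<alpha>) (holder_norm n \<alpha>) (lebesgue_on {0..t}) (\<lambda>s. u s \<circ> \<Phi> s) (\<Phi> t - id)"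
      by simp
  qed
qed


section \<open>Picard iteration for small fields\<close>

lemma integral_bound_unit_interval:
  fixes f :: "real \<Rightarrow> 'b::euclidean_space" and g :: "real \<Rightarrow> real"
  assumes t: "t \<in> {0..1}" and b: "has_bochner_integral (lebesgue_on {0..t}) f b"
    and g: "integrable (lebesgue_on {0..1}) g" "\<And>s. s \<in> {0..1} \<Longrightarrow> norm (f s) \<le> g s"
  shows "norm b \<le> (\<integral>s. g s \<partial>lebesgue_on {0..1})"
proof -
  have sub: "integrable (lebesgue_on {0..t}) g"
    by (rule integrable_subinterval[OF g(1)]) (use t in auto)
  have "norm (\<integral>s. f s \<partial>lebesgue_on {0..t}) \<le> (\<integral>s. g s \<partial>lebesgue_on {0..t})"
    by (rule Bochner_Integration.integral_norm_bound_integral[OF _ sub])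
       (use b t g(2) in \<open>auto simp: has_bochner_integral_iff\<close>)
  moreover have "0 \<le> g s" if "s \<in> {0..1}" for s
    by (rule order_trans[OF norm_ge_zero g(2)[OF that]])
  then have "0 \<le> (\<integral>s. g s \<partial>lebesgue_on {t..1})"
    using t by (intro Bochner_Integration.integral_nonneg) auto
  ultimately show ?thesis
    using integral_combine[OF g(1), of t] t b by (simp add: has_bochner_integral_iff)
qed

text \<open>The library integral is 0 for a nonintegrable integrand; that the integrals are genuine
  is proved along with the bounds on the iterates.\<close>

primrec picard :: "(real \<Rightarrow> 'a::euclidean_space \<Rightarrow> 'a) \<Rightarrow> nat \<Rightarrow> real \<Rightarrow> 'a \<Rightarrow> 'a" where
  "picard u 0 = (\<lambda>t x. x)"
| "picard u (Suc k) = (\<lambda>t x. x + (\<integral>s. u s (picard u k s x) \<partial>lebesgue_on {0..t}))"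

text \<open>The two smallness conditions have separate tasks: the first keeps the iterates in the
  C^{n,\<beta>} ball of radius r, the second makes the iteration a contraction with factor 1/2 in
  the sup norm. The limit stays in the ball because Hoelder balls are closed under uniform
  limits.\<close>

lemma picard_limit_exists:
  fixes u :: "real \<Rightarrow> 'a::euclidean_space \<Rightarrow> 'a"
  assumes \<beta>: "0 < \<beta>" "\<beta> \<le> 1" and n: "n \<ge> 1" and u: "bochner_field n \<beta> u" and r0: "0 \<le> r" and C1: "C \<ge> 1"
    and C: "\<forall>(w :: 'a \<Rightarrow> 'a) \<phi> K. holder_bd n \<beta> K w \<longrightarrow> holder_bd n \<beta> r (\<lambda>x. \<phi> x - x) \<longrightarrow>
      holder_bd n \<beta> (C * K) (\<lambda>x. w (\<phi> x))"
    and small: "C * (\<integral>s. enn2real (holder_norm n \<beta> (u s)) \<partial>lebesgue_on {0..1}) \<le> r"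
      "(\<integral>s. enn2real (holder_norm n \<beta> (u s)) \<partial>lebesgue_on {0..1}) \<le> 1 / 2"
  shows "\<exists>\<Phi>. (\<forall>t\<in>{0..1}. holder_bd n \<beta> r (\<lambda>x. \<Phi> t x - x)) \<and>
    (\<forall>t\<in>{0..1}. ((\<lambda>x. \<Phi> t x - x) \<longlongrightarrow> 0) at_infinity) \<and> integral_flow u \<Phi>"
proof -
  let ?L = "\<lambda>s. enn2real (holder_norm n \<beta> (u s))"
  let ?I = "\<lambda>\<Psi> t x. \<integral>s. u s (\<Psi> s x) \<partial>lebesgue_on {0..t}"
  let ?P = "picard u"
  have L: "integrable (lebesgue_on {0..1}) ?L" using u by (simp add: bochner_field_def)
  have usup: "norm (u s x) \<le> ?L s" if "s \<in> {0..1}" for s x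
    using holder_bd_norm[OF bochner_field_holder_bd[OF \<beta>(1) u that]] .
  have step: "has_bochner_integral (lebesgue_on {0..t}) (\<lambda>s. u s (\<Psi> s x)) (?I \<Psi> t x)"
      "holder_bd n \<beta> r (\<lambda>x. ?I \<Psi> t x)" "((\<lambda>x. ?I \<Psi> t x) \<longlongrightarrow> 0) at_infinity"
    if \<Psi>: "\<And>s. s \<in> {0..1} \<Longrightarrow> holder_bd n \<beta> r (\<lambda>x. \<Psi> s x - x)" "sup_continuous \<Psi>" and t: "t \<in> {0..1}" for \<Psi> t x
  proof -
    \<comment> \<open>An auxiliary exponent below \<beta> in which the integral is formed; only its
      pointwise values, its C^{n,\<beta>} bound and its decay are kept.\<close>
    have half: "0 < \<beta> / 2" "\<beta> / 2 < \<beta>" "\<beta> / 2 \<le> 1" using \<beta> by auto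
    obtain v where v: "has_bochner_integral_in (C0_holder n (\<beta> / 2)) (holder_norm n (\<beta> / 2)) (lebesgue_on {0..t}) (\<lambda>s. u s \<circ> \<Psi> s) v"
      "holder_bd n \<beta> (C * (\<integral>s. ?L s \<partial>lebesgue_on {0..t})) v"
      "\<And>x. has_bochner_integral (lebesgue_on {0..t}) (\<lambda>s. u s (\<Psi> s x)) (v x)"
      using has_bochner_integral_in_comp[OF half(1,2) \<beta>(2) n u \<Psi> C t] by blast
    have vI: "v = (\<lambda>x. ?I \<Psi> t x)" using has_bochner_integral_integral_eq[OF v(3)] by auto
    show "has_bochner_integral (lebesgue_on {0..t}) (\<lambda>s. u s (\<Psi> s x)) (?I \<Psi> t x)"
      using v(3)[of x] vI by simp
    have "(\<integral>s. ?L s \<partial>lebesgue_on {0..t}) \<le> (\<integral>s. ?L s \<partial>lebesgue_on {0..1})"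
      using integral_combine[OF L, of t] t Bochner_Integration.integral_nonneg[of "lebesgue_on {t..1}" ?L] by simp
    then have "C * (\<integral>s. ?L s \<partial>lebesgue_on {0..t}) \<le> C * (\<integral>s. ?L s \<partial>lebesgue_on {0..1})"
      using C1 by (intro mult_left_mono) auto
    then show "holder_bd n \<beta> r (\<lambda>x. ?I \<Psi> t x)"
      using v(2) small(1) unfolding vI by (auto intro: holder_bd_mono)
    have "v \<in> C0_holder n (\<beta> / 2)" using v(1) by (simp add: has_bochner_integral_in_def)
    then show "((\<lambda>x. ?I \<Psi> t x) \<longlongrightarrow> 0) at_infinity"
      using C0_holder_tendsto[OF half(1,3)] unfolding vI by blast
  qed
  have inv: "(\<forall>s\<in>{0..1}. holder_bd n \<beta> r (\<lambda>x. ?P k s x - x)) \<and> sup_continuous (?P k)" for k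
  proof (induction k)
    case 0
    then show ?case
      using holder_bd_mono[OF holder_bd_zero r0] by (auto simp: sup_continuous_def intro: exI[of _ 1])
  next
    case (Suc k)
    then have IH: "\<And>s. s \<in> {0..1} \<Longrightarrow> holder_bd n \<beta> r (\<lambda>x. ?P k s x - x)" "sup_continuous (?P k)" by auto
    have "sup_continuous (?P (Suc k))"
      by (rule sup_continuous_integral[OF _ L, of "\<lambda>s x. u s (?P k s x)"])
         (use step(1)[OF IH] usup in auto)
    then show ?case using step(2)[OF IH] by simp
  qed
  note inv1 = inv[THEN conjunct1, rule_format] and inv2 = inv[THEN conjunct2]
  have contr: "norm (a - b) \<le> c / 2"
    if t: "t \<in> {0..1}" and ab: "has_bochner_integral (lebesgue_on {0..t}) (\<lambda>s. u s (\<Psi> s x)) a"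
      "has_bochner_integral (lebesgue_on {0..t}) (\<lambda>s. u s (\<Psi>' s x)) b"
      and c: "\<And>s. s \<in> {0..1} \<Longrightarrow> norm (\<Psi> s x - \<Psi>' s x) \<le> c" for t a b c x and \<Psi> \<Psi>' :: "real \<Rightarrow> 'a \<Rightarrow> 'a"
  proof -
    have c0: "0 \<le> c" by (rule order_trans[OF norm_ge_zero c[of 0]]) simp
    have "norm (a - b) \<le> (\<integral>s. c * ?L s \<partial>lebesgue_on {0..1})"
    proof (rule integral_bound_unit_interval[OF t has_bochner_integral_diff[OF ab]])
      show "integrable (lebesgue_on {0..1}) (\<lambda>s. c * ?L s)" using L by auto
      show "norm (u s (\<Psi> s x) - u s (\<Psi>' s x)) \<le> c * ?L s" if s: "s \<in> {0..1}" for s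
      proof -
        have "norm (u s (\<Psi> s x) - u s (\<Psi>' s x)) \<le> ?L s * norm (\<Psi> s x - \<Psi>' s x)"
          by (rule bochner_field_lipschitz[OF \<beta>(1) n u s])
        also have "\<dots> \<le> ?L s * c" using c[OF s] by (intro mult_left_mono) auto
        finally show ?thesis by (simp add: mult.commute)
      qed
    qed
    also have "\<dots> = c * (\<integral>s. ?L s \<partial>lebesgue_on {0..1})" by simp
    also have "\<dots> \<le> c * (1 / 2)" using small(2) c0 by (intro mult_left_mono)
    finally show ?thesis by simp
  qed
  have Pint: "has_bochner_integral (lebesgue_on {0..t}) (\<lambda>s. u s (?P k s x)) (?I (?P k) t x)"
    if "t \<in> {0..1}" for k t x
    by (rule step(1)[OF inv1 inv2 that])
  have diff: "t \<in> {0..1} \<Longrightarrow> norm (?P (Suc k) t x - ?P k t x) \<le> (1 / 2) ^ k" for k t x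
  proof (induction k arbitrary: t)
    case 0
    have "norm (?I (?P 0) t x) \<le> (\<integral>s. ?L s \<partial>lebesgue_on {0..1})"
      by (rule integral_bound_unit_interval[OF 0 step(1)[OF inv1 inv2 0] L]) (use usup in auto)
    then show ?case using small(2) by simp
  next
    case (Suc k)
    have "norm (?I (?P (Suc k)) t x - ?I (?P k) t x) \<le> (1 / 2) ^ k / 2"
      by (rule contr[of t "?P (Suc k)" x _ "?P k", OF Suc.prems Pint[OF Suc.prems] Pint[OF Suc.prems] Suc.IH])
    then show ?case by simp
  qed
  \<comment> \<open>The subtracted tail makes the induction on m close: passing from m to m + 1 it
    releases exactly (1 / 2) ^ (k + m), the size of the new increment.\<close>
  have rate: "norm (?P (k + m) t x - ?P k t x) \<le> 2 * (1 / 2) ^ k - 2 * (1 / 2) ^ (k + m)" if t: "t \<in> {0..1}" for k m t x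
  proof (induction m)
    case (Suc m)
    have "norm (?P (k + Suc m) t x - ?P k t x) \<le>
        norm (?P (Suc (k + m)) t x - ?P (k + m) t x) + norm (?P (k + m) t x - ?P k t x)"
      using norm_triangle_ineq[of "?P (Suc (k + m)) t x - ?P (k + m) t x" "?P (k + m) t x - ?P k t x"] by simp
    with Suc diff[OF t, of "k + m" x] show ?case by simp
  qed simp
  have rate': "norm (?P i t x - ?P k t x) \<le> 2 * (1 / 2) ^ k" if "t \<in> {0..1}" "k \<le> i" for i k t x
  proof -
    have "norm (?P i t x - ?P k t x) \<le> 2 * (1 / 2) ^ k - 2 * (1 / 2) ^ i"
      using rate[OF that(1), of k "i - k" x] that(2) by simp
    moreover have "0 \<le> 2 * (1 / 2 :: real) ^ i" by simp
    ultimately show ?thesis by linarith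
  qed
  have pow0: "(\<lambda>k. 2 * (1 / 2 :: real) ^ k) \<longlonglongrightarrow> 0"
    using tendsto_mult[OF tendsto_const LIMSEQ_power_zero[of "1 / 2 :: real"], of 2] by simp
  have pow: "\<exists>k. 2 * (1 / 2 :: real) ^ k < e" if "0 < e" for e
    using order_tendstoD(2)[OF pow0 that] by (meson eventually_happens sequentially_bot)
  define \<Phi> where "\<Phi> = (\<lambda>t x. lim (\<lambda>k. ?P k t x))"
  have lim: "(\<lambda>k. ?P k t x) \<longlonglongrightarrow> \<Phi> t x" if t: "t \<in> {0..1}" for t x
  proof -
    have "Cauchy (\<lambda>k. ?P k t x)"
    proof (rule CauchyI)
      fix e :: real assume "0 < e"
      then obtain k where k: "2 * (1 / 2 :: real) ^ k < e / 2" using pow[of "e / 2"] by auto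
      have "norm (?P i t x - ?P j t x) < e" if "i \<ge> k" "j \<ge> k" for i j
        using rate'[OF t that(1), of x] rate'[OF t that(2), of x] that k
          norm_triangle_ineq4[of "?P i t x - ?P k t x" "?P j t x - ?P k t x"] by simp
      then show "\<exists>M. \<forall>m\<ge>M. \<forall>n\<ge>M. norm (?P m t x - ?P n t x) < e" by blast
    qed
    then show ?thesis
      unfolding \<Phi>_def using Cauchy_convergent convergent_LIMSEQ_iff by blast
  qed
  have lrate: "norm (\<Phi> t x - ?P k t x) \<le> 2 * (1 / 2) ^ k" if t: "t \<in> {0..1}" for t x k
  proof (rule LIMSEQ_le_const2)
    show "(\<lambda>i. norm (?P i t x - ?P k t x)) \<longlonglongrightarrow> norm (\<Phi> t x - ?P k t x)"
      by (intro tendsto_norm tendsto_diff lim t tendsto_const)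
  qed (use rate'[OF t] in blast)
  have unif: "uniform_limit UNIV (\<lambda>k x. ?P k t x - x) (\<lambda>x. \<Phi> t x - x) sequentially" if t: "t \<in> {0..1}" for t
  proof (rule uniform_limitI)
    fix e :: real assume "0 < e"
    from order_tendstoD(2)[OF pow0 this]
    show "\<forall>\<^sub>F k in sequentially. \<forall>x\<in>UNIV. dist (?P k t x - x) (\<Phi> t x - x) < e"
    proof eventually_elim
      case (elim k)
      then show ?case
        using lrate[OF t, of _ k] by (auto simp: dist_norm norm_minus_commute intro: le_less_trans)
    qed
  qed
  have bd: "holder_bd n \<beta> r (\<lambda>x. \<Phi> t x - x)" if t: "t \<in> {0..1}" for t
    by (rule holder_bd_uniform_limit[OF \<beta> unif[OF t] inv1[OF t]])
  have sc: "sup_continuous \<Phi>"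
    unfolding sup_continuous_def
  proof (intro ballI allI impI)
    fix s \<epsilon> :: real assume s: "s \<in> {0..1}" and \<epsilon>: "0 < \<epsilon>"
    then have e3: "0 < \<epsilon> / 3" by simp
    obtain k where k: "2 * (1 / 2 :: real) ^ k < \<epsilon> / 3" using pow[OF e3] by auto
    obtain \<delta> where \<delta>: "\<delta> > 0" "\<And>q x. q \<in> {0..1} \<Longrightarrow> \<bar>q - s\<bar> < \<delta> \<Longrightarrow> norm (?P k q x - ?P k s x) \<le> \<epsilon> / 3"
      using inv2[of k] s e3 unfolding sup_continuous_def by meson
    have "norm (\<Phi> q x - \<Phi> s x) \<le> \<epsilon>" if q: "q \<in> {0..1}" "\<bar>q - s\<bar> < \<delta>" for q x
    proof -
      have "\<Phi> q x - \<Phi> s x = (\<Phi> q x - ?P k q x) + (?P k q x - ?P k s x) - (\<Phi> s x - ?P k s x)" by simp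
      then have "norm (\<Phi> q x - \<Phi> s x) \<le> norm (\<Phi> q x - ?P k q x) + norm (?P k q x - ?P k s x) + norm (\<Phi> s x - ?P k s x)"
        by (metis norm_triangle_ineq4 norm_triangle_le add_right_mono norm_triangle_ineq order_trans)
      then show ?thesis using lrate[OF q(1), of x k] lrate[OF s, of x k] \<delta>(2)[OF q, of x] k by linarith
    qed
    then show "\<exists>\<delta>>0. \<forall>q\<in>{0..1}. \<bar>q - s\<bar> < \<delta> \<longrightarrow> (\<forall>x. norm (\<Phi> q x - \<Phi> s x) \<le> \<epsilon>)"
      using \<delta>(1) by blast
  qed
  have I: "?I \<Phi> t x = \<Phi> t x - x" if t: "t \<in> {0..1}" for t x
  proof -
    have "norm (?I \<Phi> t x - ?I (?P k) t x) \<le> 2 * (1 / 2) ^ k / 2" for k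
      by (rule contr[of t \<Phi> x _ "?P k", OF t step(1)[OF bd sc t] Pint[OF t] lrate])
    then have "(\<lambda>k. ?I \<Phi> t x - ?I (?P k) t x) \<longlonglongrightarrow> 0"
      using tendsto_divide[OF pow0 tendsto_const[of 2]]
      by (intro Lim_null_comparison[of "\<lambda>k. ?I \<Phi> t x - ?I (?P k) t x" "\<lambda>k. 2 * (1 / 2) ^ k / 2"] always_eventually) auto
    from tendsto_diff[OF tendsto_const[of "?I \<Phi> t x"] this]
    have "(\<lambda>k. ?I (?P k) t x) \<longlonglongrightarrow> ?I \<Phi> t x" by simp
    moreover have "(\<lambda>k. ?P (Suc k) t x - x) \<longlonglongrightarrow> \<Phi> t x - x"
      by (intro tendsto_diff tendsto_const LIMSEQ_Suc[OF lim[OF t]])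
    then have "(\<lambda>k. ?I (?P k) t x) \<longlonglongrightarrow> \<Phi> t x - x" by simp
    ultimately show ?thesis by (rule LIMSEQ_unique)
  qed
  have "integral_flow u \<Phi>"
    unfolding integral_flow_def
  proof (intro ballI allI)
    show "has_bochner_integral (lebesgue_on {0..t}) (\<lambda>s. u s (\<Phi> s x)) (\<Phi> t x - x)" if t: "t \<in> {0..1}" for t x
      using step(1)[OF bd sc t, of x] unfolding I[OF t] .
  qed
  moreover have "((\<lambda>x. \<Phi> t x - x) \<longlongrightarrow> 0) at_infinity" if t: "t \<in> {0..1}" for t
    using step(3)[OF bd sc t] I[OF t] by simp
  ultimately show ?thesis using bd by blast
qed

lemma det_matrix_near_identity:
  "\<exists>r>0. \<forall>D :: real ^ 'd \<Rightarrow> real ^ 'd. (\<forall>v. norm (D v) \<le> r * norm v) \<longrightarrow> 0 < det (matrix (\<lambda>v. v + D v))"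
proof -
  have "continuous_on UNIV (det :: real ^ 'd ^ 'd \<Rightarrow> real)"
    unfolding det_def by (intro continuous_intros)
  then obtain \<delta> where \<delta>: "\<delta> > 0" "\<And>A :: real ^ 'd ^ 'd. dist A (mat 1) < \<delta> \<Longrightarrow> dist (det A) (det (mat 1 :: real ^ 'd ^ 'd)) < 1"
    unfolding continuous_on_iff by (metis UNIV_I zero_less_one)
  define d where "d = real CARD('d)"
  have d: "d > 0" by (simp add: d_def)
  \<comment> \<open>Each of the d * d matrix entries is at most r, so their sum is at most \<delta>
    / 2.\<close>
  define r where "r = \<delta> / (2 * d * d)"
  have r: "r > 0" using \<delta> d by (simp add: r_def)
  have "0 < det (matrix (\<lambda>v. v + D v))" if D: "\<And>v. norm (D v) \<le> r * norm v" for D :: "real ^ 'd \<Rightarrow> real ^ 'd"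
  proof -
    have "matrix (\<lambda>v. v + D v) - mat 1 = matrix D"
      by (simp add: matrix_def mat_def vec_eq_iff axis_def)
    then have "dist (matrix (\<lambda>v. v + D v)) (mat 1) = norm (matrix D)" by (simp add: dist_norm)
    also have "\<dots> \<le> (\<Sum>i\<in>UNIV. norm (matrix D $ i))"
      unfolding norm_vec_def by (rule L2_set_le_sum) (simp add: L2_set_nonneg)
    also have "\<dots> \<le> (\<Sum>i\<in>(UNIV::'d set). \<Sum>j\<in>(UNIV::'d set). \<bar>matrix D $ i $ j\<bar>)"
      by (intro sum_mono norm_le_l1_cart)
    also have "\<dots> \<le> (\<Sum>i\<in>(UNIV::'d set). \<Sum>j\<in>(UNIV::'d set). r)"
    proof (intro sum_mono)
      fix i j :: 'd
      have "\<bar>matrix D $ i $ j\<bar> \<le> norm (D (axis j 1))"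
        by (simp add: matrix_def component_le_norm_cart)
      also have "\<dots> \<le> r" using D[of "axis j 1"] by (simp add: norm_axis_1)
      finally show "\<bar>matrix D $ i $ j\<bar> \<le> r" .
    qed
    also have "\<dots> = \<delta> / 2" using d by (simp add: r_def d_def)
    also have "\<dots> < \<delta>" using \<delta> by simp
    finally have "dist (det (matrix (\<lambda>v. v + D v))) 1 < 1" using \<delta>(2) by simp
    then show ?thesis by (simp add: dist_real_def)
  qed
  then show ?thesis using r by blast
qed

lemma has_derivative_perturbed_identity:
  assumes "holder_bd n \<gamma> M (\<lambda>x. \<phi> x - x)" "n \<ge> 1"
  shows "(\<phi> has_derivative (\<lambda>v. v + dirder (\<lambda>x. \<phi> x - x) v x)) (at x)"
proof -
  have "((\<lambda>x. x + (\<phi> x - x)) has_derivative (\<lambda>v. v + dirder (\<lambda>x. \<phi> x - x) v x)) (at x)"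
    using assms by (intro has_derivative_add has_derivative_ident has_derivative_dirder holder_bd_differentiable)
  then show ?thesis by simp
qed

text \<open>The threshold is fixed before u: the radius r comes from the determinant condition and C
  from composition on that ball. Uniformity in u lets the same threshold serve every piece of a cut
  field.\<close>

lemma small_bounded_flow_exists:
  assumes \<beta>: "0 < \<beta>" "\<beta> \<le> 1" and n: "n \<ge> 1"
  shows "\<exists>\<epsilon>>0. \<forall>u :: real \<Rightarrow> real ^ 'd \<Rightarrow> real ^ 'd. bochner_field n \<beta> u \<longrightarrow>
    (\<integral>s. enn2real (holder_norm n \<beta> (u s)) \<partial>lebesgue_on {0..1}) \<le> \<epsilon> \<longrightarrow> (\<exists>\<Phi>. bounded_flow n \<beta> u \<Phi>)"
proof -
  obtain r where r: "r > 0" and det: "\<And>D :: real ^ 'd \<Rightarrow> real ^ 'd. (\<forall>v. norm (D v) \<le> r * norm v) \<Longrightarrow> 0 < det (matrix (\<lambda>v. v + D v))"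
    using det_matrix_near_identity by blast
  obtain C where C1: "C \<ge> 1" and C: "\<forall>(w :: real ^ 'd \<Rightarrow> real ^ 'd) \<phi> K. holder_bd n \<beta> K w \<longrightarrow> holder_bd n \<beta> r (\<lambda>x. \<phi> x - x) \<longrightarrow>
      holder_bd n \<beta> (C * K) (\<lambda>x. w (\<phi> x))"
    using holder_bd_comp[OF \<beta> less_imp_le[OF r] n] by blast
  \<comment> \<open>1/2 is for the contraction, r / C for the invariance of the ball.\<close>
  define \<epsilon> where "\<epsilon> = min (1 / 2) (r / C)"
  have \<epsilon>: "\<epsilon> > 0" using r C1 by (simp add: \<epsilon>_def)
  have "\<exists>\<Phi>. bounded_flow n \<beta> u \<Phi>" if u: "bochner_field n \<beta> u"
    and small: "(\<integral>s. enn2real (holder_norm n \<beta> (u s)) \<partial>lebesgue_on {0..1}) \<le> \<epsilon>" for u :: "real \<Rightarrow> real ^ 'd \<Rightarrow> real ^ 'd"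
  proof -
    have s1: "C * (\<integral>s. enn2real (holder_norm n \<beta> (u s)) \<partial>lebesgue_on {0..1}) \<le> r"
      using small C1 by (simp add: \<epsilon>_def field_simps)
    have s2: "(\<integral>s. enn2real (holder_norm n \<beta> (u s)) \<partial>lebesgue_on {0..1}) \<le> 1 / 2"
      using small by (simp add: \<epsilon>_def)
    obtain \<Phi> where \<Phi>: "\<And>t. t \<in> {0..1} \<Longrightarrow> holder_bd n \<beta> r (\<lambda>x. \<Phi> t x - x)"
      "\<forall>t\<in>{0..1}. ((\<lambda>x. \<Phi> t x - x) \<longlongrightarrow> 0) at_infinity" "integral_flow u \<Phi>"
      using picard_limit_exists[OF \<beta> n u less_imp_le[OF r] C1 C s1 s2] by blast
    obtain m where m: "n = Suc m" using n by (cases n) auto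
    have "0 < det (matrix (frechet_derivative (\<Phi> t) (at x)))" if t: "t \<in> {0..1}" for t x
      using frechet_derivative_at[OF has_derivative_perturbed_identity[OF \<Phi>(1)[OF t] n], of x]
        det[of "\<lambda>v. dirder (\<lambda>x. \<Phi> t x - x) v x"] norm_dirder_le[OF \<Phi>(1)[OF t, unfolded m]]
      by simp
    then show ?thesis using \<Phi> unfolding bounded_flow_def by blast
  qed
  then show ?thesis using \<epsilon> by blast
qed


section \<open>Concatenation of flows\<close>

lemma holder_norm_zero: "0 < \<gamma> \<Longrightarrow> holder_norm n \<gamma> (0 :: 'a::euclidean_space \<Rightarrow> 'b::euclidean_space) = 0"
  using holder_norm_leI[OF _ holder_bd_zero, of \<gamma> n] by (simp add: zero_fun_def)

text \<open>Cutting off by zero, instead of rescaling time, keeps every piece a field on [0,1], so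
  the small-field result applies unchanged.\<close>

lemma bochner_field_restrict:
  fixes u :: "real \<Rightarrow> 'a::euclidean_space \<Rightarrow> 'a"
  assumes \<beta>: "0 < \<beta>" "\<beta> \<le> 1" and u: "bochner_field n \<beta> u" and A: "A \<in> sets (lebesgue_on {0..1})"
  shows "bochner_field n \<beta> (\<lambda>s. if s \<in> A then u s else 0)"
proof -
  interpret B: normed_carrier "C0_holder n \<beta>" "holder_norm n \<beta> :: ('a \<Rightarrow> 'a) \<Rightarrow> ennreal"
    by (rule normed_carrier_C0_holder[OF \<beta>])
  have um: "strongly_measurable_in (C0_holder n \<beta>) (holder_norm n \<beta>) (lebesgue_on {0..1}) u"
    and L: "integrable (lebesgue_on {0..1}) (\<lambda>s. enn2real (holder_norm n \<beta> (u s)))"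
    using u by (auto simp: bochner_field_def)
  obtain s where s: "\<And>i. simple_function (lebesgue_on {0..1}) (s i)" "\<And>i. s i ` space (lebesgue_on {0..1}) \<subseteq> C0_holder n \<beta>"
    and uE: "\<And>x. x \<in> space (lebesgue_on {0..1}) \<Longrightarrow> u x \<in> C0_holder n \<beta>"
    and lim: "AE x in lebesgue_on {0..1}. (\<lambda>i. holder_norm n \<beta> (u x - s i x)) \<longlonglongrightarrow> 0"
    using um unfolding strongly_measurable_in_def by blast
  define q where "q = (\<lambda>i x. if x \<in> A then s i x else 0)"
  have "simple_function (lebesgue_on {0..1}) (q i)" for i
    unfolding q_def
  proof (intro simple_function_If s simple_function_const)
    have "{x \<in> space (lebesgue_on {0..1}). x \<in> A} = A" using sets.sets_into_space[OF A] by blast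
    then show "{x \<in> space (lebesgue_on {0..1}). x \<in> A} \<in> sets (lebesgue_on {0..1})" using A by simp
  qed
  moreover have "q i ` space (lebesgue_on {0..1}) \<subseteq> C0_holder n \<beta>" for i
    using s(2)[of i] B.zero_mem by (auto simp: q_def)
  moreover have "AE x in lebesgue_on {0..1}. (\<lambda>i. holder_norm n \<beta> ((if x \<in> A then u x else 0) - q i x)) \<longlonglongrightarrow> 0"
    using lim by eventually_elim (auto simp: q_def holder_norm_zero[OF \<beta>(1)])
  ultimately have "strongly_measurable_in (C0_holder n \<beta>) (holder_norm n \<beta>) (lebesgue_on {0..1}) (\<lambda>s. if s \<in> A then u s else 0)"
    unfolding strongly_measurable_in_def using uE B.zero_mem by (intro conjI exI[of _ q]) auto
  moreover have "integrable (lebesgue_on {0..1}) (\<lambda>s. indicator A s *\<^sub>R enn2real (holder_norm n \<beta> (u s)))"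
    by (rule integrable_mult_indicator[OF A L])
  moreover have "(\<lambda>s. indicator A s *\<^sub>R enn2real (holder_norm n \<beta> (u s))) = (\<lambda>s. enn2real (holder_norm n \<beta> (if s \<in> A then u s else 0)))"
    by (auto simp: holder_norm_zero[OF \<beta>(1)])
  ultimately show ?thesis by (simp add: bochner_field_def)
qed

text \<open>\<open>\<Phi>2\<close> is the identity before time \<open>a\<close>, and \<open>\<Phi>1\<close> is constant after it.\<close>

lemma bounded_flow_concat:
  fixes u :: "real \<Rightarrow> real ^ 'd \<Rightarrow> real ^ 'd"
  assumes \<beta>: "0 < \<beta>" "\<beta> \<le> 1" and n: "n \<ge> 1" and a: "a \<in> {0..1}"
    and \<Phi>1: "bounded_flow n \<beta> (\<lambda>s. if s \<in> {0..<a} then u s else 0) \<Phi>1"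
    and \<Phi>2: "bounded_flow n \<beta> (\<lambda>s. if s \<in> {a..1} then u s else 0) \<Phi>2"
  shows "bounded_flow n \<beta> u (\<lambda>t. \<Phi>2 t \<circ> \<Phi>1 t)"
proof -
  obtain M1 where M1: "\<And>t. t \<in> {0..1} \<Longrightarrow> holder_bd n \<beta> M1 (\<lambda>x. \<Phi>1 t x - x)"
    using \<Phi>1 unfolding bounded_flow_def by blast
  obtain M2 where M2: "\<And>t. t \<in> {0..1} \<Longrightarrow> holder_bd n \<beta> M2 (\<lambda>x. \<Phi>2 t x - x)"
    using \<Phi>2 unfolding bounded_flow_def by blast
  have int1: "has_bochner_integral (lebesgue_on {0..t}) (\<lambda>s. (if s \<in> {0..<a} then u s else 0) (\<Phi>1 s x)) (\<Phi>1 t x - x)"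
    and int2: "has_bochner_integral (lebesgue_on {0..t}) (\<lambda>s. (if s \<in> {a..1} then u s else 0) (\<Phi>2 s x)) (\<Phi>2 t x - x)"
    if "t \<in> {0..1}" for t x
    using \<Phi>1 \<Phi>2 that unfolding bounded_flow_def integral_flow_def by blast+
  have M1_0: "0 \<le> M1" using holder_bd_nonneg[OF M1[of 0]] by simp
  obtain C where C: "\<forall>(w :: real ^ 'd \<Rightarrow> real ^ 'd) \<phi> K. holder_bd n \<beta> K w \<longrightarrow> holder_bd n \<beta> M1 (\<lambda>x. \<phi> x - x) \<longrightarrow>
      holder_bd n \<beta> (C * K) (\<lambda>x. w (\<phi> x))"
    using holder_bd_comp[OF \<beta> M1_0 n] by blast
  \<comment> \<open>The first field vanishes from time a on, so the increment bound applies with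
    majorant 0.\<close>
  have \<Phi>1_const: "\<Phi>1 t x = \<Phi>1 a x" if "t \<in> {a..1}" for t x
  proof -
    have "norm ((\<Phi>1 t x - x) - (\<Phi>1 a x - x)) \<le> (\<integral>s. 0 \<partial>lebesgue_on {0..t}) - (\<integral>s. 0 \<partial>lebesgue_on {0..a})"
      using a that by (intro integral_increment_bound[OF _ _ _ int1 int1]) auto
    then show ?thesis by simp
  qed
  have \<Phi>2_id: "\<Phi>2 t x = x" if t: "t \<in> {0..<a}" for t x
  proof -
    have "has_bochner_integral (lebesgue_on {0..t}) (\<lambda>s. 0) (\<Phi>2 t x - x)"
    proof (rule has_bochner_integral_cong[THEN iffD1, OF refl _ refl int2])
      show "t \<in> {0..1}" using t a by auto
      show "(if s \<in> {a..1} then u s else 0) (\<Phi>2 s x) = 0" if "s \<in> space (lebesgue_on {0..t})" for s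
        using that t a by auto
    qed
    from has_bochner_integral_eq[OF this has_bochner_integral_zero] show ?thesis by simp
  qed
  have "integral_flow u (\<lambda>t. \<Phi>2 t \<circ> \<Phi>1 t)"
    unfolding integral_flow_def
  proof (intro ballI allI)
    fix t :: real and x assume t: "t \<in> {0..1}"
    \<comment> \<open>The second flow is started at \<open>?y\<close> for all t. Before a it rests,
      and from a on \<open>\<Phi>1 s x\<close> equals \<open>?y\<close>; so at each s one summand of
      the integrand is u along the composite and the other is 0.\<close>
    let ?y = "\<Phi>1 a x"
    have "has_bochner_integral (lebesgue_on {0..t})
        (\<lambda>s. (if s \<in> {0..<a} then u s else 0) (\<Phi>1 s x) + (if s \<in> {a..1} then u s else 0) (\<Phi>2 s ?y))
        ((\<Phi>1 t x - x) + (\<Phi>2 t ?y - ?y))"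
      by (rule has_bochner_integral_add[OF int1[OF t] int2[OF t]])
    moreover have "(\<Phi>1 t x - x) + (\<Phi>2 t ?y - ?y) = (\<Phi>2 t \<circ> \<Phi>1 t) x - x"
      using \<Phi>1_const[of t x] \<Phi>2_id[of t] t a by (cases "t < a") auto
    moreover have "(if s \<in> {0..<a} then u s else 0) (\<Phi>1 s x) + (if s \<in> {a..1} then u s else 0) (\<Phi>2 s ?y)
        = u s ((\<Phi>2 s \<circ> \<Phi>1 s) x)" if "s \<in> space (lebesgue_on {0..t})" for s
      using \<Phi>1_const[of s x] \<Phi>2_id[of s] that t a by (cases "s < a") auto
    ultimately show "has_bochner_integral (lebesgue_on {0..t}) (\<lambda>s. u s ((\<Phi>2 s \<circ> \<Phi>1 s) x)) ((\<Phi>2 t \<circ> \<Phi>1 t) x - x)"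
      by (subst (asm) has_bochner_integral_cong[OF refl]) auto
  qed
  moreover have "holder_bd n \<beta> (C * M2 + M1) (\<lambda>x. (\<Phi>2 t \<circ> \<Phi>1 t) x - x)" if t: "t \<in> {0..1}" for t
    using holder_bd_add[OF C[rule_format, OF M2[OF t] M1[OF t]] M1[OF t]] by simp
  moreover have "((\<lambda>x. (\<Phi>2 t \<circ> \<Phi>1 t) x - x) \<longlongrightarrow> 0) at_infinity" if t: "t \<in> {0..1}" for t
  proof -
    have "((\<lambda>x. \<Phi>2 t x - x) \<longlongrightarrow> 0) at_infinity" "((\<lambda>x. \<Phi>1 t x - x) \<longlongrightarrow> 0) at_infinity"
      using \<Phi>1 \<Phi>2 t unfolding bounded_flow_def by blast+
    from tendsto_add[OF tendsto_comp_at_infinity[OF this(1) holder_bd_norm[OF M1[OF t]]] this(2)]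
    show ?thesis by simp
  qed
  moreover have "0 < det (matrix (frechet_derivative (\<Phi>2 t \<circ> \<Phi>1 t) (at x)))" if t: "t \<in> {0..1}" for t x
  proof -
    let ?D1 = "frechet_derivative (\<Phi>1 t) (at x)"
    let ?D2 = "frechet_derivative (\<Phi>2 t) (at (\<Phi>1 t x))"
    have D: "\<Phi>1 t differentiable (at x)" "\<Phi>2 t differentiable (at (\<Phi>1 t x))"
      using has_derivative_perturbed_identity[OF M1[OF t] n] has_derivative_perturbed_identity[OF M2[OF t] n]
      unfolding differentiable_def by blast+
    have "frechet_derivative (\<Phi>2 t \<circ> \<Phi>1 t) (at x) = ?D2 \<circ> ?D1"
      using D by (intro frechet_derivative_compose) auto
    then have "matrix (frechet_derivative (\<Phi>2 t \<circ> \<Phi>1 t) (at x)) = matrix ?D2 ** matrix ?D1"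
      using D by (simp add: matrix_compose linear_frechet_derivative)
    moreover have "0 < det (matrix ?D1)" "0 < det (matrix ?D2)"
      using \<Phi>1 \<Phi>2 t unfolding bounded_flow_def by blast+
    ultimately show ?thesis by (simp add: det_mul)
  qed
  ultimately show ?thesis unfolding bounded_flow_def by blast
qed

text \<open>Induction on the number k of threshold portions in the integral of the norms. The
  intermediate value theorem cuts at a time a where exactly k portions are used up: the induction
  hypothesis handles the field before a, the small-field result the rest.\<close>

lemma bounded_flow_exists:
  fixes u :: "real \<Rightarrow> real ^ 'd \<Rightarrow> real ^ 'd"
  assumes \<beta>: "0 < \<beta>" "\<beta> \<le> 1" and n: "n \<ge> 1" and u: "bochner_field n \<beta> u"
  shows "\<exists>\<Phi>. bounded_flow n \<beta> u \<Phi>"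
proof -
  let ?L = "\<lambda>(u :: real \<Rightarrow> real ^ 'd \<Rightarrow> real ^ 'd) s. enn2real (holder_norm n \<beta> (u s))"
  obtain \<epsilon> where \<epsilon>: "\<epsilon> > 0" and small: "\<And>u :: real \<Rightarrow> real ^ 'd \<Rightarrow> real ^ 'd. bochner_field n \<beta> u \<Longrightarrow>
    (\<integral>s. ?L u s \<partial>lebesgue_on {0..1}) \<le> \<epsilon> \<Longrightarrow> \<exists>\<Phi>. bounded_flow n \<beta> u \<Phi>"
    using small_bounded_flow_exists[OF \<beta> n] by blast
  have "bochner_field n \<beta> u \<Longrightarrow> (\<integral>s. ?L u s \<partial>lebesgue_on {0..1}) \<le> real k * \<epsilon> \<Longrightarrow> \<exists>\<Phi>. bounded_flow n \<beta> u \<Phi>"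
    for k and u :: "real \<Rightarrow> real ^ 'd \<Rightarrow> real ^ 'd"
  proof (induction k arbitrary: u)
    case 0
    then show ?case using \<epsilon> by (intro small) auto
  next
    case (Suc k)
    let ?P = "\<lambda>t. \<integral>s. ?L u s \<partial>lebesgue_on {0..t}"
    have L: "integrable (lebesgue_on {0..1}) (?L u)" using Suc.prems(1) by (simp add: bochner_field_def)
    show ?case
    proof (cases "?P 1 \<le> real k * \<epsilon>")
      case True
      with Suc show ?thesis by blast
    next
      case False
      have P0: "?P 0 = 0"
        using has_bochner_integral_integral_eq[OF has_bochner_integral_null[of "{0..0::real}" "?L u"]] by simp
      have "continuous_on {0..1} ?P" by (rule indefinite_integral_continuous_real[OF L])
      then obtain a where a: "0 \<le> a" "a \<le> 1" "?P a = real k * \<epsilon>"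
        using IVT'[of ?P 0 "real k * \<epsilon>" 1] False P0 \<epsilon> by auto
      \<comment> \<open>Half-open at a: the two cutoffs have disjoint supports and add up to u, so
        their norms add up pointwise.\<close>
      define u1 where "u1 = (\<lambda>s. if s \<in> {0..<a} then u s else 0)"
      define u2 where "u2 = (\<lambda>s. if s \<in> {a..1} then u s else 0)"
      have sets: "{0..<a} \<in> sets (lebesgue_on {0..1})" "{a..1} \<in> sets (lebesgue_on {0..1})"
        using a by (auto simp: sets_restrict_space_iff)
      have u1: "bochner_field n \<beta> u1" and u2: "bochner_field n \<beta> u2"
        unfolding u1_def u2_def using bochner_field_restrict[OF \<beta> Suc.prems(1)] sets by blast+
      have L1: "integrable (lebesgue_on {0..1}) (?L u1)" and L2: "integrable (lebesgue_on {0..1}) (?L u2)"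
        using u1 u2 by (auto simp: bochner_field_def)
      have "(\<integral>s. ?L u2 s \<partial>lebesgue_on {0..1}) = (\<integral>s. indicator {a..1} s *\<^sub>R ?L u s \<partial>lebesgue_on {0..1})"
        by (intro Bochner_Integration.integral_cong) (auto simp: u2_def holder_norm_zero[OF \<beta>(1)])
      also have "\<dots> = (\<integral>s. ?L u s \<partial>restrict_space (lebesgue_on {0..1}) {a..1})"
        using sets(2) sets.sets_into_space[OF sets(2)]
        by (intro integral_restrict_space[symmetric]) (simp add: max_absorb1 a)
      also have "restrict_space (lebesgue_on {0..1}) {a..1} = lebesgue_on {a..1}"
        using a by (simp add: restrict_restrict_space max_absorb2)
      finally have I2: "(\<integral>s. ?L u2 s \<partial>lebesgue_on {0..1}) = ?P 1 - ?P a"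
        using integral_combine[OF L a(1,2)] by simp
      have "(\<integral>s. ?L u1 s \<partial>lebesgue_on {0..1}) = (\<integral>s. ?L u s - ?L u2 s \<partial>lebesgue_on {0..1})"
        by (intro Bochner_Integration.integral_cong) (auto simp: u1_def u2_def holder_norm_zero[OF \<beta>(1)])
      also have "\<dots> = ?P a" using L L2 I2 by simp
      finally have "(\<integral>s. ?L u1 s \<partial>lebesgue_on {0..1}) \<le> real k * \<epsilon>" using a(3) by simp
      then obtain \<Phi>1 where \<Phi>1: "bounded_flow n \<beta> u1 \<Phi>1" using Suc.IH[OF u1] by blast
      have "(\<integral>s. ?L u2 s \<partial>lebesgue_on {0..1}) \<le> \<epsilon>"
        using I2 a(3) Suc.prems(2) by (simp add: algebra_simps)
      then obtain \<Phi>2 where \<Phi>2: "bounded_flow n \<beta> u2 \<Phi>2" using small[OF u2] by blast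
      have "bounded_flow n \<beta> u (\<lambda>t. \<Phi>2 t \<circ> \<Phi>1 t)"
        using bounded_flow_concat[OF \<beta> n _ \<Phi>1[unfolded u1_def] \<Phi>2[unfolded u2_def]] a by simp
      then show ?thesis by blast
    qed
  qed
  moreover obtain k where "(\<integral>s. ?L u s \<partial>lebesgue_on {0..1}) / \<epsilon> \<le> real k" using real_arch_simple by blast
  then have "(\<integral>s. ?L u s \<partial>lebesgue_on {0..1}) \<le> real k * \<epsilon>" using \<epsilon> by (simp add: field_simps)
  ultimately show ?thesis using u by blast
qed

lemma bochner_integrable_in_imp_bochner_field:
  fixes u :: "real \<Rightarrow> 'a::euclidean_space \<Rightarrow> 'a"
  assumes "0 < \<beta>" "\<beta> \<le> 1"
    and "bochner_integrable_in (C0_holder n \<beta>) (holder_norm n \<beta>) (lebesgue_on {0..1}) u"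
  shows "bochner_field n \<beta> u"
proof -
  interpret B: normed_carrier "C0_holder n \<beta>" "holder_norm n \<beta> :: ('a \<Rightarrow> 'a) \<Rightarrow> ennreal"
    by (rule normed_carrier_C0_holder[OF assms(1,2)])
  obtain v where v: "has_bochner_integral_in (C0_holder n \<beta>) (holder_norm n \<beta>) (lebesgue_on {0..1}) u v"
    using assms(3) by (auto simp: bochner_integrable_in_def)
  have "complete_measure (lebesgue_on {0..1::real})" by (rule complete_measure_lebesgue_on) simp
  from B.integrable_nr[OF this v] v show ?thesis
    by (simp add: bochner_field_def has_bochner_integral_in_def B.nr_def)
qed

theorem theorem5p3:
  fixes n :: nat and \<alpha> \<beta> :: real
    and u :: "real \<Rightarrow> real ^ 'd \<Rightarrow> real ^ 'd"
  assumes "n \<ge> 1" and "0 < \<alpha>" and "\<alpha> < \<beta>" and "\<beta> \<le> 1"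
    and "bochner_integrable_in (C0_holder n \<beta>) (holder_norm n \<beta>) (lebesgue_on {0..1}) u"
  shows "\<exists>\<Phi>. strong_flow n \<alpha> u \<Phi> \<and>
    (\<forall>\<Psi>. strong_flow n \<alpha> u \<Psi> \<longrightarrow> (\<forall>t\<in>{0..1}. \<Psi> t = \<Phi> t))"
proof -
  have \<beta>: "0 < \<beta>" and \<alpha>: "\<alpha> \<le> 1" using assms by linarith+
  have u: "bochner_field n \<beta> u"
    by (rule bochner_integrable_in_imp_bochner_field[OF \<beta> assms(4,5)])
  obtain \<Phi> where \<Phi>: "bounded_flow n \<beta> u \<Phi>"
    using bounded_flow_exists[OF \<beta> assms(4,1) u] by blast
  have "strong_flow n \<alpha> u \<Phi>"
    by (rule bounded_flow_imp_strong_flow[OF assms(2-4,1) u \<Phi>])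
  \<comment> \<open>A competitor is controlled only in exponent \<alpha>. The comparison goes
    through the pointwise equation, where the Lipschitz constant comes from u alone.\<close>
  moreover have "\<Psi> t = \<Phi> t" if "strong_flow n \<alpha> u \<Psi>" "t \<in> {0..1}" for \<Psi> t
    using \<Phi> strong_flow_imp_integral_flow[OF assms(2) \<alpha> that(1)] that(2)
    by (intro integral_flow_unique[OF \<beta> assms(1) u]) (auto simp: bounded_flow_def)
  ultimately show ?thesis by blast
qed

end
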